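(* Let $G = U \times V$ be a finite group, where $U$ is a homocyclic group of odd order, and $V$ is trivial or one of the groups $\mathbb{Z}_{2^r}$, $\mathbb{Z}_2^r$ ($r \ge 1$) and the quaternion group $Q_8$ of order $8$. Then $G$ is a $3$-BCI-group.
   Context: All groups and graphs are finite. A group is homocyclic if it is a direct product of cyclic groups of the same order. For a group $G$ and a subset $S \subseteq G$, the bi-Cayley graph $\mathrm{BCay}(G,S)$ is the graph with vertex set $G \times \{0,1\}$ and edge set $\{\{(x,0),(sx,1)\} : x \in G, s \in S\}$; it is regular of valency $|S|$. The bi-Cayley graph $\mathrm{BCay}(G,S)$ is a BCI-graph if for every subset $T \subseteq G$, a graph isomorphism $\mathrm{BCay}(G,S) \cong \mathrm{BCay}(G,T)$ implies $T = gS^\alpha$ for some $g \in G$ and $\alpha \in \mathrm{Aut}(G)$, where $gS^\alpha = \{g\,s^\alpha : s \in S\}$. A group $G$ is an $m$-BCI-group if every bi-Cayley graph of $G$ of valency at most $m$ is a BCI-graph. *)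

theory Defs
  imports "HOL-Algebra.Algebra"
begin

section \<open>Graphs\<close>

text \<open>Finite simple graphs: an edge is an unordered pair, i.e. a two-element set of vertices.\<close>

record 'v graph =
  vertices :: "'v set"
  edges :: "'v set set"

definition graph_isomorphism :: "'v graph \<Rightarrow> 'w graph \<Rightarrow> ('v \<Rightarrow> 'w) \<Rightarrow> bool" where
  "graph_isomorphism \<Gamma> \<Delta> f \<longleftrightarrow>
     bij_betw f (vertices \<Gamma>) (vertices \<Delta>) \<and>
     (\<forall>u\<in>vertices \<Gamma>. \<forall>v\<in>vertices \<Gamma>. {u, v} \<in> edges \<Gamma> \<longleftrightarrow> {f u, f v} \<in> edges \<Delta>)"

definition graph_isomorphic :: "'v graph \<Rightarrow> 'w graph \<Rightarrow> bool" where
  "graph_isomorphic \<Gamma> \<Delta> \<longleftrightarrow> (\<exists>f. graph_isomorphism \<Gamma> \<Delta> f)"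

definition has_valency :: "'v graph \<Rightarrow> nat \<Rightarrow> bool" where
  "has_valency \<Gamma> d \<longleftrightarrow> (\<forall>v\<in>vertices \<Gamma>. card {e \<in> edges \<Gamma>. v \<in> e} = d)"


section \<open>Bi-Cayley graphs\<close>

definition BCay :: "('a, 'c) monoid_scheme \<Rightarrow> 'a set \<Rightarrow> ('a \<times> nat) graph" where
  "BCay G S =
     \<lparr> vertices = carrier G \<times> {0, 1},
       edges = {{(x, 0), (s \<otimes>\<^bsub>G\<^esub> x, 1)} | x s. x \<in> carrier G \<and> s \<in> S} \<rparr>"

lemma (in group) has_valency_BCay:
  assumes S: "S \<subseteq> carrier G"
  shows "has_valency (BCay G S) (card S)"
  unfolding has_valency_def
proof
  fix v assume "v \<in> vertices (BCay G S)"
  then obtain x i where v: "v = (x, i)" "x \<in> carrier G" "i = 0 \<or> i = 1"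
    by (auto simp: BCay_def)
  show "card {e \<in> edges (BCay G S). v \<in> e} = card S"
  proof (cases "i = 0")
    case True
    have "{e \<in> edges (BCay G S). v \<in> e} = (\<lambda>s. {(x, 0), (s \<otimes> x, 1)}) ` S"
      using v True by (auto simp: BCay_def)
    moreover have "inj_on (\<lambda>s. {(x, 0::nat), (s \<otimes> x, 1)}) S"
      using S v by (auto simp: inj_on_def doubleton_eq_iff subset_iff)
    ultimately show ?thesis by (simp add: card_image)
  next
    case False
    with v have i: "i = 1" by simp
    have cancel: "inv t \<otimes> (t \<otimes> y) = y" "t \<otimes> (inv t \<otimes> y) = y"
      if "t \<in> S" "y \<in> carrier G" for t y
      using that S by (simp_all add: m_assoc[symmetric] subset_iff)
    have "{e \<in> edges (BCay G S). v \<in> e} = (\<lambda>s. {(inv s \<otimes> x, 0), (x, 1)}) ` S"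
    proof (intro equalityI subsetI)
      fix e :: "('a \<times> nat) set" assume "e \<in> {e \<in> edges (BCay G S). v \<in> e}"
      then obtain y t where "e = {(y, 0), (t \<otimes> y, 1)}" "y \<in> carrier G" "t \<in> S" "x = t \<otimes> y"
        using v(1) i by (auto simp: BCay_def)
      then show "e \<in> (\<lambda>s. {(inv s \<otimes> x, 0), (x, 1)}) ` S"
        using cancel(1)[of t y] by (intro image_eqI[of _ _ t]) simp_all
    next
      fix e :: "('a \<times> nat) set" assume "e \<in> (\<lambda>s. {(inv s \<otimes> x, 0), (x, 1)}) ` S"
      then obtain s where s: "s \<in> S" "e = {(inv s \<otimes> x, 0), (x, 1)}" by blast
      then have "e = {(inv s \<otimes> x, 0), (s \<otimes> (inv s \<otimes> x), 1)}" "inv s \<otimes> x \<in> carrier G"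
        using cancel(2)[of s x] v(2) S by auto
      then have "e \<in> edges (BCay G S)"
        unfolding BCay_def using s(1) by auto
      with s(2) v(1) i show "e \<in> {e \<in> edges (BCay G S). v \<in> e}" by simp
    qed
    moreover have "inj_on (\<lambda>s. {(inv s \<otimes> x, 0::nat), (x, 1)}) S"
    proof (rule inj_onI)
      fix s t assume "s \<in> S" "t \<in> S"
        and "{(inv s \<otimes> x, 0::nat), (x, 1)} = {(inv t \<otimes> x, 0), (x, 1)}"
      then have "inv s = inv t" "s \<in> carrier G" "t \<in> carrier G"
        using S v(2) by (auto simp: doubleton_eq_iff subset_iff)
      then show "s = t" by (metis inv_inv)
    qed
    ultimately show ?thesis by (simp add: card_image)
  qed
qed

definition BCI_graph :: "('a, 'c) monoid_scheme \<Rightarrow> 'a set \<Rightarrow> bool" where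
  "BCI_graph G S \<longleftrightarrow>
     (\<forall>T. T \<subseteq> carrier G \<longrightarrow> graph_isomorphic (BCay G S) (BCay G T) \<longrightarrow>
       (\<exists>g\<in>carrier G. \<exists>\<alpha>\<in>auto G. T = g <#\<^bsub>G\<^esub> (\<alpha> ` S)))"

definition BCI_group :: "nat \<Rightarrow> ('a, 'c) monoid_scheme \<Rightarrow> bool" where
  "BCI_group m G \<longleftrightarrow>
     (\<forall>S. S \<subseteq> carrier G \<longrightarrow> (\<exists>d\<le>m. has_valency (BCay G S) d) \<longrightarrow> BCI_graph G S)"


section \<open>Groups\<close>

text \<open>
  The condition \<open>n > 0\<close> is needed because \<open>integer_mod_group 0\<close> is the infinite cyclic group.
\<close>

definition homocyclic :: "('a, 'c) monoid_scheme \<Rightarrow> bool" where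
  "homocyclic G \<longleftrightarrow>
     group G \<and> (\<exists>n k::nat. n > 0 \<and> G \<cong> product_group {..<k} (\<lambda>_. integer_mod_group n))"

text \<open>
  \<open>Q\<^sub>8\<close> is the set of unit quaternions \<open>\<plusminus>1, \<plusminus>i, \<plusminus>j, \<plusminus>k\<close> under Hamilton's product,
  where \<open>(a, b, c, d)\<close> stands for \<open>a + bi + cj + dk\<close>.
\<close>

fun quat_mult :: "int \<times> int \<times> int \<times> int \<Rightarrow> int \<times> int \<times> int \<times> int \<Rightarrow> int \<times> int \<times> int \<times> int" where
  "quat_mult (a, b, c, d) (a', b', c', d') =
     (a * a' - b * b' - c * c' - d * d',
      a * b' + b * a' + c * d' - d * c',
      a * c' - b * d' + c * a' + d * b',
      a * d' + b * c' - c * b' + d * a')"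

definition Q8 :: "(int \<times> int \<times> int \<times> int) monoid" where
  "Q8 =
     \<lparr> carrier = {(1, 0, 0, 0), (-1, 0, 0, 0), (0, 1, 0, 0), (0, -1, 0, 0),
                  (0, 0, 1, 0), (0, 0, -1, 0), (0, 0, 0, 1), (0, 0, 0, -1)},
       monoid.mult = quat_mult,
       one = (1, 0, 0, 0) \<rparr>"

lemma group_Q8: "group Q8"
proof (rule groupI)
  show "\<one>\<^bsub>Q8\<^esub> \<in> carrier Q8" by (simp add: Q8_def)
next
  fix x y assume "x \<in> carrier Q8" "y \<in> carrier Q8"
  then show "x \<otimes>\<^bsub>Q8\<^esub> y \<in> carrier Q8" by (auto simp: Q8_def)
next
  fix x y z :: "int \<times> int \<times> int \<times> int"
  show "x \<otimes>\<^bsub>Q8\<^esub> y \<otimes>\<^bsub>Q8\<^esub> z = x \<otimes>\<^bsub>Q8\<^esub> (y \<otimes>\<^bsub>Q8\<^esub> z)"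
    by (cases x; cases y; cases z) (simp add: Q8_def algebra_simps)
next
  fix x assume "x \<in> carrier Q8"
  then show "\<one>\<^bsub>Q8\<^esub> \<otimes>\<^bsub>Q8\<^esub> x = x" by (auto simp: Q8_def)
next
  fix x assume "x \<in> carrier Q8"
  then show "\<exists>y\<in>carrier Q8. y \<otimes>\<^bsub>Q8\<^esub> x = \<one>\<^bsub>Q8\<^esub>" by (auto simp: Q8_def)
qed

lemma order_Q8: "order Q8 = 8"
  by (simp add: order_def Q8_def)

end

theory Submission
  imports Defs
begin

text \<open>
  An isomorphism \<open>f\<close> between two bi-Cayley graphs sends the edge from \<open>(x, 0)\<close> to \<open>(s x, 1)\<close>, coloured by
  \<open>s\<close>, to an edge of some colour. If this colour depends on \<open>s\<close> only, then \<open>f\<close> restricts to an isomorphism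
  between the subgroups generated by the differences \<open>s\<inverse> t\<close>, which extends to an automorphism
  because the groups in question are homogeneous. For a cubic graph, the dependence on \<open>s\<close> only follows
  once paths with colours \<open>p q p\<close> can be told from paths with three distinct colours \<open>p q r\<close>.

  If the differences commute, every path \<open>p q r\<close> lies on the \<open>6\<close>-cycle \<open>p q r p q r\<close> (the graph is a
  quotient of the hexagonal lattice), so an edge surrounded by a path \<open>p q p\<close> on no \<open>6\<close>-cycle is
  harmless. Enumerating the closed words of length \<open>6\<close> shows that otherwise one of three short
  relations holds. Each of them, together with the order of the subgroup, determines the connection set
  up to equivalence; only for \<open>(p\<inverse> q)\<^sup>2 = \<one>\<close> does this use the restriction on the Sylow \<open>2\<close>-subgroup.

  In \<open>U \<times> Q\<^sub>8\<close> with noncommuting differences, a hexagon closes up only after two turns. Two adjacent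
  hexagons bound a closed walk of length \<open>10\<close>, and the set of such walks distinguishes the two kinds of
  paths, unless the \<open>U\<close>-components of two of the elements coincide. This exceptional case is the one in
  which there are closed words of length \<open>6\<close>, and it is again determined by the order of the subgroup.
\<close>

section \<open>Words and walks in bi-Cayley graphs\<close>

text \<open>Graphs are compared through one invariant: whether a path begins a closed walk without
  backtracking of a given length. It is applied to only one further colour \<open>p\<close> for each
  \<open>q\<close>: the edges at a vertex receive their colours through a bijection between sets of
  three elements, and two such bijections that agree on \<open>q\<close> and \<open>p\<close> agree
  on the third element too. In the exceptional cases colours are given up. There the order of the
  span, which is half the order of a connected component, fixes all relations between the
  differences once the type of the short relation is known. Fixing the vertex
  \<open>(\<one>, 0)\<close> has a price. An isomorphism may exchange the two sides, and undoing the
  exchange replaces \<open>T\<close> by the set of all \<open>inv t \<otimes> p\<close>. This set is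
  equivalent to \<open>T\<close> because inverting both generators of the span preserves their
  relations, also in the noncommuting case, where the relations in \<open>Q8\<close> are the same
  for all noncommuting pairs.\<close>

lemma mem_edges_BCay:
  "{u, v} \<in> edges (BCay G S) \<longleftrightarrow>
    (\<exists>x s. x \<in> carrier G \<and> s \<in> S \<and>
      (u = (x, 0) \<and> v = (s \<otimes>\<^bsub>G\<^esub> x, 1) \<or> v = (x, 0) \<and> u = (s \<otimes>\<^bsub>G\<^esub> x, 1)))"
  by (auto simp: BCay_def doubleton_eq_iff)

lemma edge_BCay: "x \<in> carrier G \<Longrightarrow> s \<in> S \<Longrightarrow> {(x, 0), (s \<otimes>\<^bsub>G\<^esub> x, 1)} \<in> edges (BCay G S)"
  by (auto simp: BCay_def)

lemma vertices_BCay [simp]: "vertices (BCay G S) = carrier G \<times> {0, 1}"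
  by (simp add: BCay_def)

context group
begin

lemma inv_mult_cancel [simp]:
  assumes "x \<in> carrier G" "y \<in> carrier G"
  shows "inv x \<otimes> (x \<otimes> y) = y" "x \<otimes> (inv x \<otimes> y) = y"
  using assms by (simp_all add: m_assoc[symmetric])

text \<open>
  A word \<open>p\<^sub>1 p\<^sub>2 p\<^sub>3 \<dots>\<close> over the connection set describes the walk from \<open>(x, 0)\<close> through
  \<open>(p\<^sub>1 x, 1)\<close>, \<open>(p\<^sub>2\<inverse> p\<^sub>1 x, 0)\<close>, \<open>(p\<^sub>3 p\<^sub>2\<inverse> p\<^sub>1 x, 1)\<close>, \<dots>; \<open>walk_end\<close> is the last vertex on side \<open>0\<close>.
\<close>

fun walk_end :: "'a \<Rightarrow> 'a list \<Rightarrow> 'a" where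
  "walk_end x [] = x"
| "walk_end x [p] = x"
| "walk_end x (p # q # w) = walk_end (inv q \<otimes> (p \<otimes> x)) w"

lemma walk_end_closed [simp]:
  "set w \<subseteq> carrier G \<Longrightarrow> x \<in> carrier G \<Longrightarrow> walk_end x w \<in> carrier G"
  by (induction x w rule: walk_end.induct) auto

text \<open>Right translations are automorphisms of every bi-Cayley graph, so whether a word closes
  up does not depend on the starting vertex.\<close>

lemma walk_end_mult:
  assumes "set w \<subseteq> carrier G" "x \<in> carrier G" "y \<in> carrier G"
  shows "walk_end (x \<otimes> y) w = walk_end x w \<otimes> y"
  using assms
proof (induction x w rule: walk_end.induct)
  case (3 x p q w)
  then have "walk_end (inv q \<otimes> (p \<otimes> x) \<otimes> y) w = walk_end (inv q \<otimes> (p \<otimes> x)) w \<otimes> y"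
    by simp
  with 3 show ?case by (simp add: m_assoc)
qed auto

text \<open>Equal neighbouring letters would retrace an edge, so these are closed walks without
  backtracking, also at the base point. Vertices may repeat. The even length brings the walk back to
  side \<open>0\<close>.\<close>

definition closed_word :: "'a set \<Rightarrow> 'a list \<Rightarrow> bool" where
  "closed_word S w \<longleftrightarrow> set w \<subseteq> S \<and> even (length w) \<and> w \<noteq> [] \<and> distinct_adj w \<and>
     last w \<noteq> hd w \<and> walk_end \<one> w = \<one>"

text \<open>The invariant of paths that start on side \<open>0\<close>; the prefix may have odd
  length and stop on side \<open>1\<close>.\<close>

definition extends_to_closed :: "nat \<Rightarrow> 'a set \<Rightarrow> 'a list \<Rightarrow> bool" where
  "extends_to_closed n S u \<longleftrightarrow> (\<exists>v. length (u @ v) = n \<and> closed_word S (u @ v))"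

text \<open>Since the generators are closed under inverses, the subgroup consists of their products.
  Left multiplication is the form that matches walks, whose double steps multiply by
  \<open>inv s \<otimes> t\<close> from the left.\<close>

lemma generate_left_induct [consumes 3, case_names one step]:
  assumes x: "x \<in> generate G A" and A: "A \<subseteq> carrier G" and Ainv: "\<And>a. a \<in> A \<Longrightarrow> inv a \<in> A"
    and one: "P \<one>" and step: "\<And>a y. a \<in> A \<Longrightarrow> y \<in> generate G A \<Longrightarrow> P y \<Longrightarrow> P (a \<otimes> y)"
  shows "P x"
proof -
  \<comment> \<open>Quantifying over the right factor \<open>y\<close> makes the product rule
    \<open>eng\<close> go through.\<close>
  have "\<forall>y\<in>generate G A. P y \<longrightarrow> P (x \<otimes> y)" using x
  proof (induction rule: generate.induct)
    case one
    then show ?case using A by (simp add: generate_in_carrier)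
  next
    case (incl h)
    then show ?case using step by blast
  next
    case (inv h)
    then show ?case using step Ainv by blast
  next
    case (eng h1 h2)
    then show ?case
      using A generate.eng[of _ G A] by (simp add: m_assoc generate_in_carrier)
  qed
  moreover have "x \<in> carrier G" using x A by (simp add: generate_in_carrier)
  ultimately show ?thesis using one generate.one[of G A] by force
qed

text \<open>Left quotients are unchanged by left translations of \<open>S\<close>. They are also the
  steps between vertices of side \<open>0\<close> with a common neighbour, so
  \<open>diff_span S\<close> is side \<open>0\<close> of the component of
  \<open>(\<one>, 0)\<close>.\<close>

definition differences :: "'a set \<Rightarrow> 'a set" where
  "differences S = (\<lambda>(s, t). inv s \<otimes> t) ` (S \<times> S)"

abbreviation diff_span :: "'a set \<Rightarrow> 'a set" where
  "diff_span S \<equiv> generate G (differences S)"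

lemma differences_carrier: "S \<subseteq> carrier G \<Longrightarrow> differences S \<subseteq> carrier G"
  by (auto simp: differences_def)

lemma differences_inv:
  assumes S: "S \<subseteq> carrier G" and a: "a \<in> differences S"
  shows "inv a \<in> differences S"
proof -
  from a obtain s t where "s \<in> S" "t \<in> S" "a = inv s \<otimes> t" by (auto simp: differences_def)
  moreover from this have "inv a = inv t \<otimes> s" using S by (simp add: inv_mult_group subset_iff)
  ultimately show ?thesis unfolding differences_def by (auto intro!: image_eqI[of _ _ "(t, s)"])
qed

lemma subgroup_diff_span: "S \<subseteq> carrier G \<Longrightarrow> subgroup (diff_span S) G"
  by (simp add: differences_carrier generate_is_subgroup)

lemma diff_span_induct [consumes 2, case_names one step]:
  assumes "x \<in> diff_span S" "S \<subseteq> carrier G" "P \<one>"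
    and "\<And>s t y. s \<in> S \<Longrightarrow> t \<in> S \<Longrightarrow> y \<in> diff_span S \<Longrightarrow> P y \<Longrightarrow> P (inv s \<otimes> (t \<otimes> y))"
  shows "P x"
proof (rule generate_left_induct[where P = P, OF assms(1) differences_carrier[OF assms(2)]])
  fix a y assume y: "a \<in> differences S" "y \<in> diff_span S" "P y"
  then obtain s t where "s \<in> S" "t \<in> S" "a = inv s \<otimes> t" by (auto simp: differences_def)
  moreover have "y \<in> carrier G"
    using y assms(2) generate_in_carrier differences_carrier by blast
  ultimately show "P (a \<otimes> y)" using assms(2) assms(4)[of s t y] y by (auto simp: m_assoc subset_iff)
qed (use assms differences_inv in auto)

end

section \<open>Graph isomorphisms that fix \<open>(\<one>, 0)\<close>, and the colours of image
  edges\<close>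

locale bicayley_iso = group G for G (structure) +
  fixes S T :: "'a set" and f :: "'a \<times> nat \<Rightarrow> 'a \<times> nat"
  assumes S: "S \<subseteq> carrier G" and T: "T \<subseteq> carrier G"
    and iso: "graph_isomorphism (BCay G S) (BCay G T) f"
    and base: "f (\<one>, 0) = (\<one>, 0)"
begin

lemma bij: "bij_betw f (carrier G \<times> {0, 1}) (carrier G \<times> {0, 1})"
  using iso by (simp add: graph_isomorphism_def)

lemma edge_iff:
  "u \<in> carrier G \<times> {0, 1} \<Longrightarrow> v \<in> carrier G \<times> {0, 1} \<Longrightarrow>
    {u, v} \<in> edges (BCay G S) \<longleftrightarrow> {f u, f v} \<in> edges (BCay G T)"
  using iso unfolding graph_isomorphism_def vertices_BCay by blast

text \<open>Fixing \<open>(\<one>, 0)\<close> only controls the component of this vertex; on other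
  components the isomorphism may still exchange the sides.\<close>

definition same_side :: "'a \<Rightarrow> bool" where
  "same_side x \<longleftrightarrow> x \<in> carrier G \<and> snd (f (x, 0)) = 0"

definition \<phi> :: "'a \<Rightarrow> 'a" where
  "\<phi> x = fst (f (x, 0))"

text \<open>The colour of the image of the edge from \<open>(x, 0)\<close> to \<open>(p x, 1)\<close>.\<close>

definition col :: "'a \<Rightarrow> 'a \<Rightarrow> 'a" where
  "col x p = fst (f (p \<otimes> x, 1)) \<otimes> inv (\<phi> x)"

lemma \<phi>_one [simp]: "\<phi> \<one> = \<one>" and same_side_one [simp]: "same_side \<one>"
  by (simp_all add: \<phi>_def same_side_def base)

lemma same_side_carrier: "same_side x \<Longrightarrow> x \<in> carrier G"
  by (simp add: same_side_def)

lemma f_same_side: "same_side x \<Longrightarrow> f (x, 0) = (\<phi> x, 0)"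
  by (simp add: \<phi>_def same_side_def prod_eq_iff)

lemma \<phi>_carrier [simp]: "same_side x \<Longrightarrow> \<phi> x \<in> carrier G"
  using bij bij_betwE by (fastforce simp: same_side_def \<phi>_def)

lemma \<phi>_inj: "same_side x \<Longrightarrow> same_side y \<Longrightarrow> \<phi> x = \<phi> y \<Longrightarrow> x = y"
  using bij f_same_side same_side_carrier
  by (metis Pair_inject SigmaI bij_betw_imp_inj_on inj_onD insertI1)

lemma col_step:
  assumes x: "same_side x" and p: "p \<in> S"
  shows "col x p \<in> T" "f (p \<otimes> x, 1) = (col x p \<otimes> \<phi> x, 1)"
proof -
  have [simp]: "x \<in> carrier G" "p \<in> carrier G" using x p S same_side_carrier by auto
  have "{(x, 0), (p \<otimes> x, 1)} \<in> edges (BCay G S)" using p by (simp add: edge_BCay del: One_nat_def)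
  then have "{(\<phi> x, 0), f (p \<otimes> x, 1)} \<in> edges (BCay G T)"
    using edge_iff[of "(x, 0)" "(p \<otimes> x, 1)"] f_same_side[OF x] by simp
  then obtain t where t: "t \<in> T" "f (p \<otimes> x, 1) = (t \<otimes> \<phi> x, 1)"
    by (auto simp: mem_edges_BCay)
  moreover from t have "t \<in> carrier G" using T by auto
  ultimately have "col x p = t"
    using x by (simp add: col_def m_assoc)
  with t show "col x p \<in> T" "f (p \<otimes> x, 1) = (col x p \<otimes> \<phi> x, 1)" by simp_all
qed

lemma col_carrier [simp]: "same_side x \<Longrightarrow> p \<in> S \<Longrightarrow> col x p \<in> carrier G"
  using col_step(1) T by blast

lemma same_side_step:
  assumes x: "same_side x" and p: "p \<in> S" and q: "q \<in> S"
  shows "same_side (inv q \<otimes> (p \<otimes> x))"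
proof -
  have [simp]: "x \<in> carrier G" "p \<in> carrier G" "q \<in> carrier G" using x p q S same_side_carrier by auto
  let ?y = "inv q \<otimes> (p \<otimes> x)"
  have "{(?y, 0), (p \<otimes> x, 1)} \<in> edges (BCay G S)" 
    using q edge_BCay[of ?y G q S] by (simp del: One_nat_def)
  then have "{f (?y, 0), (col x p \<otimes> \<phi> x, 1)} \<in> edges (BCay G T)"
    using edge_iff[of "(?y, 0)" "(p \<otimes> x, 1)"] col_step(2)[OF x p] by simp
  then show ?thesis by (auto simp: mem_edges_BCay same_side_def)
qed

lemma \<phi>_step:
  assumes x: "same_side x" and p: "p \<in> S" and q: "q \<in> S"
  shows "\<phi> (inv q \<otimes> (p \<otimes> x)) = inv (col (inv q \<otimes> (p \<otimes> x)) q) \<otimes> (col x p \<otimes> \<phi> x)"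
proof -
  have [simp]: "x \<in> carrier G" "p \<in> carrier G" "q \<in> carrier G" using x p q S same_side_carrier by auto
  let ?y = "inv q \<otimes> (p \<otimes> x)"
  have y: "same_side ?y" by (rule same_side_step[OF assms])
  have "q \<otimes> ?y = p \<otimes> x" by simp
  then have "col ?y q \<otimes> \<phi> ?y = col x p \<otimes> \<phi> x"
    using col_step(2)[OF y q] col_step(2)[OF x p] by simp
  then show ?thesis using x y p q inv_mult_cancel(1)[of "col ?y q" "\<phi> ?y"] by simp
qed

lemma col_inj:
  assumes x: "same_side x" and p: "p \<in> S" "p' \<in> S" and eq: "col x p = col x p'"
  shows "p = p'"
proof -
  have c: "x \<in> carrier G" "p \<in> carrier G" "p' \<in> carrier G" using x p S same_side_carrier by auto
  have "f (p \<otimes> x, 1) = f (p' \<otimes> x, 1)"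
    using col_step(2)[OF x p(1)] col_step(2)[OF x p(2)] eq by simp
  then have "(p \<otimes> x, 1::nat) = (p' \<otimes> x, 1)"
    by (rule inj_onD[OF bij_betw_imp_inj_on[OF bij]]) (use c in simp_all)
  then have "p \<otimes> x = p' \<otimes> x" by simp
  then show ?thesis using c by simp
qed

text \<open>Two image edges of the same colour that meet on side \<open>1\<close> coincide, so
  colours also separate the edges at a vertex of side \<open>1\<close>.\<close>

lemma col_inj_side1:
  assumes x: "same_side x" "same_side y" and p: "p \<in> S" "q \<in> S" and meet: "p \<otimes> x = q \<otimes> y"
    and eq: "col x p = col y q"
  shows "p = q"
proof -
  have c: "x \<in> carrier G" "y \<in> carrier G" "p \<in> carrier G" "q \<in> carrier G"
    using x p S same_side_carrier by auto
  have "col x p \<otimes> \<phi> x = col y q \<otimes> \<phi> y" using assms col_step(2) by (metis Pair_inject)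
  then have "\<phi> x = \<phi> y" using x p eq by simp
  then have "x = y" using \<phi>_inj x by blast
  with meet c show ?thesis by simp
qed

lemma col_image: assumes x: "same_side x" shows "col x ` S = T"
proof
  show "col x ` S \<subseteq> T" using col_step(1)[OF x] by blast
  show "T \<subseteq> col x ` S"
  proof
    fix t assume t: "t \<in> T"
    have [simp]: "x \<in> carrier G" "t \<in> carrier G" using x t T same_side_carrier by auto
    have "(t \<otimes> \<phi> x, 1) \<in> f ` (carrier G \<times> {0, 1})"
      using x bij_betw_imp_surj_on[OF bij] by simp
    then obtain v where v: "v \<in> carrier G \<times> {0, 1}" "f v = (t \<otimes> \<phi> x, 1)"
      by (elim imageE) metis
    have "{(\<phi> x, 0), (t \<otimes> \<phi> x, 1)} \<in> edges (BCay G T)" using t x by (simp add: edge_BCay del: One_nat_def)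
    then have "{(x, 0), v} \<in> edges (BCay G S)"
      using edge_iff[of "(x, 0)" v] v f_same_side[OF x] by simp
    then obtain p where p: "p \<in> S" "v = (p \<otimes> x, 1)" by (auto simp: mem_edges_BCay)
    then have "col x p \<otimes> \<phi> x = t \<otimes> \<phi> x" using v(2) col_step(2)[OF x] by simp
    then have "col x p = t" using x p by simp
    with p show "t \<in> col x ` S" by blast
  qed
qed

lemma bij_col: "same_side x \<Longrightarrow> bij_betw (col x) S T"
  by (simp add: bij_betw_def col_image inj_onI col_inj)

lemma card_eq: "card S = card T"
  using bij_col[OF same_side_one] bij_betw_same_card by blast

text \<open>Every edge is coloured from its end on side \<open>0\<close>; an edge traversed from
  side \<open>1\<close> therefore takes its colour at the vertex that the walk reaches next.\<close>

fun image_word :: "'a \<Rightarrow> 'a list \<Rightarrow> 'a list" where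
  "image_word x [] = []"
| "image_word x [p] = [col x p]"
| "image_word x (p # q # w) =
    col x p # col (inv q \<otimes> (p \<otimes> x)) q # image_word (inv q \<otimes> (p \<otimes> x)) w"

lemma length_image_word [simp]: "length (image_word x w) = length w"
  by (induction x w rule: image_word.induct) auto

lemma take_image_word: "take (length u) (image_word x (u @ v)) = image_word x u"
proof (induction x u rule: image_word.induct)
  case (2 x p)
  then show ?case by (cases v) auto
qed auto

lemma set_image_word: "same_side x \<Longrightarrow> set w \<subseteq> S \<Longrightarrow> set (image_word x w) \<subseteq> T"
  by (induction x w rule: image_word.induct) (auto simp: col_step(1) same_side_step)

lemma walk_end_image_word:
  "same_side x \<Longrightarrow> set w \<subseteq> S \<Longrightarrow> walk_end (\<phi> x) (image_word x w) = \<phi> (walk_end x w)"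
proof (induction x w rule: image_word.induct)
  case (3 x p q w)
  then show ?case using \<phi>_step[of x p q] same_side_step[of x p q] by auto
qed auto

lemma hd_image_word: "w \<noteq> [] \<Longrightarrow> hd (image_word x w) = col x (hd w)"
  by (cases "(x, w)" rule: image_word.cases) auto

lemma col_adj:
  assumes "same_side x" "p \<in> S" "q \<in> S" "p \<noteq> q"
  shows "col x p \<noteq> col (inv q \<otimes> (p \<otimes> x)) q"
proof -
  have "x \<in> carrier G" "p \<in> carrier G" "q \<in> carrier G" using assms S same_side_carrier by auto
  then have "p \<otimes> x = q \<otimes> (inv q \<otimes> (p \<otimes> x))" by simp
  then show ?thesis using assms col_inj_side1 same_side_step by metis
qed

lemma distinct_adj_image_word:
  "same_side x \<Longrightarrow> set w \<subseteq> S \<Longrightarrow> distinct_adj w \<Longrightarrow> distinct_adj (image_word x w)"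
proof (induction x w rule: image_word.induct)
  case (3 x p q w)
  let ?x = "inv q \<otimes> (p \<otimes> x)"
  have x: "same_side ?x" using 3 same_side_step by simp
  have w: "distinct_adj (image_word ?x w)" using 3 x by (auto dest: distinct_adj_ConsD)
  have pq: "col x p \<noteq> col ?x q" using 3 by (intro col_adj) auto
  show ?case
  proof (cases "w = []")
    case False
    then have "hd w \<noteq> q" "hd w \<in> S" using 3 by (auto simp: distinct_adj_Cons neq_Nil_conv)
    then have "col ?x q \<noteq> hd (image_word ?x w)"
      using 3 x False col_inj[of ?x q "hd w"] by (auto simp: hd_image_word)
    with w pq show ?thesis by (auto simp: distinct_adj_Cons)
  qed (use pq in simp)
qed auto

text \<open>In a word of even length the last edge is traversed towards side \<open>0\<close>, so
  its colour is read at the end of the walk.\<close>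

lemma last_image_word:
  "even (length w) \<Longrightarrow> w \<noteq> [] \<Longrightarrow> last (image_word x w) = col (walk_end x w) (last w)"
proof (induction x w rule: image_word.induct)
  case (3 x p q w)
  then show ?case by (cases "w = []") (auto simp: neq_Nil_conv dest: arg_cong[of _ _ length])
qed auto

lemma closed_word_image_word:
  assumes x: "same_side x" and w: "closed_word S w"
  shows "closed_word T (image_word x w)"
proof -
  have wS: "set w \<subseteq> S" "set w \<subseteq> carrier G" using w S by (auto simp: closed_word_def)
  have xc: "x \<in> carrier G" using x by (simp add: same_side_carrier)
  have e: "walk_end x w = x"
    using walk_end_mult[of w \<one> x] w wS xc by (simp add: closed_word_def)
  have wT: "set (image_word x w) \<subseteq> T" by (rule set_image_word[OF x wS(1)])
  have "walk_end (\<one> \<otimes> \<phi> x) (image_word x w) = \<phi> x"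
    using walk_end_image_word[OF x wS(1)] e x by simp
  then have "walk_end \<one> (image_word x w) \<otimes> \<phi> x = \<phi> x"
    using walk_end_mult[of "image_word x w" \<one> "\<phi> x"] wT T x by auto
  then have "walk_end \<one> (image_word x w) = \<one>"
    using r_cancel_one[of "\<phi> x" "walk_end \<one> (image_word x w)"] x wT T by simp
  moreover have "last (image_word x w) \<noteq> hd (image_word x w)"
  proof -
    have "last w \<in> S" "hd w \<in> S" using w by (auto simp: closed_word_def)
    then have "col x (last w) \<noteq> col x (hd w)"
      using w col_inj[OF x, of "last w" "hd w"] by (auto simp: closed_word_def)
    then show ?thesis using w e by (simp add: closed_word_def last_image_word hd_image_word)
  qed
  moreover have "image_word x w \<noteq> []" using w by (metis closed_word_def length_0_conv length_image_word)
  ultimately show ?thesis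
    using w wT distinct_adj_image_word[OF x wS(1)] by (simp add: closed_word_def)
qed

lemma extends_to_closed_image:
  assumes x: "same_side x" and u: "extends_to_closed n S u"
  shows "extends_to_closed n T (image_word x u)"
proof -
  from u obtain v where v: "length (u @ v) = n" "closed_word S (u @ v)"
    by (auto simp: extends_to_closed_def)
  have "image_word x (u @ v) = image_word x u @ drop (length u) (image_word x (u @ v))"
    using append_take_drop_id[of "length u" "image_word x (u @ v)"] by (simp add: take_image_word)
  then obtain v' where v': "image_word x (u @ v) = image_word x u @ v'" by blast
  then have "length (image_word x u @ v') = n" using v(1) by (metis length_image_word)
  with closed_word_image_word[OF x v(2)] v' show ?thesis
    unfolding extends_to_closed_def by metis
qed

definition f_inv :: "'a \<times> nat \<Rightarrow> 'a \<times> nat" where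
  "f_inv = inv_into (carrier G \<times> {0, 1}) f"

lemma f_inv_f: "v \<in> carrier G \<times> {0, 1} \<Longrightarrow> f_inv (f v) = v"
  unfolding f_inv_def by (rule bij_betw_inv_into_left[OF bij])

text \<open>Makes every statement about \<open>S\<close> and \<open>T\<close> available with the
  roles exchanged.\<close>

lemma bicayley_iso_inverse: "bicayley_iso G T S f_inv"
proof unfold_locales
  let ?g = f_inv
  have g: "bij_betw ?g (carrier G \<times> {0, 1}) (carrier G \<times> {0, 1})"
    unfolding f_inv_def by (rule bij_betw_inv_into[OF bij])
  show "graph_isomorphism (BCay G T) (BCay G S) ?g"
    unfolding graph_isomorphism_def vertices_BCay
  proof (intro conjI ballI g)
    fix u v :: "'a \<times> nat"
    assume uv: "u \<in> carrier G \<times> {0, 1}" "v \<in> carrier G \<times> {0, 1}"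
    then have "?g u \<in> carrier G \<times> {0, 1}" "?g v \<in> carrier G \<times> {0, 1}" "f (?g u) = u" "f (?g v) = v"
      using bspec[OF bij_betwE[OF g]] bij_betw_inv_into_right[OF bij] unfolding f_inv_def by blast+
    then show "{u, v} \<in> edges (BCay G T) \<longleftrightarrow> {?g u, ?g v} \<in> edges (BCay G S)"
      using edge_iff by metis
  qed
  show "?g (\<one>, 0) = (\<one>, 0)"
    using f_inv_f[of "(\<one>, 0)"] base by simp
qed (use S T in auto)

end

section \<open>Homogeneous groups and normal forms\<close>

text \<open>Ultrahomogeneity in the sense of model theory. It turns an isomorphism between the spans
  of two connection sets into the automorphism that a BCI-graph requires.\<close>

definition homogeneous :: "('a, 'b) monoid_scheme \<Rightarrow> bool" where
  "homogeneous G \<longleftrightarrow>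
     (\<forall>H \<phi>. subgroup H G \<longrightarrow> \<phi> \<in> hom (G\<lparr>carrier := H\<rparr>) G \<longrightarrow> inj_on \<phi> H \<longrightarrow>
       (\<exists>\<alpha>\<in>auto G. \<forall>x\<in>H. \<alpha> x = \<phi> x))"

lemma homogeneousD:
  assumes "homogeneous G" "subgroup H G" "inj_on \<phi> H"
    and "\<And>x y. x \<in> H \<Longrightarrow> y \<in> H \<Longrightarrow> \<phi> (x \<otimes>\<^bsub>G\<^esub> y) = \<phi> x \<otimes>\<^bsub>G\<^esub> \<phi> y"
    and "\<And>x. x \<in> H \<Longrightarrow> \<phi> x \<in> carrier G"
  obtains \<alpha> where "\<alpha> \<in> auto G" "\<And>x. x \<in> H \<Longrightarrow> \<alpha> x = \<phi> x"
proof -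
  have "\<phi> \<in> hom (G\<lparr>carrier := H\<rparr>) G" using assms(4,5) by (auto simp: hom_def)
  with assms(1-3) show ?thesis using that unfolding homogeneous_def by metis
qed

lemma (in group) auto_mult:
  "\<alpha> \<in> auto G \<Longrightarrow> x \<in> carrier G \<Longrightarrow> y \<in> carrier G \<Longrightarrow> \<alpha> (x \<otimes> y) = \<alpha> x \<otimes> \<alpha> y"
  "\<alpha> \<in> auto G \<Longrightarrow> x \<in> carrier G \<Longrightarrow> \<alpha> x \<in> carrier G"
  by (auto simp: auto_def hom_def)

text \<open>
  Two elements that commute up to a central element of order at most two. With \<open>z = \<one>\<close> this is a
  pair of commuting elements.
\<close>

locale commutator_pair = group G for G (structure) +
  fixes a b z :: 'a
  assumes a [simp]: "a \<in> carrier G" and b [simp]: "b \<in> carrier G" and z [simp]: "z \<in> carrier G"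
    and ba: "b \<otimes> a = z \<otimes> (a \<otimes> b)" and za: "z \<otimes> a = a \<otimes> z" and zb: "z \<otimes> b = b \<otimes> z"
    and zz: "z \<otimes> z = \<one>"
begin

text \<open>Only the parity of \<open>e\<close> matters, but an integer exponent lets products be
  computed by polynomial arithmetic.\<close>

definition nf :: "int \<Rightarrow> int \<Rightarrow> int \<Rightarrow> 'a" where
  "nf i j e = a [^] i \<otimes> (b [^] j \<otimes> z [^] e)"

lemma nf_closed [simp]: "nf i j e \<in> carrier G"
  by (simp add: nf_def)

text \<open>Conjugation by \<open>y\<close> is a homomorphism that fixes \<open>x\<close>, hence all
  powers of \<open>x\<close>.\<close>

lemma int_pow_commute:
  assumes "x \<in> carrier G" "y \<in> carrier G" "x \<otimes> y = y \<otimes> x"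
  shows "x [^] (i::int) \<otimes> y = y \<otimes> x [^] i"
proof -
  have h: "(\<lambda>g. inv y \<otimes> (g \<otimes> y)) \<in> hom G G"
    using assms by (auto simp: hom_def m_assoc)
  have "inv y \<otimes> (x [^] i \<otimes> y) = (inv y \<otimes> (x \<otimes> y)) [^] i"
    using hom_int_pow[OF h, of x i] assms by (simp add: is_group)
  also have "\<dots> = x [^] i" using assms by simp
  finally show ?thesis using assms by (metis int_pow_closed inv_mult_cancel(2) m_closed)
qed

lemma z_pow_even: "even k \<Longrightarrow> z [^] (k::int) = \<one>"
proof -
  assume "even k"
  then obtain l where "k = 2 * l" by (elim evenE)
  moreover have "z [^] (2::int) = \<one>" using int_pow_mult[of z 1 1] zz by simp
  ultimately show ?thesis by (simp flip: int_pow_pow)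
qed

lemma z_pow_parity: "even (k - l) \<Longrightarrow> z [^] (k::int) = z [^] (l::int)"
  using int_pow_mult[of z "k - l" l] z_pow_even[of "k - l"] by simp

text \<open>Conjugation by \<open>b\<close> sends \<open>a\<close> to \<open>z \<otimes> a\<close>,
  hence \<open>a [^] i\<close> to \<open>z [^] i \<otimes> a [^] i\<close>. Read as a statement
  about conjugation by \<open>a [^] i\<close>, this sends \<open>b\<close> to
  \<open>z [^] i \<otimes> b\<close>, and powers of \<open>b\<close> follow.\<close>

lemma b_pow_a_pow: "b [^] (j::int) \<otimes> a [^] (i::int) = a [^] i \<otimes> (b [^] j \<otimes> z [^] (i * j))"
proof -
  have zi: "z [^] k \<otimes> b [^] l = b [^] l \<otimes> z [^] k" "z [^] k \<otimes> a [^] l = a [^] l \<otimes> z [^] k" for k l :: int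
    by (metis int_pow_commute int_pow_closed a b z za zb)+
  have h: "(\<lambda>g. b \<otimes> (g \<otimes> inv b)) \<in> hom G G" by (auto simp: hom_def m_assoc)
  have "b \<otimes> (a \<otimes> inv b) = z \<otimes> a"
    using ba by (metis a b z inv_closed m_assoc m_closed r_inv r_one)
  then have "b \<otimes> (a [^] i \<otimes> inv b) = (z \<otimes> a) [^] i"
    using hom_int_pow[OF h, of a i] by (simp add: is_group)
  also have "\<dots> = z [^] i \<otimes> a [^] i" by (rule int_pow_mult_distrib[OF za]) simp_all
  finally have 1: "b \<otimes> a [^] i = a [^] i \<otimes> (z [^] i \<otimes> b)"
    using zi by (metis a b z int_pow_closed inv_closed m_assoc m_closed l_inv r_one)
  have h': "(\<lambda>g. inv (a [^] i) \<otimes> (g \<otimes> a [^] i)) \<in> hom G G" by (auto simp: hom_def m_assoc)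
  have "inv (a [^] i) \<otimes> (b \<otimes> a [^] i) = z [^] i \<otimes> b" using 1 by simp
  then have "inv (a [^] i) \<otimes> (b [^] j \<otimes> a [^] i) = (z [^] i \<otimes> b) [^] j"
    using hom_int_pow[OF h', of b j] by (simp add: is_group)
  also have "\<dots> = (z [^] i) [^] j \<otimes> b [^] j"
    using zb by (intro int_pow_mult_distrib int_pow_commute) simp_all
  also have "\<dots> = b [^] j \<otimes> z [^] (i * j)" using zi by (simp add: int_pow_pow)
  finally show ?thesis
    by (metis a b z int_pow_closed inv_mult_cancel(2) m_closed)
qed

lemma z_pow_central: "z [^] (k::int) \<otimes> nf i j e = nf i j e \<otimes> z [^] k"
proof -
  have zi: "z [^] k \<otimes> b [^] l = b [^] l \<otimes> z [^] k" "z [^] k \<otimes> a [^] l = a [^] l \<otimes> z [^] k" for k l :: int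
    by (metis int_pow_commute int_pow_closed a b z za zb)+
  have "z [^] k \<otimes> nf i j e = (z [^] k \<otimes> a [^] i) \<otimes> (b [^] j \<otimes> z [^] e)" by (simp add: nf_def m_assoc)
  also have "\<dots> = a [^] i \<otimes> ((z [^] k \<otimes> b [^] j) \<otimes> z [^] e)"
    by (simp only: zi(2)) (simp add: m_assoc)
  also have "\<dots> = a [^] i \<otimes> (b [^] j \<otimes> z [^] (k + e))"
    by (simp only: zi(1)) (simp add: m_assoc int_pow_mult)
  also have "\<dots> = nf i j e \<otimes> z [^] k" by (simp add: nf_def m_assoc add.commute flip: int_pow_mult)
  finally show ?thesis .
qed

text \<open>Moving \<open>b [^] j\<close> past \<open>a [^] k\<close> costs
  \<open>z [^] (j * k)\<close>, as in a Heisenberg group.\<close>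

lemma nf_mult: "nf i j e \<otimes> nf k l m = nf (i + k) (j + l) (e + m + j * k)"
proof -
  have "nf i j e \<otimes> nf k l m = a [^] i \<otimes> (b [^] j \<otimes> (z [^] e \<otimes> nf k l m))"
    by (simp add: nf_def m_assoc)
  also have "\<dots> = a [^] i \<otimes> ((b [^] j \<otimes> a [^] k) \<otimes> (b [^] l \<otimes> (z [^] m \<otimes> z [^] e)))"
    by (simp only: z_pow_central) (simp add: nf_def m_assoc)
  also have "\<dots> = (a [^] i \<otimes> a [^] k) \<otimes> (b [^] j \<otimes> ((z [^] (k * j) \<otimes> b [^] l) \<otimes> (z [^] m \<otimes> z [^] e)))"
    by (simp add: b_pow_a_pow m_assoc)
  also have "z [^] (k * j) \<otimes> b [^] l = b [^] l \<otimes> z [^] (k * j)"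
    by (metis int_pow_commute int_pow_closed b z zb)
  also have "(a [^] i \<otimes> a [^] k) \<otimes> (b [^] j \<otimes> ((b [^] l \<otimes> z [^] (k * j)) \<otimes> (z [^] m \<otimes> z [^] e))) =
      (a [^] i \<otimes> a [^] k) \<otimes> ((b [^] j \<otimes> b [^] l) \<otimes> (z [^] (k * j) \<otimes> (z [^] m \<otimes> z [^] e)))"
    by (simp add: m_assoc)
  also have "\<dots> = nf (i + k) (j + l) (k * j + (m + e))"
    by (simp add: nf_def flip: int_pow_mult)
  finally show ?thesis by (simp add: ac_simps)
qed

lemma nf_0 [simp]: "nf 0 0 0 = \<one>"
  by (simp add: nf_def)

lemma nf_a: "nf 1 0 0 = a" and nf_b: "nf 0 1 0 = b" and nf_z: "nf 0 0 e = z [^] e"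
  by (simp_all add: nf_def)

lemma nf_parity: "even (e - e') \<Longrightarrow> nf i j e = nf i j e'"
  by (simp add: nf_def z_pow_parity[of e e'])

lemma nf_inv: "inv (nf i j e) = nf (- i) (- j) (i * j - e)"
  by (rule inv_equality) (simp_all add: nf_mult algebra_simps)

lemma mult_a_nf: "a \<otimes> nf i j e = nf (i + 1) j e" "inv a \<otimes> nf i j e = nf (i - 1) j e"
  using nf_mult[of 1 0 0 i j e] nf_mult[of "- 1" 0 0 i j e] nf_inv[of 1 0 0] by (simp_all add: nf_a add.commute)

lemma mult_b_nf: "b \<otimes> nf i j e = nf i (j + 1) (e + i)" "inv b \<otimes> nf i j e = nf i (j - 1) (e + i)"
proof -
  show "b \<otimes> nf i j e = nf i (j + 1) (e + i)"
    using nf_mult[of 0 1 0 i j e] by (simp add: nf_b add.commute)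
  have "inv b \<otimes> nf i j e = nf i (j - 1) (e - i)"
    using nf_mult[of 0 "- 1" 0 i j e] nf_inv[of 0 1 0] by (simp add: nf_b add.commute)
  \<comment> \<open>As \<open>z\<close> has order at most two, \<open>e - i\<close> may be traded
    for \<open>e + i\<close>; multiplying and dividing by a letter then change the last exponent
    alike.\<close>
  also have "\<dots> = nf i (j - 1) (e + i)" by (rule nf_parity) simp
  finally show "inv b \<otimes> nf i j e = nf i (j - 1) (e + i)" .
qed

lemma subgroup_range_nf: "subgroup {nf i j e | i j e. True} G"
proof (rule subgroupI)
  show "inv x \<in> {nf i j e | i j e. True}" if "x \<in> {nf i j e | i j e. True}" for x
    using that nf_inv by blast
  show "x \<otimes> y \<in> {nf i j e | i j e. True}"
    if "x \<in> {nf i j e | i j e. True}" "y \<in> {nf i j e | i j e. True}" for x y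
    using that nf_mult by blast
qed auto

text \<open>Reduces equality of normal forms to triviality, so that the set of trivial exponent
  triples determines the subgroup generated by \<open>a\<close>, \<open>b\<close>,
  \<open>z\<close>.\<close>

lemma nf_eq_iff: "nf i j e = nf k l m \<longleftrightarrow> nf (k - i) (l - j) (i * j - e + m - j * k) = \<one>"
proof -
  have "nf i j e = nf k l m \<longleftrightarrow> inv (nf i j e) \<otimes> nf k l m = \<one>"
    by (metis inv_mult_cancel(2) l_inv nf_closed inv_closed r_one)
  then show ?thesis by (simp add: nf_inv nf_mult)
qed

end

text \<open>Equal sets of relations make the map between normal forms with the same exponents both
  well defined and injective.\<close>

lemma (in group) commutator_pairs_hom:
  assumes ab: "commutator_pair G a b z" and cd: "commutator_pair G c d z"
    and eq: "\<And>i j e. commutator_pair.nf G a b z i j e = \<one> \<longleftrightarrow> commutator_pair.nf G c d z i j e = \<one>"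
  obtains \<phi> where "\<phi> a = c" "\<phi> b = d" "inj_on \<phi> {commutator_pair.nf G a b z i j e | i j e. True}"
    "\<And>x y. x \<in> {commutator_pair.nf G a b z i j e | i j e. True} \<Longrightarrow>
      y \<in> {commutator_pair.nf G a b z i j e | i j e. True} \<Longrightarrow> \<phi> (x \<otimes> y) = \<phi> x \<otimes> \<phi> y"
    "\<And>x. x \<in> {commutator_pair.nf G a b z i j e | i j e. True} \<Longrightarrow> \<phi> x \<in> carrier G"
proof -
  interpret ab: commutator_pair G a b z by fact
  interpret cd: commutator_pair G c d z by fact
  have eq': "ab.nf i j e = ab.nf k l m \<longleftrightarrow> cd.nf i j e = cd.nf k l m" for i j e k l m
    by (simp only: ab.nf_eq_iff cd.nf_eq_iff eq)
  \<comment> \<open>Exponents are not unique; by \<open>eq'\<close> the choice among them is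
    immaterial.\<close>
  define \<phi> where "\<phi> x = (SOME y. \<exists>i j e. x = ab.nf i j e \<and> y = cd.nf i j e)" for x
  have \<phi>: "\<phi> (ab.nf i j e) = cd.nf i j e" for i j e
  proof -
    have "\<exists>k l m. ab.nf i j e = ab.nf k l m \<and> \<phi> (ab.nf i j e) = cd.nf k l m"
      unfolding \<phi>_def by (rule someI_ex) blast
    then show ?thesis using eq' by metis
  qed
  show ?thesis
  proof (rule that[of \<phi>])
    show "\<phi> a = c" "\<phi> b = d"
      using \<phi>[of 1 0 0] \<phi>[of 0 1 0] by (simp_all add: ab.nf_a ab.nf_b cd.nf_a cd.nf_b)
    show "inj_on \<phi> {ab.nf i j e | i j e. True}" by (auto simp: inj_on_def \<phi> eq')
  qed (auto simp: ab.nf_mult cd.nf_mult \<phi>)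
qed

lemma (in group) homogeneous_commutator_pairs:
  assumes hom: "homogeneous G" and ab: "commutator_pair G a b z" and cd: "commutator_pair G c d z"
    and eq: "\<And>i j e. commutator_pair.nf G a b z i j e = \<one> \<longleftrightarrow> commutator_pair.nf G c d z i j e = \<one>"
  obtains \<alpha> where "\<alpha> \<in> auto G" "\<alpha> a = c" "\<alpha> b = d"
proof -
  interpret ab: commutator_pair G a b z by fact
  obtain \<phi> where \<phi>: "\<phi> a = c" "\<phi> b = d" "inj_on \<phi> {ab.nf i j e | i j e. True}"
    "\<And>x y. x \<in> {ab.nf i j e | i j e. True} \<Longrightarrow> y \<in> {ab.nf i j e | i j e. True} \<Longrightarrow> \<phi> (x \<otimes> y) = \<phi> x \<otimes> \<phi> y"
    "\<And>x. x \<in> {ab.nf i j e | i j e. True} \<Longrightarrow> \<phi> x \<in> carrier G"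
    by (rule commutator_pairs_hom[OF ab cd eq]) blast
  obtain \<alpha> where \<alpha>: "\<alpha> \<in> auto G" "\<And>x. x \<in> {ab.nf i j e | i j e. True} \<Longrightarrow> \<alpha> x = \<phi> x"
    by (rule homogeneousD[OF hom ab.subgroup_range_nf \<phi>(3-5)]) auto
  have "a \<in> {ab.nf i j e | i j e. True}" "b \<in> {ab.nf i j e | i j e. True}"
    using ab.nf_a[symmetric] ab.nf_b[symmetric] by blast+
  then have "\<alpha> a = c" "\<alpha> b = d" using \<alpha>(2)[of a] \<alpha>(2)[of b] \<phi>(1,2) by simp_all
  with \<alpha>(1) show ?thesis by (rule that)
qed

section \<open>Affine equivalence of connection sets\<close>

definition (in group) affine_equiv :: "'a set \<Rightarrow> 'a set \<Rightarrow> bool" where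
  "affine_equiv S T \<longleftrightarrow> (\<exists>g\<in>carrier G. \<exists>\<alpha>\<in>auto G. T = g <# (\<alpha> ` S))"

text \<open>Left translation by \<open>p' \<otimes> inv (\<alpha> p)\<close> takes
  \<open>\<alpha> p\<close> to \<open>p'\<close>. The other two elements follow because \<alpha>
  matches their differences from \<open>p\<close>.\<close>

lemma (in group) affine_equivI:
  assumes "\<alpha> \<in> auto G" and pqr: "p \<in> carrier G" "q \<in> carrier G" "r \<in> carrier G"
    and pqr': "p' \<in> carrier G" "q' \<in> carrier G" "r' \<in> carrier G"
    and "\<alpha> (inv p \<otimes> q) = inv p' \<otimes> q'" "\<alpha> (inv p \<otimes> r) = inv p' \<otimes> r'"
  shows "affine_equiv {p, q, r} {p', q', r'}"
  unfolding affine_equiv_def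
proof (intro bexI)
  have \<alpha>p: "\<alpha> p \<in> carrier G" using assms by (simp add: auto_mult)
  have *: "p' \<otimes> inv (\<alpha> p) \<otimes> \<alpha> s = s'"
    if "s \<in> carrier G" "s' \<in> carrier G" "\<alpha> (inv p \<otimes> s) = inv p' \<otimes> s'" for s s'
  proof -
    have "\<alpha> s = \<alpha> p \<otimes> \<alpha> (inv p \<otimes> s)" 
      using that(1) pqr assms(1) auto_mult(1)[of \<alpha> p "inv p \<otimes> s"] by simp
    then show ?thesis using that \<alpha>p pqr' by (simp add: m_assoc)
  qed
  have "\<alpha> \<one> = \<one>" using assms(1) auto_mult(1)[of \<alpha> \<one> \<one>] auto_mult(2)[of \<alpha> \<one>] by simp
  then have "p' \<otimes> inv (\<alpha> p) \<otimes> \<alpha> p = p'" by (intro *) (use pqr pqr' in simp_all)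
  moreover have "p' \<otimes> inv (\<alpha> p) \<otimes> \<alpha> q = q'" "p' \<otimes> inv (\<alpha> p) \<otimes> \<alpha> r = r'"
    using assms by (auto intro!: *)
  ultimately show "{p', q', r'} = (p' \<otimes> inv (\<alpha> p)) <# (\<alpha> ` {p, q, r})"
    by (auto simp: l_coset_def)
  show "p' \<otimes> inv (\<alpha> p) \<in> carrier G" using \<alpha>p pqr' by simp
qed fact

lemma (in group) affine_equiv_sym:
  assumes T: "T \<subseteq> carrier G" and equiv: "affine_equiv T S"
  shows "affine_equiv S T"
proof -
  obtain g \<alpha> where g: "g \<in> carrier G" and \<alpha>: "\<alpha> \<in> auto G" and S: "S = g <# (\<alpha> ` T)"
    using equiv by (auto simp: affine_equiv_def)
  \<comment> \<open>Members of \<open>auto G\<close> are extensional on the carrier, hence the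
    \<open>restrict\<close>.\<close>
  define \<beta> where "\<beta> = restrict (inv_into (carrier G) \<alpha>) (carrier G)"
  have bij: "bij_betw \<alpha> (carrier G) (carrier G)" using \<alpha> by (auto simp: auto_def Bij_def)
  have \<beta>: "\<beta> (\<alpha> x) = x" if "x \<in> carrier G" for x
    using that bij_betw_inv_into_left[OF bij that] auto_mult(2)[OF \<alpha> that] by (simp add: \<beta>_def)
  have "\<alpha> \<in> iso G G" using \<alpha> bij by (simp add: auto_def iso_def)
  then have hom: "inv_into (carrier G) \<alpha> \<in> hom G G" using iso_set_sym by (auto simp: iso_def)
  then have "\<beta> \<in> hom G G" unfolding \<beta>_def by (auto simp: hom_def)
  moreover have "\<beta> \<in> Bij (carrier G)"
    using restrict_inv_into_Bij[of \<alpha> "carrier G"] \<alpha> unfolding \<beta>_def by (simp add: auto_def)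
  ultimately have \<beta>_auto: "\<beta> \<in> auto G" by (simp add: auto_def)
  have \<beta>g: "\<beta> g \<in> carrier G" using auto_mult(2)[OF \<beta>_auto g] .
  have "inv (\<beta> g) \<otimes> \<beta> (g \<otimes> \<alpha> t) = t" if "t \<in> T" for t
    using that T g \<beta> \<beta>g \<alpha> by (subst auto_mult(1)[OF \<beta>_auto]) (auto simp: auto_mult)
  then have "T = inv (\<beta> g) <# (\<beta> ` S)"
    unfolding S l_coset_def by (auto simp: image_iff)
  then show ?thesis unfolding affine_equiv_def using \<beta>_auto \<beta>g by blast
qed

section \<open>Enumeration of words over three letters\<close>

fun next_letters :: "nat \<Rightarrow> nat \<Rightarrow> nat list list" where
  "next_letters 0 l = [[]]"
| "next_letters (Suc n) l =
    concat (map (\<lambda>c. map ((#) c) (next_letters n c)) (filter (\<lambda>c. c \<noteq> l) [0, 1, 2]))"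

text \<open>Letters are numbers, so the continuations without backtracking form an executable list,
  and statements about all of them can be settled by \<open>code_simp\<close>.\<close>

lemma next_letters_complete:
  "set w \<subseteq> {0, 1, 2} \<Longrightarrow> distinct_adj (l # w) \<Longrightarrow> w \<in> set (next_letters (length w) l)"
proof (induction w arbitrary: l)
  case (Cons c w)
  then have "w \<in> set (next_letters (length w) c)" by auto
  then show ?case using Cons.prems by (auto simp: image_iff)
qed simp

text \<open>
  \<open>word_nf\<close> computes the exponents of the normal form \<open>a\<^sup>i b\<^sup>j z\<^sup>e\<close> of the end point of a walk over the
  letters \<open>p\<close>, \<open>p a\<close>, \<open>p b\<close>, which are encoded as \<open>0\<close>, \<open>1\<close>, \<open>2\<close>.
\<close>

definition letter_mult :: "nat \<Rightarrow> int \<times> int \<times> int \<Rightarrow> int \<times> int \<times> int" where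
  "letter_mult c = (\<lambda>(i, j, e). if c = 0 then (i, j, e) else if c = 1 then (i + 1, j, e) else (i, j + 1, e + i))"

definition letter_div :: "nat \<Rightarrow> int \<times> int \<times> int \<Rightarrow> int \<times> int \<times> int" where
  "letter_div c = (\<lambda>(i, j, e). if c = 0 then (i, j, e) else if c = 1 then (i - 1, j, e) else (i, j - 1, e + i))"

fun word_nf :: "int \<times> int \<times> int \<Rightarrow> nat list \<Rightarrow> int \<times> int \<times> int" where
  "word_nf s [] = s"
| "word_nf s [p] = s"
| "word_nf s (p # q # w) = word_nf (letter_div q (letter_mult p s)) w"

locale connection_triple = commutator_pair G a b z for G (structure) and a b z +
  fixes p q r
  assumes p [simp]: "p \<in> carrier G" and q [simp]: "q \<in> carrier G" and r [simp]: "r \<in> carrier G"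
    and a_def: "a = inv p \<otimes> q" and b_def: "b = inv p \<otimes> r"
begin

definition letter :: "nat \<Rightarrow> 'a" where
  "letter c = (if c = 0 then p else if c = 1 then q else r)"

lemma letter_closed [simp]: "letter c \<in> carrier G"
  by (simp add: letter_def)

lemma set_letters: "set (map letter w) \<subseteq> {p, q, r}" "set (map letter w) \<subseteq> carrier G"
  by (auto simp: letter_def)

abbreviation nf3 :: "int \<times> int \<times> int \<Rightarrow> 'a" where
  "nf3 \<equiv> \<lambda>(i, j, e). nf i j e"

lemma nf3_step: "inv (letter d) \<otimes> (letter c \<otimes> nf3 s) = nf3 (letter_div d (letter_mult c s))"
proof -
  \<comment> \<open>Every letter is \<open>p\<close> times one of \<open>\<one>\<close>,
    \<open>a\<close>, \<open>b\<close>, and the factors \<open>p\<close> cancel in a double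
    step.\<close>
  define \<kappa> where "\<kappa> c = (if c = 0 then \<one> else if c = 1 then a else b)" for c :: nat
  have l: "letter c = p \<otimes> \<kappa> c" for c by (simp add: letter_def \<kappa>_def a_def b_def)
  have \<kappa>: "\<kappa> c \<in> carrier G" for c by (simp add: \<kappa>_def)
  obtain i j e where s: "s = (i, j, e)" by (cases s)
  have "inv (letter d) \<otimes> (letter c \<otimes> nf3 s) = inv (\<kappa> d) \<otimes> (\<kappa> c \<otimes> nf i j e)"
    using \<kappa> by (simp add: l s inv_mult_group m_assoc)
  also have "\<dots> = nf3 (letter_div d (letter_mult c s))"
    by (simp add: \<kappa>_def s letter_div_def letter_mult_def mult_a_nf mult_b_nf)
  finally show ?thesis .
qed

lemma walk_end_letters: "walk_end (nf3 s) (map letter w) = nf3 (word_nf s w)"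
  by (induction s w rule: word_nf.induct) (simp_all add: nf3_step)

lemma ex_letters: "set w \<subseteq> {p, q, r} \<Longrightarrow> \<exists>v. w = map letter v \<and> set v \<subseteq> {0, 1, 2}"
proof (induction w)
  case (Cons x w)
  then obtain v where "w = map letter v" "set v \<subseteq> {0, 1, 2}" by auto
  moreover have "\<exists>c\<in>{0, 1, 2}. x = letter c" using Cons.prems by (auto simp: letter_def)
  ultimately show ?case by (metis insert_subset list.set(2) list.simps(9))
qed simp

lemma extends_to_closed_lettersD:
  assumes "extends_to_closed n {p, q, r} (map letter u)" and u: "u \<noteq> []"
  obtains v where "v \<in> set (next_letters (n - length u) (last u))"
    "last (u @ v) \<noteq> hd u" "nf3 (word_nf (0, 0, 0) (u @ v)) = \<one>"
proof -
  from assms obtain w where w: "length (map letter u @ w) = n" "closed_word {p, q, r} (map letter u @ w)"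
    by (auto simp: extends_to_closed_def)
  then obtain v where v: "w = map letter v" "set v \<subseteq> {0, 1, 2}"
    using ex_letters[of w] by (auto simp: closed_word_def)
  have uv: "map letter u @ w = map letter (u @ v)" by (simp add: v)
  have "distinct_adj (map letter (u @ v))" using w(2) uv by (simp only: closed_word_def)
  then have "distinct_adj (u @ v)" by (rule distinct_adj_mapD)
  then have "distinct_adj (last u # v)" using u
    by (cases v) (auto simp: distinct_adj_append_iff)
  then have "v \<in> set (next_letters (length v) (last u))" using v(2) by (intro next_letters_complete)
  moreover have "length v = n - length u" using w(1) v by auto
  moreover have "last (u @ v) \<noteq> hd u"
  proof
    assume "last (u @ v) = hd u"
    then have "last (map letter (u @ v)) = hd (map letter (u @ v))" using u
      by (metis append_is_Nil_conv hd_append2 last_map list.map_sel(1))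
    then show False using w(2) uv by (simp only: closed_word_def simp_thms)
  qed
  moreover have "nf3 (word_nf (0, 0, 0) (u @ v)) = \<one>"
    using w(2) walk_end_letters[of "(0, 0, 0)" "u @ v"] uv by (simp add: closed_word_def del: map_append)
  ultimately show ?thesis using that by metis
qed

lemma extends_to_closed_lettersI:
  assumes "length (u @ v) = n" "even n" "u @ v \<noteq> []" "distinct_adj (u @ v)" "last (u @ v) \<noteq> hd (u @ v)"
    and "set (u @ v) \<subseteq> {0, 1, 2}" and d: "p \<noteq> q" "p \<noteq> r" "q \<noteq> r"
    and "nf3 (word_nf (0, 0, 0) (u @ v)) = \<one>"
  shows "extends_to_closed n {p, q, r} (map letter u)"
proof -
  have inj: "inj_on letter {0, 1, 2}" using d by (auto simp: inj_on_def letter_def)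
  have "distinct_adj (map letter (u @ v))"
    using assms(4) inj_on_subset[OF inj assms(6)] by (rule distinct_adj_mapI)
  moreover have "last (map letter (u @ v)) \<noteq> hd (map letter (u @ v))"
    using assms(3,5,6) inj_onD[OF inj, of "last (u @ v)" "hd (u @ v)"]
    by (metis hd_in_set last_in_set last_map list.map_sel(1) subsetD)
  moreover have "walk_end \<one> (map letter (u @ v)) = \<one>"
    using walk_end_letters[of "(0, 0, 0)" "u @ v"] assms by (simp del: map_append)
  ultimately have "closed_word {p, q, r} (map letter (u @ v))"
    unfolding closed_word_def using assms(1-3) set_letters(1)[of "u @ v"] by auto
  then show ?thesis
    unfolding extends_to_closed_def using assms(1) by (intro exI[of _ "map letter v"]) simp
qed

end

section \<open>Colour-preserving isomorphisms\<close>

lemma (in group) affine_equiv_commutator_pairs: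
  assumes hom: "homogeneous G"
    and pqr: "p \<in> carrier G" "q \<in> carrier G" "r \<in> carrier G"
    and pqr': "p' \<in> carrier G" "q' \<in> carrier G" "r' \<in> carrier G"
    and pairs: "commutator_pair G (inv p \<otimes> q) (inv p \<otimes> r) z" "commutator_pair G (inv p' \<otimes> q') (inv p' \<otimes> r') z"
    and eq: "\<And>i j e. commutator_pair.nf G (inv p \<otimes> q) (inv p \<otimes> r) z i j e = \<one> \<longleftrightarrow>
      commutator_pair.nf G (inv p' \<otimes> q') (inv p' \<otimes> r') z i j e = \<one>"
  shows "affine_equiv {p, q, r} {p', q', r'}"
proof -
  obtain \<alpha> where "\<alpha> \<in> auto G" "\<alpha> (inv p \<otimes> q) = inv p' \<otimes> q'" "\<alpha> (inv p \<otimes> r) = inv p' \<otimes> r'"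
    using homogeneous_commutator_pairs[OF hom pairs eq] by blast
  with pqr pqr' show ?thesis by (intro affine_equivI)
qed

context bicayley_iso
begin

lemma back_\<phi>: "same_side x \<Longrightarrow> bicayley_iso.\<phi> f_inv (\<phi> x) = x"
  using f_inv_f[of "(x, 0)"] f_same_side[of x]
  by (simp add: bicayley_iso.\<phi>_def[OF bicayley_iso_inverse] same_side_carrier)

lemma back_same_side: "same_side x \<Longrightarrow> bicayley_iso.same_side G f_inv (\<phi> x)"
  using f_inv_f[of "(x, 0)"] f_same_side[of x]
  by (simp add: bicayley_iso.same_side_def[OF bicayley_iso_inverse] same_side_carrier)

lemma back_col:
  assumes x: "same_side x" and p: "p \<in> S"
  shows "bicayley_iso.col G f_inv (\<phi> x) (col x p) = p"
proof -
  have c: "x \<in> carrier G" "p \<in> carrier G" using x p S same_side_carrier by auto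
  then have "f_inv (f (p \<otimes> x, 1)) = (p \<otimes> x, 1)"
    using f_inv_f[of "(p \<otimes> x, 1)"] by simp
  then have "f_inv (col x p \<otimes> \<phi> x, 1) = (p \<otimes> x, 1)" by (simp only: col_step(2)[OF x p])
  then show ?thesis
    using back_\<phi>[OF x] c by (simp add: bicayley_iso.col_def[OF bicayley_iso_inverse] m_assoc)
qed

lemma back_image_word:
  "same_side x \<Longrightarrow> set w \<subseteq> S \<Longrightarrow> bicayley_iso.image_word G f_inv (\<phi> x) (image_word x w) = w"
proof (induction x w rule: image_word.induct)
  case (3 x p q w)
  interpret inverse: bicayley_iso G T S f_inv by (rule bicayley_iso_inverse)
  let ?y = "inv q \<otimes> (p \<otimes> x)"
  have y: "same_side ?y" using 3 same_side_step by simp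
  have "inv (col ?y q) \<otimes> (col x p \<otimes> \<phi> x) = \<phi> ?y" using 3 by (simp add: \<phi>_step)
  then show ?case using 3 y by (simp add: back_col)
qed (auto simp: back_col bicayley_iso.image_word.simps[OF bicayley_iso_inverse])

text \<open>The image lemma for the inverse isomorphism. In the contrapositive, a path on no closed
  walk cannot be sent to a path that lies on one.\<close>

lemma extends_to_closed_preimage:
  assumes x: "same_side x" and u: "set u \<subseteq> S" "extends_to_closed n T (image_word x u)"
  shows "extends_to_closed n S u"
  using bicayley_iso.extends_to_closed_image[OF bicayley_iso_inverse back_same_side[OF x] u(2)]
    back_image_word[OF x u(1)] by simp

lemma \<phi>_diff_span:
  assumes "x \<in> diff_span S"
  shows "same_side x \<and> \<phi> x \<in> diff_span T"
  using assms S
proof (induction rule: diff_span_induct)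
  case (step s t y)
  have y: "same_side (inv s \<otimes> (t \<otimes> y))" using step same_side_step by simp
  have "\<phi> (inv s \<otimes> (t \<otimes> y)) = (inv (col (inv s \<otimes> (t \<otimes> y)) s) \<otimes> col y t) \<otimes> \<phi> y"
    using step y by (simp add: \<phi>_step m_assoc)
  moreover have "inv (col (inv s \<otimes> (t \<otimes> y)) s) \<otimes> col y t \<in> diff_span T"
    using step y by (auto intro!: generate.incl simp: differences_def col_step(1) image_iff)
  ultimately show ?case using y step generate.eng by metis
qed (simp_all add: generate.one)

text \<open>\<phi> embeds side \<open>0\<close> of one component into side \<open>0\<close> of the
  other; with the inverse isomorphism, the order of the span becomes an invariant.\<close>

lemma card_diff_span_le:
  assumes "finite (carrier G)"
  shows "card (diff_span S) \<le> card (diff_span T)"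
proof (rule card_inj_on_le[where f = \<phi>])
  show "inj_on \<phi> (diff_span S)" using \<phi>_inj \<phi>_diff_span by (blast intro: inj_onI)
  show "\<phi> ` diff_span S \<subseteq> diff_span T" using \<phi>_diff_span by blast
  show "finite (diff_span T)"
    using assms subgroup.subset[OF subgroup_diff_span[OF T]] finite_subset by blast
qed

lemma card_diff_span: "finite (carrier G) \<Longrightarrow> card (diff_span S) = card (diff_span T)"
  using card_diff_span_le bicayley_iso.card_diff_span_le[OF bicayley_iso_inverse] by (simp add: order_antisym)

text \<open>Colours are compared between \<open>x\<close> and an adjacent vertex of side
  \<open>1\<close>. There the two colourings are bijections from \<open>S\<close> to
  \<open>T\<close> that agree on the connecting edge \<open>q\<close> and, by \<open>edge\<close>,
  on one more colour; as \<open>S\<close> has three elements, they are equal.\<close>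

lemma col_constant:
  assumes card: "card S = 3"
    and edge: "\<And>q. q \<in> S \<Longrightarrow> \<exists>p\<in>S - {q}. \<forall>x. same_side x \<longrightarrow> col (inv q \<otimes> (p \<otimes> x)) p = col x p"
    and x: "same_side x" and s: "s \<in> S" and t: "t \<in> S" and u: "u \<in> S"
  shows "col (inv t \<otimes> (s \<otimes> x)) u = col x u"
proof -
  have star: "col (inv u \<otimes> (q \<otimes> x)) u = col x u" if x: "same_side x" and q: "q \<in> S" and u: "u \<in> S" for x q u
  proof -
    obtain p where p: "p \<in> S" "p \<noteq> q" "\<And>x. same_side x \<Longrightarrow> col (inv q \<otimes> (p \<otimes> x)) p = col x p"
      using edge[OF q] by blast
    have c [simp]: "x \<in> carrier G" "\<And>s. s \<in> S \<Longrightarrow> s \<in> carrier G"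
      using x same_side_carrier S by auto
    \<comment> \<open>The colours of the images of the edges at the vertex
      \<open>q \<otimes> x\<close> of side \<open>1\<close>.\<close>
    define \<tau> where "\<tau> v = col (inv v \<otimes> (q \<otimes> x)) v" for v
    have \<tau>q: "\<tau> q = col x q" using q by (simp add: \<tau>_def)
    \<comment> \<open>The path \<open>p q p\<close> is taken from
      \<open>inv p \<otimes> (q \<otimes> x)\<close>; after its first two edges it is at
      \<open>x\<close>.\<close>
    have \<tau>p: "\<tau> p = col x p"
      using p(3)[OF same_side_step[OF x q p(1)]] q p(1) by (simp add: \<tau>_def)
    have \<tau>_inj: "v = w" if "v \<in> S" "w \<in> S" "\<tau> v = \<tau> w" for v w
    proof (rule col_inj_side1)
      show "same_side (inv v \<otimes> (q \<otimes> x))" "same_side (inv w \<otimes> (q \<otimes> x))"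
        using that x q same_side_step by auto
    qed (use that q in \<open>auto simp: \<tau>_def\<close>)
    \<comment> \<open>A third colour with a different image would force a fourth element into
      \<open>S\<close>.\<close>
    have "u = p \<or> u = q \<or> \<tau> u = col x u"
    proof (rule disjCI)
      assume "\<not> (u = q \<or> \<tau> u = col x u)"
      then have *: "\<tau> u \<noteq> col x u" "u \<noteq> q" by auto
      show "u = p"
      proof (rule ccontr)
        assume up: "u \<noteq> p"
        have "\<tau> u \<in> T" using u q x same_side_step by (simp add: \<tau>_def col_step(1))
        then obtain v where v: "v \<in> S" "\<tau> u = col x v" using col_image[OF x] by blast
        have "v \<noteq> u" using v * by auto
        moreover have "v \<noteq> p" using v \<tau>p \<tau>_inj[OF u p(1)] up by auto
        moreover have "v \<noteq> q" using v \<tau>q \<tau>_inj[OF u q] * by auto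
        ultimately have "card {v, u, p, q} = 4" using up * p by auto
        moreover have "finite S" using card by (metis card.infinite zero_neq_numeral)
        then have "card {v, u, p, q} \<le> card S" using u v p q by (intro card_mono) auto
        ultimately show False using card by simp
      qed
    qed
    then show ?thesis using \<tau>p \<tau>q by (auto simp: \<tau>_def)
  qed
  have c: "x \<in> carrier G" "s \<in> carrier G" "t \<in> carrier G" using x s t S same_side_carrier by auto
  \<comment> \<open>Both side \<open>0\<close> vertices are neighbours of
    \<open>s \<otimes> x\<close> on side \<open>1\<close>, so comparing each of them with this
    vertex suffices.\<close>
  have "t \<otimes> (inv t \<otimes> (s \<otimes> x)) = s \<otimes> x" using c by simp
  then show ?thesis
    using star[OF x s u] star[OF same_side_step[OF x s t] t u] by simp
qed

text \<open>With constant colours, a double step \<open>inv s \<otimes> t\<close> always becomes the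
  same left factor under \<phi>. Hence \<phi> is multiplicative on the span and extends to an
  automorphism.\<close>

lemma affine_equiv_of_col_constant:
  assumes hom: "homogeneous G" and S3: "S = {p, q, r}"
    and const: "\<And>x s t u. same_side x \<Longrightarrow> s \<in> S \<Longrightarrow> t \<in> S \<Longrightarrow> u \<in> S \<Longrightarrow> col (inv t \<otimes> (s \<otimes> x)) u = col x u"
  shows "affine_equiv S T"
proof -
  have same: "same_side x" if "x \<in> diff_span S" for x using \<phi>_diff_span[OF that] by simp
  have col: "col x u = col \<one> u" if "x \<in> diff_span S" "u \<in> S" for x u
    using that(1) S
  proof (induction rule: diff_span_induct)
    case (step s t y)
    then show ?case using const same that(2) by simp
  qed simp
  have step: "\<phi> (inv s \<otimes> (t \<otimes> y)) = inv (col \<one> s) \<otimes> (col \<one> t \<otimes> \<phi> y)"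
    if "s \<in> S" "t \<in> S" "y \<in> diff_span S" for s t y
  proof -
    have "same_side y" using same that by simp
    moreover have "col (inv s \<otimes> (t \<otimes> y)) s = col \<one> s" using const[of y t s s] col same that by simp
    ultimately show ?thesis using that col[of y t] by (simp add: \<phi>_step)
  qed
  have carr: "x \<in> carrier G" if "x \<in> diff_span S" for x using same[OF that] same_side_carrier by simp
  have mult: "\<phi> (x \<otimes> y) = \<phi> x \<otimes> \<phi> y" if "x \<in> diff_span S" "y \<in> diff_span S" for x y
    using that(1) S
  proof (induction rule: diff_span_induct)
    case one
    then show ?case using that(2) carr same by simp
  next
    case (step s t x)
    have xy: "x \<otimes> y \<in> diff_span S" using step that generate.eng by metis
    have c: "s \<in> carrier G" "t \<in> carrier G" "x \<in> carrier G" "y \<in> carrier G"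
      using step that S carr by auto
    then have "inv s \<otimes> (t \<otimes> x) \<otimes> y = inv s \<otimes> (t \<otimes> (x \<otimes> y))" by (simp add: m_assoc)
    then have "\<phi> (inv s \<otimes> (t \<otimes> x) \<otimes> y) = inv (col \<one> s) \<otimes> (col \<one> t \<otimes> \<phi> (x \<otimes> y))"
      using \<open>\<And>y t s. \<lbrakk>s \<in> S; t \<in> S; y \<in> diff_span S\<rbrakk> \<Longrightarrow> \<phi> (inv s \<otimes> (t \<otimes> y)) = inv (col \<one> s) \<otimes> (col \<one> t \<otimes> \<phi> y)\<close>[OF step(1,2) xy]
      by simp
    also have "\<dots> = \<phi> (inv s \<otimes> (t \<otimes> x)) \<otimes> \<phi> y"
      using \<open>\<And>y t s. \<lbrakk>s \<in> S; t \<in> S; y \<in> diff_span S\<rbrakk> \<Longrightarrow> \<phi> (inv s \<otimes> (t \<otimes> y)) = inv (col \<one> s) \<otimes> (col \<one> t \<otimes> \<phi> y)\<close>[OF step(1,2,3)]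
        step same that by (simp add: m_assoc)
    finally show ?case .
  qed
  obtain \<alpha> where \<alpha>: "\<alpha> \<in> auto G" "\<And>x. x \<in> diff_span S \<Longrightarrow> \<alpha> x = \<phi> x"
  proof (rule homogeneousD[OF hom subgroup_diff_span[OF S]])
    show "inj_on \<phi> (diff_span S)" using same \<phi>_inj by (blast intro: inj_onI)
  qed (use mult same in auto)
  have *: "\<alpha> (inv s \<otimes> t) = inv (col \<one> s) \<otimes> col \<one> t" if "s \<in> S" "t \<in> S" for s t
  proof -
    have "inv s \<otimes> t \<in> diff_span S"
      using that by (auto intro!: generate.incl simp: differences_def image_iff)
    then show ?thesis
      using \<alpha>(2) step[of s t \<one>] that S generate.one[of G "differences S"] by (auto simp: subset_iff)
  qed
  have "T = {col \<one> p, col \<one> q, col \<one> r}" using col_image[OF same_side_one] S3 by auto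
  moreover have "affine_equiv {p, q, r} {col \<one> p, col \<one> q, col \<one> r}"
    using S S3 * by (intro affine_equivI[OF \<alpha>(1)]) auto
  ultimately show ?thesis using S3 by simp
qed

end

section \<open>Commuting connection sets\<close>

locale commuting_triple = group G for G (structure) +
  fixes p q r
  assumes p_closed: "p \<in> carrier G" and q_closed: "q \<in> carrier G" and r_closed: "r \<in> carrier G"
    and commute: "(inv p \<otimes> q) \<otimes> (inv p \<otimes> r) = (inv p \<otimes> r) \<otimes> (inv p \<otimes> q)"

sublocale commuting_triple \<subseteq> connection_triple G "inv p \<otimes> q" "inv p \<otimes> r" \<one> p q r
  using p_closed q_closed r_closed commute by unfold_locales auto

context commuting_triple
begin

definition cf :: "int \<Rightarrow> int \<Rightarrow> 'a" where
  "cf i j = (inv p \<otimes> q) [^] i \<otimes> (inv p \<otimes> r) [^] j"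

lemma nf_eq_cf: "nf i j e = cf i j"
  by (simp add: nf_def cf_def)

lemma cf_closed [simp]: "cf i j \<in> carrier G"
  by (simp add: cf_def)

lemma cf_0 [simp]: "cf 0 0 = \<one>"
  by (simp add: cf_def)

lemma cf_mult: "cf i j \<otimes> cf k l = cf (i + k) (j + l)"
  using nf_mult[of i j 0 k l 0] by (simp add: nf_eq_cf)

lemma cf_inv: "inv (cf i j) = cf (- i) (- j)"
  using nf_inv[of i j 0] by (simp add: nf_eq_cf)

lemma cf_pow: "cf i j [^] (k::int) = cf (k * i) (k * j)"
proof -
  have "(inv p \<otimes> q) [^] i \<otimes> (inv p \<otimes> r) [^] j = (inv p \<otimes> r) [^] j \<otimes> (inv p \<otimes> q) [^] i"
    using b_pow_a_pow[of j i] by simp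
  then have "((inv p \<otimes> q) [^] i \<otimes> (inv p \<otimes> r) [^] j) [^] k =
      ((inv p \<otimes> q) [^] i) [^] k \<otimes> ((inv p \<otimes> r) [^] j) [^] k"
    by (rule int_pow_mult_distrib) simp_all
  then show ?thesis by (simp add: cf_def int_pow_pow mult.commute)
qed

lemma difference_cf:
  "inv p \<otimes> q = cf 1 0" "inv p \<otimes> r = cf 0 1" "inv q \<otimes> p = cf (- 1) 0"
  "inv r \<otimes> p = cf 0 (- 1)" "inv q \<otimes> r = cf (- 1) 1" "inv r \<otimes> q = cf 1 (- 1)"
proof -
  show 1: "inv p \<otimes> q = cf 1 0" "inv p \<otimes> r = cf 0 1" by (simp_all add: cf_def)
  have "inv (cf 1 0) = inv q \<otimes> p" "inv (cf 0 1) = inv r \<otimes> p"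
    unfolding 1[symmetric] by (simp_all add: inv_mult_group)
  then show 2: "inv q \<otimes> p = cf (- 1) 0" "inv r \<otimes> p = cf 0 (- 1)"
    by (simp_all add: cf_inv)
  have "inv q \<otimes> r = (inv q \<otimes> p) \<otimes> (inv p \<otimes> r)" "inv r \<otimes> q = (inv r \<otimes> p) \<otimes> (inv p \<otimes> q)"
    by (simp_all add: m_assoc)
  then show "inv q \<otimes> r = cf (- 1) 1" "inv r \<otimes> q = cf 1 (- 1)"
    by (simp_all add: 1 2 cf_mult)
qed

lemma cf_eq_iff: "cf i j = cf k l \<longleftrightarrow> cf (k - i) (l - j) = \<one>"
  using nf_eq_iff[of i j 0 k l 0] by (simp add: nf_eq_cf)

lemma cf_neg: "cf (- i) (- j) = \<one> \<longleftrightarrow> cf i j = \<one>"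
  using cf_eq_iff[of i j 0 0] by auto

text \<open>Every difference of two letters is some \<open>cf i j\<close>, so the choice of base
  point is immaterial, and letters may be repeated.\<close>

lemma commuting_triple_subset:
  assumes "s \<in> {p, q, r}" "t \<in> {p, q, r}" "u \<in> {p, q, r}"
  shows "commuting_triple G s t u"
proof -
  have d: "\<exists>i j. inv s \<otimes> t = cf i j" if "s \<in> {p, q, r}" "t \<in> {p, q, r}" for s t
  proof (cases "s = t")
    case True
    then have "inv s \<otimes> t = cf 0 0" using that by auto
    then show ?thesis by blast
  next
    case False
    then show ?thesis using that difference_cf by auto
  qed
  obtain i j k l where "inv s \<otimes> t = cf i j" "inv s \<otimes> u = cf k l" using d assms by meson
  then have "(inv s \<otimes> t) \<otimes> (inv s \<otimes> u) = (inv s \<otimes> u) \<otimes> (inv s \<otimes> t)"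
    by (simp add: cf_mult add.commute)
  then show ?thesis using assms p q r by unfold_locales auto
qed

lemma diff_span_eq: "diff_span {p, q, r} = {cf i j | i j. True}"
proof
  have *: "{cf i j | i j. True} = {nf i j e | i j e. True}"
    by (auto simp: nf_eq_cf)
  have "inv s \<otimes> t \<in> {cf i j | i j. True}" if "s \<in> {p, q, r}" "t \<in> {p, q, r}" for s t
  proof (cases "s = t")
    case True
    then have "inv s \<otimes> t = cf 0 0" using that by auto
    then show ?thesis by blast
  next
    case False
    then show ?thesis using that difference_cf by auto
  qed
  then have "differences {p, q, r} \<subseteq> {cf i j | i j. True}"
    unfolding differences_def by (intro image_subsetI) (simp only: split_paired_all mem_Sigma_iff case_prod_conv)
  then show "diff_span {p, q, r} \<subseteq> {cf i j | i j. True}"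
    using generate_subgroup_incl[OF _ subgroup_range_nf] * by simp
  have sub: "subgroup (diff_span {p, q, r}) G" by (rule subgroup_diff_span) simp
  have "inv p \<otimes> q \<in> diff_span {p, q, r}" "inv p \<otimes> r \<in> diff_span {p, q, r}"
    by (auto intro!: generate.incl simp: differences_def image_iff)
  then have "cf i j \<in> diff_span {p, q, r}" for i j
    unfolding cf_def using subgroup_int_pow_closed[OF sub] by (auto intro!: generate.eng generate.one)
  then show "{cf i j | i j. True} \<subseteq> diff_span {p, q, r}" by blast
qed

lemma card_diff_span_cyclic:
  assumes "finite (carrier G)" "inv p \<otimes> r = (inv p \<otimes> q) [^] (k::int)"
  shows "card (diff_span {p, q, r}) = ord (inv p \<otimes> q)"
proof -
  have "cf i j = (inv p \<otimes> q) [^] (i + k * j)" for i j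
    using assms(2) by (simp add: cf_def int_pow_pow int_pow_mult)
  moreover have "(inv p \<otimes> q) [^] i = cf i 0" for i by (simp add: cf_def)
  ultimately have "diff_span {p, q, r} = {(inv p \<otimes> q) [^] i | i. i \<in> (UNIV :: int set)}"
    unfolding diff_span_eq by blast
  then show ?thesis
    using generate_pow[of "inv p \<otimes> q"] generate_pow_card[of "inv p \<otimes> q"] assms(1) by simp
qed

end

definition commuting_set :: "('a, 'b) monoid_scheme \<Rightarrow> 'a set \<Rightarrow> bool" where
  "commuting_set G S \<longleftrightarrow> (\<forall>p\<in>S. \<forall>q\<in>S. \<forall>r\<in>S. commuting_triple G p q r)"

context group
begin

lemma commuting_setI: "commuting_triple G p q r \<Longrightarrow> commuting_set G {p, q, r}"
  unfolding commuting_set_def by (intro ballI) (rule commuting_triple.commuting_triple_subset)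

lemma affine_equiv_commuting:
  assumes hom: "homogeneous G" and "commuting_triple G p q r" "commuting_triple G p' q' r'"
    and eq: "\<And>i j. (inv p \<otimes> q) [^] (i::int) \<otimes> (inv p \<otimes> r) [^] (j::int) = \<one> \<longleftrightarrow>
      (inv p' \<otimes> q') [^] i \<otimes> (inv p' \<otimes> r') [^] j = \<one>"
  shows "affine_equiv {p, q, r} {p', q', r'}"
proof -
  interpret A: commuting_triple G p q r by fact
  interpret B: commuting_triple G p' q' r' by fact
  show ?thesis
    using eq by (intro affine_equiv_commutator_pairs[OF hom, where z = \<one>])
      (simp_all add: A.commutator_pair_axioms B.commutator_pair_axioms A.nf_def B.nf_def)
qed

text \<open>In both groups the word with exponents \<open>i\<close>, \<open>j\<close> is trivial
  exactly if the common order divides \<open>i + k * j\<close>.\<close>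

lemma affine_equiv_cyclic:
  assumes hom: "homogeneous G" and tr: "commuting_triple G p q r" "commuting_triple G p' q' r'"
    and k: "inv p \<otimes> r = (inv p \<otimes> q) [^] (k::int)" "inv p' \<otimes> r' = (inv p' \<otimes> q') [^] k"
    and ord: "ord (inv p \<otimes> q) = ord (inv p' \<otimes> q')"
  shows "affine_equiv {p, q, r} {p', q', r'}"
proof -
  interpret A: commuting_triple G p q r by fact
  interpret B: commuting_triple G p' q' r' by fact
  show ?thesis
  proof (rule affine_equiv_commuting[OF hom tr])
    fix i j :: int
    show "(inv p \<otimes> q) [^] i \<otimes> (inv p \<otimes> r) [^] j = \<one> \<longleftrightarrow> (inv p' \<otimes> q') [^] i \<otimes> (inv p' \<otimes> r') [^] j = \<one>"
      by (simp add: k ord int_pow_pow int_pow_eq_id flip: int_pow_mult)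
  qed
qed

text \<open>
  The sets \<open>{p, q, r}\<close> for which short relations in the group create additional \<open>6\<close>-cycles, beyond
  those coming from commutativity.
\<close>

definition square_rel :: "'a \<Rightarrow> 'a \<Rightarrow> bool" where
  "square_rel p q \<longleftrightarrow> (inv p \<otimes> q) [^] (2::int) = \<one>"

definition cube_rel :: "'a \<Rightarrow> 'a \<Rightarrow> bool" where
  "cube_rel p q \<longleftrightarrow> (inv p \<otimes> q) [^] (3::int) = \<one>"

text \<open>In additive notation with \<open>p = 0\<close> and \<open>q = 1\<close> the set is
  \<open>{0, 1, - 2}\<close>.\<close>

definition skew_rel :: "'a \<Rightarrow> 'a \<Rightarrow> 'a \<Rightarrow> bool" where
  "skew_rel p q r \<longleftrightarrow> inv p \<otimes> r = (inv p \<otimes> q) [^] (- 2::int)"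

end

context commuting_triple
begin

lemma rel_cf:
  "square_rel p q \<longleftrightarrow> cf 2 0 = \<one>" "square_rel p r \<longleftrightarrow> cf 0 2 = \<one>" "square_rel q r \<longleftrightarrow> cf (- 2) 2 = \<one>"
  "cube_rel p q \<longleftrightarrow> cf 3 0 = \<one>" "cube_rel p r \<longleftrightarrow> cf 0 3 = \<one>"
  "skew_rel p q r \<longleftrightarrow> cf (- 2) (- 1) = \<one>" "skew_rel p r q \<longleftrightarrow> cf (- 1) (- 2) = \<one>"
  "skew_rel q p r \<longleftrightarrow> cf 3 (- 1) = \<one>"
  unfolding square_rel_def cube_rel_def skew_rel_def difference_cf cf_pow
  by (simp_all add: cf_eq_iff[of 0 1] cf_eq_iff[of 1 0] cf_eq_iff[of "- 1" 1])

text \<open>There are six ways to complete \<open>p q p\<close> to a cyclically reduced word of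
  length six. They end at five points of the lattice, and each point being trivial is one of the
  five relations.\<close>

lemma path_on_hexagon:
  assumes "extends_to_closed 6 {p, q, r} [p, q, p]"
  shows "square_rel p r \<or> skew_rel q p r \<or> cube_rel p q \<or> skew_rel p q r \<or> skew_rel p r q"
proof -
  have "extends_to_closed 6 {p, q, r} (map letter [0, 1, 0])" using assms by (simp add: letter_def)
  then obtain v where v: "v \<in> set (next_letters 3 0)" "last ([0, 1, 0] @ v) \<noteq> 0"
    "nf3 (word_nf (0, 0, 0) ([0, 1, 0] @ v)) = \<one>"
    by (rule extends_to_closed_lettersD) simp_all
  have "\<forall>v\<in>set (next_letters 3 0). last ([0, 1, 0] @ v) = 0 \<or>
      (case word_nf (0, 0, 0) ([0, 1, 0] @ v) of (i, j, e) \<Rightarrow>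
        (i, j) \<in> {(-3, 0), (-3, 1), (-2, -1), (-1, -2), (0, -2)})"
    by code_simp
  then have "cf (- 3) 0 = \<one> \<or> cf (- 3) 1 = \<one> \<or> cf (- 2) (- 1) = \<one> \<or> cf (- 1) (- 2) = \<one> \<or> cf 0 (- 2) = \<one>"
    using v by (auto simp: nf_eq_cf)
  then show ?thesis
    using cf_neg[of 3 0] cf_neg[of 3 "- 1"] cf_neg[of 0 2] by (auto simp: rel_cf)
qed

lemma distinct_path_on_hexagon:
  assumes "p \<noteq> q" "p \<noteq> r" "q \<noteq> r"
  shows "extends_to_closed 6 {p, q, r} [p, q, r]"
proof -
  have "extends_to_closed 6 {p, q, r} (map letter [0, 1, 2])"
    by (rule extends_to_closed_lettersI[where v = "[0, 1, 2]"])
      (use assms in \<open>simp_all add: letter_mult_def letter_div_def nf_eq_cf\<close>)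
  then show ?thesis by (simp add: letter_def)
qed

lemma square_on_4_cycle:
  assumes "p \<noteq> q" "p \<noteq> r" "q \<noteq> r" "square_rel p q"
  shows "extends_to_closed 4 {p, q, r} [p]"
proof -
  have "extends_to_closed 4 {p, q, r} (map letter [0])"
    by (rule extends_to_closed_lettersI[where v = "[1, 0, 1]"])
      (use assms cf_neg[of 2 0] in \<open>simp_all add: letter_mult_def letter_div_def nf_eq_cf rel_cf\<close>)
  then show ?thesis by (simp add: letter_def)
qed

lemma cube_on_hexagon:
  assumes "p \<noteq> q" "p \<noteq> r" "q \<noteq> r" "cube_rel p q"
  shows "extends_to_closed 6 {p, q, r} [p, q, p]"
proof -
  have "extends_to_closed 6 {p, q, r} (map letter [0, 1, 0])"
    by (rule extends_to_closed_lettersI[where v = "[1, 0, 1]"])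
      (use assms cf_neg[of 3 0] in \<open>simp_all add: letter_mult_def letter_div_def nf_eq_cf rel_cf\<close>)
  then show ?thesis by (simp add: letter_def)
qed

text \<open>These are the possible end points of reduced closed words of length four; they recognise
  the image of a \<open>4\<close>-cycle in a set with a skew relation.\<close>

lemma closed_4_word_cf:
  assumes "extends_to_closed 4 {p, q, r} [s]" "s \<in> {p, q, r}"
  shows "\<exists>(i, j)\<in>{(-2, 0), (-2, 1), (-2, 2), (-1, -1), (-1, 2), (0, -2), (0, 2), (1, -2), (1, 1), (2, -2),
    (2, -1), (2, 0)}. cf i j = \<one>"
proof -
  have "\<exists>c\<in>{0, 1, 2}. s = letter c" using assms(2) by (auto simp: letter_def)
  then obtain c where c: "c \<in> {0, 1, 2}" "s = letter c" by blast
  then have "extends_to_closed 4 {p, q, r} (map letter [c])" using assms(1) by simp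
  then obtain v where v: "v \<in> set (next_letters 3 c)" "last ([c] @ v) \<noteq> c"
    "nf3 (word_nf (0, 0, 0) ([c] @ v)) = \<one>"
    by (rule extends_to_closed_lettersD) simp_all
  have "\<forall>c\<in>set [0, 1, 2]. \<forall>v\<in>set (next_letters 3 c). last ([c] @ v) = c \<or>
      (case word_nf (0, 0, 0) ([c] @ v) of (i, j, e) \<Rightarrow>
        (i, j) \<in> {(-2, 0), (-2, 1), (-2, 2), (-1, -1), (-1, 2), (0, -2), (0, 2), (1, -2), (1, 1), (2, -2),
          (2, -1), (2, 0)})"
    by code_simp
  then have "last ([c] @ v) = c \<or>
      (case word_nf (0, 0, 0) ([c] @ v) of (i, j, e) \<Rightarrow>
        (i, j) \<in> {(-2, 0), (-2, 1), (-2, 2), (-1, -1), (-1, 2), (0, -2), (0, 2), (1, -2), (1, 1), (2, -2),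
          (2, -1), (2, 0)})"
    using v(1) c(1) by (metis list.set(1) list.set(2))
  moreover obtain i j e where e: "word_nf (0, 0, 0) ([c] @ v) = (i, j, e)" by (metis surj_pair)
  ultimately have "(i, j) \<in> {(-2, 0), (-2, 1), (-2, 2), (-1, -1), (-1, 2), (0, -2), (0, 2), (1, -2), (1, 1),
      (2, -2), (2, -1), (2, 0)}" using v(2) by simp
  moreover have "cf i j = \<one>" using v(3) e by (simp add: nf_eq_cf)
  ultimately show ?thesis by blast
qed

end

lemma (in group) ord_dvd_card_subgroup:
  assumes H: "subgroup H G" and x: "x \<in> H"
  shows "ord x dvd card H"
proof -
  interpret H: group "G\<lparr>carrier := H\<rparr>" by (rule subgroup_imp_group[OF H])
  have "x [^]\<^bsub>G\<lparr>carrier := H\<rparr>\<^esub> card H = \<one>"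
    using H.pow_order_eq_1[of x] x by (simp add: order_def)
  then have "x [^] card H = \<one>" by (metis nat_pow_consistent)
  then show ?thesis using x subgroup.mem_carrier[OF H] by (simp add: pow_eq_id)
qed

context group
begin

lemma inv_difference: "p \<in> carrier G \<Longrightarrow> q \<in> carrier G \<Longrightarrow> inv (inv p \<otimes> q) = inv q \<otimes> p"
  by (simp add: inv_mult_group)

lemma difference_eq_one_iff:
  assumes "p \<in> carrier G" "q \<in> carrier G"
  shows "inv p \<otimes> q = \<one> \<longleftrightarrow> p = q"
  using assms by (metis inv_mult_cancel(2) l_inv r_one)

lemma square_rel_sym: "p \<in> carrier G \<Longrightarrow> q \<in> carrier G \<Longrightarrow> square_rel p q \<Longrightarrow> square_rel q p"
  using int_pow_inv[of "inv p \<otimes> q" 2] by (simp add: square_rel_def inv_difference)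

lemma cube_rel_sym: "p \<in> carrier G \<Longrightarrow> q \<in> carrier G \<Longrightarrow> cube_rel p q \<Longrightarrow> cube_rel q p"
  using int_pow_inv[of "inv p \<otimes> q" 3] by (simp add: cube_rel_def inv_difference)

lemma even_card_diff_span_square:
  assumes S: "S \<subseteq> carrier G" and sq: "square_rel p q" and d: "p \<noteq> q" and pq: "p \<in> S" "q \<in> S"
  shows "even (card (diff_span S))"
proof -
  let ?a = "inv p \<otimes> q"
  have c: "p \<in> carrier G" "q \<in> carrier G" using S pq by auto
  have "ord ?a dvd 2"
    using sq c by (simp add: square_rel_def int_pow_eq_id) (metis int_dvd_int_iff of_nat_numeral)
  moreover have "ord ?a \<noteq> 1" using d c ord_eq_1[of ?a] difference_eq_one_iff[of p q] by simp
  ultimately have "ord ?a = 2" using prime_nat_iff two_is_prime_nat by blast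
  moreover have "?a \<in> diff_span S"
    using pq by (auto intro!: generate.incl simp: differences_def image_iff)
  ultimately show ?thesis using ord_dvd_card_subgroup[OF subgroup_diff_span[OF S]] by metis
qed

definition has_square :: "'a set \<Rightarrow> bool" where
  "has_square S \<longleftrightarrow> (\<exists>p q r. S = {p, q, r} \<and> square_rel p q)"

definition has_skew :: "'a set \<Rightarrow> bool" where
  "has_skew S \<longleftrightarrow> (\<exists>p q r. S = {p, q, r} \<and> skew_rel p q r)"

text \<open>For a commuting set of three elements, each component of the graph is then
  \<open>K_{3,3}\<close> or the Pappus graph, where all paths of length three lie on closed walks of
  length six.\<close>

definition has_cubes :: "'a set \<Rightarrow> bool" where
  "has_cubes S \<longleftrightarrow> (\<exists>p q r. S = {p, q, r} \<and> cube_rel p q \<and> cube_rel p r)"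

lemma distinct_of_card_3: "card {p, q, r} = 3 \<Longrightarrow> p \<noteq> q \<and> p \<noteq> r \<and> q \<noteq> r"
  by (auto simp: card_insert_if split: if_splits)

lemma has_squareE:
  assumes "has_square S" "card S = 3"
  obtains p q r where "S = {p, q, r}" "p \<noteq> q" "p \<noteq> r" "q \<noteq> r" "square_rel p q"
  using assms distinct_of_card_3 unfolding has_square_def by metis

lemma has_skewE:
  assumes "has_skew S" "card S = 3"
  obtains p q r where "S = {p, q, r}" "p \<noteq> q" "p \<noteq> r" "q \<noteq> r" "skew_rel p q r"
  using assms distinct_of_card_3 unfolding has_skew_def by metis

lemma has_cubesE:
  assumes "has_cubes S" "card S = 3"
  obtains p q r where "S = {p, q, r}" "p \<noteq> q" "p \<noteq> r" "q \<noteq> r" "cube_rel p q" "cube_rel p r"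
  using assms distinct_of_card_3 unfolding has_cubes_def by metis

text \<open>\<open>path_on_hexagon\<close> applies to both colours different from \<open>q\<close>.
  If neither application yields a square or skew relation, both yield a cube relation, and these
  share the letter \<open>q\<close>.\<close>

lemma nonrigid_cases:
  assumes comm: "commuting_set G S" and card: "card S = 3" and q: "q \<in> S"
    and ext: "\<And>p. p \<in> S - {q} \<Longrightarrow> extends_to_closed 6 S [p, q, p]"
  shows "has_square S \<or> has_skew S \<or> has_cubes S"
proof -
  have "card (S - {q}) = 2" using card q by simp
  then obtain p r where pr: "S - {q} = {p, r}" "p \<noteq> r" by (auto simp: card_2_iff)
  then have S: "S = {p, q, r}" "q \<noteq> p" "q \<noteq> r" using q by auto
  interpret A: commuting_triple G p q r using comm S unfolding commuting_set_def by simp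
  interpret B: commuting_triple G r q p using comm S unfolding commuting_set_def by simp
  have perm: "S = {p, r, q}" "S = {q, p, r}" "S = {r, p, q}" "S = {q, r, p}" "S = {r, q, p}"
    using S by auto
  have 1: "square_rel p r \<or> skew_rel q p r \<or> cube_rel p q \<or> skew_rel p q r \<or> skew_rel p r q"
    using A.path_on_hexagon ext[of p] pr S by simp
  have 2: "square_rel r p \<or> skew_rel q r p \<or> cube_rel r q \<or> skew_rel r q p \<or> skew_rel r p q"
  proof (rule B.path_on_hexagon)
    have "extends_to_closed 6 S [r, q, r]" by (rule ext) (simp add: pr)
    then show "extends_to_closed 6 {r, q, p} [r, q, r]" using perm(5) by (simp only:)
  qed
  have sq: "has_square S" if "square_rel p r \<or> square_rel r p"
    using that perm unfolding has_square_def by metis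
  have sk: "has_skew S"
    if "skew_rel q p r \<or> skew_rel p q r \<or> skew_rel p r q \<or> skew_rel q r p \<or> skew_rel r q p \<or> skew_rel r p q"
    using that perm S(1) unfolding has_skew_def by metis
  have cu: "has_cubes S" if "cube_rel p q" "cube_rel r q"
    using that perm cube_rel_sym A.p A.q A.r unfolding has_cubes_def by metis
  show ?thesis using 1 2 sq sk cu by blast
qed

end

section \<open>Relations and orders of the spans in the exceptional cases\<close>

context commuting_triple
begin

lemma cf_neq_one:
  "p \<noteq> q \<Longrightarrow> cf 1 0 \<noteq> \<one>" "p \<noteq> r \<Longrightarrow> cf 0 1 \<noteq> \<one>" "q \<noteq> r \<Longrightarrow> cf (- 1) 1 \<noteq> \<one>"
  using difference_eq_one_iff[of p q] difference_eq_one_iff[of p r] difference_eq_one_iff[of q r]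
  by (simp_all add: difference_cf)

lemma card_diff_span_rectangular:
  assumes mn: "m > 0" "n > 0" and iff: "\<And>i j. cf i j = \<one> \<longleftrightarrow> int m dvd i \<and> int n dvd j"
  shows "card (diff_span {p, q, r}) = m * n"
proof -
  let ?R = "{0..<int m} \<times> {0..<int n}"
  have "inj_on (\<lambda>(i, j). cf i j) ?R"
  proof (rule inj_onI, clarify)
    fix i j k l assume *: "i \<in> {0..<int m}" "j \<in> {0..<int n}" "k \<in> {0..<int m}" "l \<in> {0..<int n}" "cf i j = cf k l"
    then have "int m dvd k - i" "int n dvd l - j" using iff by (simp_all add: cf_eq_iff[of i j])
    then have "k mod int m = i mod int m" "l mod int n = j mod int n" by (simp_all add: mod_eq_dvd_iff)
    with * show "i = k \<and> j = l" by simp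
  qed
  moreover have "(\<lambda>(i, j). cf i j) ` ?R = diff_span {p, q, r}"
  proof -
    have "cf i j \<in> (\<lambda>(i, j). cf i j) ` ?R" for i j
    proof (rule image_eqI)
      show "cf i j = (case (i mod int m, j mod int n) of (i, j) \<Rightarrow> cf i j)"
        using iff by (simp add: cf_eq_iff[of i j] flip: mod_eq_dvd_iff)
      show "(i mod int m, j mod int n) \<in> ?R" using mn by simp
    qed
    then show ?thesis unfolding diff_span_eq by auto
  qed
  ultimately have "card (diff_span {p, q, r}) = card ?R" by (metis card_image)
  then show ?thesis by simp
qed

text \<open>Exponents count modulo three. Up to sign this leaves four nonzero pairs: three are
  differences of distinct letters, and \<open>(1, 1)\<close>, which is congruent to
  \<open>(- 2, 1)\<close>, is excluded by \<open>ne\<close>.\<close>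

lemma cube_cf:
  assumes d: "p \<noteq> q" "p \<noteq> r" "q \<noteq> r" and c: "cube_rel p q" "cube_rel p r"
    and ne: "inv p \<otimes> r \<noteq> (inv p \<otimes> q) [^] (2::int)"
  shows "cf i j = \<one> \<longleftrightarrow> 3 dvd i \<and> 3 dvd j"
proof -
  have "cf (3 * (i div 3)) (3 * (j div 3)) = \<one>" for i j
  proof -
    have "cf (3 * (i div 3)) (3 * (j div 3)) = cf 3 0 [^] (i div 3) \<otimes> cf 0 3 [^] (j div 3)"
      by (simp add: cf_pow cf_mult mult.commute)
    then show ?thesis using c by (simp add: rel_cf)
  qed
  then have red: "cf i j = cf (i mod 3) (j mod 3)" for i j
    using cf_mult[of "3 * (i div 3)" "3 * (j div 3)" "i mod 3" "j mod 3"] by simp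
  have n0: "cf 1 0 \<noteq> \<one>" "cf 0 1 \<noteq> \<one>" "cf (- 1) 1 \<noteq> \<one>" using cf_neq_one d by simp_all
  have n1: "cf (- 2) 1 \<noteq> \<one>" using ne by (simp add: difference_cf cf_pow cf_eq_iff[of 0 1] cf_neg[of 2 "- 1", symmetric])
  have n2: "cf 2 0 \<noteq> \<one>" "cf 0 2 \<noteq> \<one>" "cf 1 2 \<noteq> \<one>" "cf 2 2 \<noteq> \<one>"
    using n0 n1 cf_neg[of 1 0] cf_neg[of 0 1] cf_neg[of "- 1" 1] red[of "- 1" 0] red[of 0 "- 1"] red[of 1 "- 1"]
      red[of "- 2" 1] red[of 2 "- 1"] cf_neg[of "- 2" 1]
    by auto
  have n3: "cf 2 1 \<noteq> \<one>" "cf 1 1 \<noteq> \<one>" using n0(3) n1 red[of "- 1" 1] red[of "- 2" 1] by simp_all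
  have "i mod 3 \<in> {0, 1, 2}" "j mod 3 \<in> {0, 1, 2}" by auto
  then have "cf (i mod 3) (j mod 3) = \<one> \<longleftrightarrow> i mod 3 = 0 \<and> j mod 3 = 0"
    using n0 n2 n3 by auto
  then show ?thesis using red[of i j] by (simp add: dvd_eq_mod_eq_0)
qed

lemma cube_card:
  assumes fin: "finite (carrier G)" and d: "p \<noteq> q" "p \<noteq> r" "q \<noteq> r" and c: "cube_rel p q" "cube_rel p r"
  shows "card (diff_span {p, q, r}) = (if inv p \<otimes> r = (inv p \<otimes> q) [^] (2::int) then 3 else 9)"
    and "ord (inv p \<otimes> q) = 3"
proof -
  have "int (ord (inv p \<otimes> q)) dvd 3" "ord (inv p \<otimes> q) \<noteq> 1"
    using c(1) d(1) difference_eq_one_iff[of p q] ord_eq_1[of "inv p \<otimes> q"]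
    by (simp_all add: cube_rel_def int_pow_eq_id)
  then show o: "ord (inv p \<otimes> q) = 3"
  proof -
    assume *: "int (ord (inv p \<otimes> q)) dvd 3" "ord (inv p \<otimes> q) \<noteq> 1"
    then have "ord (inv p \<otimes> q) dvd 3" by (metis int_dvd_int_iff of_nat_numeral)
    moreover from this have "ord (inv p \<otimes> q) \<in> {0, 1, 2, 3}" by (auto dest!: dvd_imp_le)
    ultimately show ?thesis using *(2) by auto
  qed
  show "card (diff_span {p, q, r}) = (if inv p \<otimes> r = (inv p \<otimes> q) [^] (2::int) then 3 else 9)"
    using card_diff_span_cyclic[OF fin, of 2] o card_diff_span_rectangular[of 3 3] cube_cf[OF d c] by simp
qed

lemma skew_cf: "skew_rel p q r \<Longrightarrow> cf i j = \<one> \<longleftrightarrow> int (ord (inv p \<otimes> q)) dvd i - 2 * j"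
  by (simp add: cf_def skew_rel_def int_pow_pow int_pow_eq_id flip: int_pow_mult)

text \<open>The involution \<open>inv p \<otimes> q\<close> lies outside the cyclic group generated
  by \<open>inv p \<otimes> r\<close>, so the span is their direct product.\<close>

lemma square_cf:
  assumes sq: "square_rel p q" and nin: "\<nexists>k::int. inv p \<otimes> q = (inv p \<otimes> r) [^] k"
  shows "cf i j = \<one> \<longleftrightarrow> 2 dvd i \<and> int (ord (inv p \<otimes> r)) dvd j"
proof -
  have ev: "(inv p \<otimes> q) [^] i = \<one>" if "even i" for i :: int
    using that sq by (auto simp: square_rel_def int_pow_pow[symmetric] elim!: evenE)
  show ?thesis
  proof (cases "even i")
    case True
    then have "cf i j = (inv p \<otimes> r) [^] j" using ev[of i] by (simp add: cf_def)
    with True show ?thesis by (simp add: int_pow_eq_id)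
  next
    case False
    have "(inv p \<otimes> q) [^] i = inv p \<otimes> q" using ev[of "i - 1"] False int_pow_mult[of "inv p \<otimes> q" "i - 1" 1] by simp
    moreover have "x = (inv p \<otimes> r) [^] (- j)" if "x \<otimes> (inv p \<otimes> r) [^] j = \<one>" "x \<in> carrier G" for x
      using that by (simp add: int_pow_neg inv_equality[symmetric] inv_solve_right')
    moreover from this[of "inv p \<otimes> q"] have "inv p \<otimes> q \<otimes> (inv p \<otimes> r) [^] j \<noteq> \<one>" using nin by auto
    ultimately show ?thesis using False by (simp add: cf_def)
  qed
qed

lemma square_not_cyclic:
  assumes fin: "finite (carrier G)" and sq: "square_rel p q" and nin: "\<nexists>k::int. inv p \<otimes> q = (inv p \<otimes> r) [^] k"
  shows "card (diff_span {p, q, r}) = 2 * ord (inv p \<otimes> r)"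
  using card_diff_span_rectangular[of 2 "ord (inv p \<otimes> r)"] square_cf[OF sq nin] ord_ge_1[OF fin, of "inv p \<otimes> r"]
  by simp

text \<open>A cyclic group has at most one involution, namely the power of a generator with half the
  order as exponent.\<close>

lemma square_cyclic:
  assumes fin: "finite (carrier G)" and d: "p \<noteq> q" and sq: "square_rel p q"
    and k: "inv p \<otimes> q = (inv p \<otimes> r) [^] (k::int)"
  shows "card (diff_span {p, q, r}) = ord (inv p \<otimes> r)" "even (ord (inv p \<otimes> r))"
    "inv p \<otimes> q = (inv p \<otimes> r) [^] (int (ord (inv p \<otimes> r) div 2))"
proof -
  interpret B: commuting_triple G p r q using commuting_triple_subset by simp
  let ?n = "ord (inv p \<otimes> r)"
  show "card (diff_span {p, q, r}) = ?n"
    using B.card_diff_span_cyclic[OF fin k] by (simp add: insert_commute)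
  have n: "?n \<ge> 1" using ord_ge_1[OF fin, of "inv p \<otimes> r"] by simp
  have "int ?n dvd k * 2" using sq k by (simp add: square_rel_def int_pow_pow int_pow_eq_id)
  moreover have nd: "\<not> int ?n dvd k"
    using d k difference_eq_one_iff[of p q] by (simp add: int_pow_eq_id)
  ultimately show ev: "even ?n"
    by (metis coprime_dvd_mult_left_iff coprime_right_2_iff_odd even_of_nat)
  then obtain h where h: "?n = 2 * h" by (elim evenE)
  then obtain l where l: "k = int h * l" using \<open>int ?n dvd k * 2\<close> by (auto elim!: dvdE)
  then have "odd l" using nd h by (auto elim!: evenE)
  then have "int ?n dvd int h - k" using h l
    by (auto elim!: oddE simp: algebra_simps)
  then have "(inv p \<otimes> r) [^] k = (inv p \<otimes> r) [^] int h" by (simp add: int_pow_eq)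
  then show "inv p \<otimes> q = (inv p \<otimes> r) [^] int (?n div 2)" using k h by simp
qed

end

text \<open>
  This separates \<open>\<int>\<^sub>2 \<times> \<int>\<^sub>2\<^sub>m\<close> from \<open>\<int>\<^sub>4\<^sub>m\<close> among the subgroups: both kinds carry connection sets
  \<open>{p, q, r}\<close> with \<open>(p\<inverse> q)\<^sup>2 = \<one>\<close> and isomorphic graphs.
\<close>

definition no_4_or_unique_involution :: "('a, 'b) monoid_scheme \<Rightarrow> bool" where
  "no_4_or_unique_involution G \<longleftrightarrow>
     (\<forall>x\<in>carrier G. x [^]\<^bsub>G\<^esub> (4::int) = \<one>\<^bsub>G\<^esub> \<longrightarrow> x [^]\<^bsub>G\<^esub> (2::int) = \<one>\<^bsub>G\<^esub>) \<or>
     (\<forall>x\<in>carrier G. \<forall>y\<in>carrier G. x [^]\<^bsub>G\<^esub> (2::int) = \<one>\<^bsub>G\<^esub> \<longrightarrow> y [^]\<^bsub>G\<^esub> (2::int) = \<one>\<^bsub>G\<^esub> \<longrightarrow>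
        x \<noteq> \<one>\<^bsub>G\<^esub> \<longrightarrow> y \<noteq> \<one>\<^bsub>G\<^esub> \<longrightarrow> x = y)"

context group
begin

text \<open>Here the span is a direct product of a group of order two and a cyclic group of order
  \<open>n\<close>, and \<open>x\<close>, which will come from a second connection set, has the
  order of the whole span. For even \<open>n\<close>, both alternatives of \<open>inv\<close> fail,
  so \<open>n\<close> is odd, the span is cyclic, and taking \<open>q\<close> as base point shows
  this.\<close>

lemma square_relabel:
  assumes fin: "finite (carrier G)" and inv: "no_4_or_unique_involution G"
    and tr: "commuting_triple G p q r" and pq: "p \<noteq> q" and sq: "square_rel p q"
    and nin: "\<nexists>k::int. inv p \<otimes> q = (inv p \<otimes> r) [^] k"
    and x: "x \<in> carrier G" "ord x = card (diff_span {p, q, r})"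
  shows "\<exists>k::int. inv q \<otimes> p = (inv q \<otimes> r) [^] k"
proof -
  interpret commuting_triple G p q r by fact
  let ?n = "ord (inv p \<otimes> r)"
  have n: "?n \<ge> 1" using ord_ge_1[OF fin, of "inv p \<otimes> r"] by simp
  have x2: "ord x = 2 * ?n" using square_not_cyclic[OF fin sq nin] x(2) by simp
  have "odd ?n"
  proof
    assume "even ?n"
    then obtain m where m: "?n = 2 * m" by (elim evenE)
    have "m > 0" using n m by simp
    \<comment> \<open>\<open>y\<close> has order four, and \<open>w\<close> is an involution in the
      cyclic factor, hence different from \<open>inv p \<otimes> q\<close>. Each refutes one
      alternative of \<open>inv\<close>.\<close>
    define y where "y = x [^] int m"
    define w where "w = (inv p \<otimes> r) [^] int m"
    have yw [simp]: "y \<in> carrier G" "w \<in> carrier G" using x by (simp_all add: y_def w_def)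
    have o: "ord x = 4 * m" using x2 m by simp
    have "y [^] (4::int) = \<one>" "y [^] (2::int) \<noteq> \<one>"
      using x(1) o \<open>m > 0\<close> by (auto simp: y_def int_pow_pow int_pow_eq_id dest!: zdvd_imp_le)
    moreover have "w [^] (2::int) = \<one>" "w \<noteq> \<one>"
      using m \<open>m > 0\<close> by (auto simp: w_def int_pow_pow int_pow_eq_id dest!: zdvd_imp_le)
    moreover have "w \<noteq> inv p \<otimes> q" using nin w_def by metis
    moreover have "inv p \<otimes> q \<noteq> \<one>" using pq difference_eq_one_iff[of p q] by simp
    ultimately show False
      using inv sq unfolding no_4_or_unique_involution_def square_rel_def by (metis a yw)
  qed
  \<comment> \<open>An odd power keeps the component of order two and kills the other one.\<close>
  have "(inv q \<otimes> r) [^] int ?n = inv q \<otimes> p"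
  proof -
    have "(inv q \<otimes> r) [^] int ?n = cf (- int ?n) (int ?n)" by (simp add: difference_cf cf_pow)
    also have "\<dots> = cf (- 1) 0"
      using square_cf[OF sq nin, of "int ?n - 1" "- int ?n"] \<open>odd ?n\<close> by (simp add: cf_eq_iff[of "- int ?n" "int ?n"])
    finally show ?thesis by (simp add: difference_cf)
  qed
  then show ?thesis by metis
qed

text \<open>Inverting two commuting generators preserves their relations. The target is the image of
  the triple under \<open>t \<mapsto> inv t \<otimes> p\<close>, the connection set after an
  exchange of sides.\<close>

lemma affine_equiv_inverse_commuting:
  assumes hom: "homogeneous G" and tr: "commuting_triple G p q r"
  shows "affine_equiv {p, q, r} {\<one>, inv q \<otimes> p, inv r \<otimes> p}"
proof -
  interpret A: commuting_triple G p q r by fact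
  let ?a = "inv p \<otimes> q" and ?b = "inv p \<otimes> r"
  have d: "inv \<one> \<otimes> (inv q \<otimes> p) = inv ?a" "inv \<one> \<otimes> (inv r \<otimes> p) = inv ?b"
    by (simp_all add: inv_mult_group)
  have comm: "?a \<otimes> ?b = ?b \<otimes> ?a" by (rule A.commute)
  then have "inv ?b \<otimes> inv ?a = inv ?a \<otimes> inv ?b" using inv_mult_group[of ?a ?b] inv_mult_group[of ?b ?a] by simp
  then have tr': "commuting_triple G \<one> (inv q \<otimes> p) (inv r \<otimes> p)"
    by unfold_locales (simp_all only: d, auto)
  show ?thesis
  proof (rule affine_equiv_commuting[OF hom tr tr'])
    fix i j :: int
    have "inv (?a [^] i \<otimes> ?b [^] j) = inv ?b [^] j \<otimes> inv ?a [^] i"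
      by (simp only: inv_mult_group int_pow_closed A.a A.b int_pow_inv)
    also have "\<dots> = inv ?a [^] i \<otimes> inv ?b [^] j"
    proof -
      have "inv ?b [^] j \<otimes> inv ?a [^] i = ?b [^] (- j) \<otimes> ?a [^] (- i)" by (simp only: int_pow_inv int_pow_neg A.a A.b)
      also have "\<dots> = ?a [^] (- i) \<otimes> ?b [^] (- j)" using A.b_pow_a_pow[of "- j" "- i"] by simp
      finally show ?thesis by (simp only: int_pow_inv int_pow_neg A.a A.b)
    qed
    finally show "?a [^] i \<otimes> ?b [^] j = \<one> \<longleftrightarrow>
        (inv \<one> \<otimes> (inv q \<otimes> p)) [^] i \<otimes> (inv \<one> \<otimes> (inv r \<otimes> p)) [^] j = \<one>"
      unfolding d by (metis int_pow_closed A.a A.b m_closed inv_eq_1_iff)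
  qed
qed

lemma affine_equiv_square_cyclic:
  assumes fin: "finite (carrier G)" and hom: "homogeneous G"
    and tr: "commuting_triple G p q r" "commuting_triple G p' q' r'" and d: "p \<noteq> q" "p' \<noteq> q'"
    and sq: "square_rel p q" "square_rel p' q'"
    and k: "\<exists>k::int. inv p \<otimes> q = (inv p \<otimes> r) [^] k" "\<exists>k::int. inv p' \<otimes> q' = (inv p' \<otimes> r') [^] k"
    and card: "card (diff_span {p, q, r}) = card (diff_span {p', q', r'})"
  shows "affine_equiv {p, q, r} {p', q', r'}"
proof -
  interpret A: commuting_triple G p q r by fact
  interpret B: commuting_triple G p' q' r' by fact
  obtain k k' where k: "inv p \<otimes> q = (inv p \<otimes> r) [^] (k::int)" "inv p' \<otimes> q' = (inv p' \<otimes> r') [^] (k'::int)"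
    using k by blast
  note A = A.square_cyclic[OF fin d(1) sq(1) k(1)] and B = B.square_cyclic[OF fin d(2) sq(2) k(2)]
  have "affine_equiv {p, r, q} {p', r', q'}"
    using A B card by (intro affine_equiv_cyclic[OF hom, where k = "int (ord (inv p \<otimes> r) div 2)"]
      A.commuting_triple_subset B.commuting_triple_subset) simp_all
  then show ?thesis by (simp add: insert_commute)
qed

text \<open>The pair \<open>p\<close>, \<open>q\<close> is symmetric, but whether
  \<open>inv p \<otimes> q\<close> is a power of \<open>inv p \<otimes> r\<close> may depend on its
  order. When only one of the sets is of cyclic form, \<open>square_relabel\<close> exchanges the
  pair in the other one.\<close>

lemma affine_equiv_square:
  assumes fin: "finite (carrier G)" and hom: "homogeneous G" and inv: "no_4_or_unique_involution G"
    and tr: "commuting_triple G p q r" "commuting_triple G p' q' r'" and d: "p \<noteq> q" "p' \<noteq> q'"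
    and sq: "square_rel p q" "square_rel p' q'"
    and card: "card (diff_span {p, q, r}) = card (diff_span {p', q', r'})"
  shows "affine_equiv {p, q, r} {p', q', r'}"
proof -
  interpret A: commuting_triple G p q r by fact
  interpret B: commuting_triple G p' q' r' by fact
  let ?cyc = "\<lambda>p q r. \<exists>k::int. inv p \<otimes> q = (inv p \<otimes> r) [^] k"
  have perm: "{q, p, r} = {p, q, r}" "{q', p', r'} = {p', q', r'}" by auto
  consider "?cyc p q r" "?cyc p' q' r'" | "?cyc p q r" "\<not> ?cyc p' q' r'" | "\<not> ?cyc p q r" "?cyc p' q' r'"
    | "\<not> ?cyc p q r" "\<not> ?cyc p' q' r'" by blast
  then show ?thesis
  proof cases
    case 1
    then show ?thesis by (rule affine_equiv_square_cyclic[OF fin hom tr d sq _ _ card])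
  next
    case 2
    then have "ord (inv p \<otimes> r) = card (diff_span {p', q', r'})"
      using A.square_cyclic(1)[OF fin d(1) sq(1)] card by auto
    then have "?cyc q' p' r'" using square_relabel[OF fin inv tr(2) d(2) sq(2) 2(2)] A.b by blast
    then have "affine_equiv {p, q, r} {q', p', r'}"
      using 2 d sq card perm
      by (intro affine_equiv_square_cyclic[OF fin hom tr(1) B.commuting_triple_subset]) (auto intro: square_rel_sym)
    then show ?thesis using perm by simp
  next
    case 3
    then have "ord (inv p' \<otimes> r') = card (diff_span {p, q, r})"
      using B.square_cyclic(1)[OF fin d(2) sq(2)] card by auto
    then have "?cyc q p r" using square_relabel[OF fin inv tr(1) d(1) sq(1) 3(1)] B.b by blast
    then have "affine_equiv {q, p, r} {p', q', r'}"
      using 3 d sq card perm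
      by (intro affine_equiv_square_cyclic[OF fin hom A.commuting_triple_subset tr(2)]) (auto intro: square_rel_sym)
    then show ?thesis using perm by simp
  next
    case 4
    then have "ord (inv p \<otimes> r) = ord (inv p' \<otimes> r')"
      using A.square_not_cyclic[OF fin sq(1)] B.square_not_cyclic[OF fin sq(2)] card by simp
    then show ?thesis
      using A.square_cf[OF sq(1) 4(1)] B.square_cf[OF sq(2) 4(2)]
      by (intro affine_equiv_commuting[OF hom tr]) (simp flip: A.cf_def B.cf_def)
  qed
qed

text \<open>The order of the span, \<open>3\<close> or \<open>9\<close>, tells whether
  \<open>inv p \<otimes> r\<close> is the square of \<open>inv p \<otimes> q\<close>, and either
  answer fixes all relations.\<close>

lemma affine_equiv_cubes:
  assumes fin: "finite (carrier G)" and hom: "homogeneous G"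
    and tr: "commuting_triple G p q r" "commuting_triple G p' q' r'"
    and d: "p \<noteq> q" "p \<noteq> r" "q \<noteq> r" and d': "p' \<noteq> q'" "p' \<noteq> r'" "q' \<noteq> r'"
    and c: "cube_rel p q" "cube_rel p r" and c': "cube_rel p' q'" "cube_rel p' r'"
    and card: "card (diff_span {p, q, r}) = card (diff_span {p', q', r'})"
  shows "affine_equiv {p, q, r} {p', q', r'}"
proof -
  interpret A: commuting_triple G p q r by fact
  interpret B: commuting_triple G p' q' r' by fact
  note A = A.cube_card[OF fin d c] and B = B.cube_card[OF fin d' c']
  show ?thesis
  proof (cases "inv p \<otimes> r = (inv p \<otimes> q) [^] (2::int)")
    case True
    then have "card (diff_span {p', q', r'}) = 3" using A(1) card by (simp only: if_True simp_thms)
    then have "(if inv p' \<otimes> r' = (inv p' \<otimes> q') [^] (2::int) then 3 else 9) = (3::nat)"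
      by (simp only: B(1))
    then have "inv p' \<otimes> r' = (inv p' \<otimes> q') [^] (2::int)" by (rule contrapos_pp) simp
    with True show ?thesis by (rule affine_equiv_cyclic[OF hom tr]) (simp only: A(2) B(2))
  next
    case False
    then have "card (diff_span {p', q', r'}) = 9" using A(1) card by (simp only: if_False)
    then have "(if inv p' \<otimes> r' = (inv p' \<otimes> q') [^] (2::int) then 3 else 9) = (9::nat)"
      by (simp only: B(1))
    then have "inv p' \<otimes> r' \<noteq> (inv p' \<otimes> q') [^] (2::int)" by (rule contrapos_pn) simp
    then show ?thesis
      using A.cube_cf[OF d c False] B.cube_cf[OF d' c']
      by (intro affine_equiv_commuting[OF hom tr]) (simp flip: A.cf_def B.cf_def)
  qed
qed

end

section \<open>Closed walks of length six and the comparison of two commuting sets\<close>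

lemma (in group) triple_on_hexagon:
  assumes comm: "commuting_set G T" and card: "card T = 3"
    and xyz: "x \<in> T" "y \<in> T" "z \<in> T" "x \<noteq> y" "y \<noteq> z" "x \<noteq> z"
  shows "extends_to_closed 6 T [x, y, z]"
proof -
  have "finite T" using card by (metis card.infinite zero_neq_numeral)
  then have T: "T = {x, y, z}" using card xyz by (intro card_seteq[symmetric]) auto
  interpret commuting_triple G x y z using comm xyz by (simp add: commuting_set_def)
  show ?thesis unfolding T using xyz by (intro distinct_path_on_hexagon) auto
qed

lemma (in group) cubes_on_hexagons:
  assumes comm: "commuting_set G T" and card: "card T = 3" and cubes: "has_cubes T"
    and xyz: "x \<in> T" "y \<in> T" "z \<in> T" "x \<noteq> y" "y \<noteq> z"
  shows "extends_to_closed 6 T [x, y, z]"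
proof (cases "x = z")
  case True
  obtain p q r where pqr: "T = {p, q, r}" "cube_rel p q" "cube_rel p r"
    using has_cubesE[OF cubes card] by metis
  interpret A: commuting_triple G p q r using comm pqr(1) by (simp add: commuting_set_def)
  have "A.cf (- 3) 3 = A.cf (- 3) 0 \<otimes> A.cf 0 3" by (simp add: A.cf_mult)
  then have "cube_rel q r"
    using pqr(2,3) A.cf_neg[of 3 0] by (simp add: A.rel_cf) (simp add: cube_rel_def A.difference_cf A.cf_pow)
  moreover from this have "cube_rel q p" "cube_rel r p" "cube_rel r q"
    using pqr(2,3) by (simp_all add: cube_rel_sym)
  ultimately have xy: "cube_rel x y" using xyz pqr by auto
  obtain w where w: "w \<in> T" "w \<noteq> x" "w \<noteq> y"
  proof -
    have "T \<noteq> {x, y}" using card xyz(4) by auto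
    then show ?thesis using that xyz by blast
  qed
  have T: "T = {x, y, w}"
  proof -
    have "finite T" using card by (metis card.infinite zero_neq_numeral)
    then show ?thesis using card xyz w by (intro card_seteq[symmetric]) auto
  qed
  interpret B: commuting_triple G x y w using comm xyz w by (simp add: commuting_set_def)
  have "extends_to_closed 6 {x, y, w} [x, y, x]" using xyz(4) w xy by (intro B.cube_on_hexagon) auto
  then show ?thesis using T True by simp
qed (use triple_on_hexagon assms in blast)

context bicayley_iso
begin

text \<open>If the colour of \<open>p\<close> changed along \<open>p q p\<close>, the image path
  would have three distinct colours and lie on a hexagon because \<open>T\<close> commutes; pulled
  back, this hexagon contradicts \<open>rigid\<close>.\<close>

lemma rigid_commuting:
  assumes hom: "homogeneous G" and card: "card S = 3" and comm: "commuting_set G T"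
    and rigid: "\<And>q. q \<in> S \<Longrightarrow> \<exists>p\<in>S - {q}. \<not> extends_to_closed 6 S [p, q, p]"
  shows "affine_equiv S T"
proof -
  have edge: "\<exists>p\<in>S - {q}. \<forall>x. same_side x \<longrightarrow> col (inv q \<otimes> (p \<otimes> x)) p = col x p" if q: "q \<in> S" for q
  proof -
    obtain p where p: "p \<in> S" "p \<noteq> q" "\<not> extends_to_closed 6 S [p, q, p]" using rigid[OF q] by blast
    have "col (inv q \<otimes> (p \<otimes> x)) p = col x p" if x: "same_side x" for x
    proof (rule ccontr)
      let ?y = "inv q \<otimes> (p \<otimes> x)"
      assume ne: "col ?y p \<noteq> col x p"
      have y: "same_side ?y" by (rule same_side_step[OF x p(1) q])
      have "col x p \<noteq> col ?y q" using col_adj[OF x p(1) q p(2)] .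
      moreover have "col ?y q \<noteq> col ?y p" using col_inj[OF y q p(1)] p(2) by auto
      ultimately have "extends_to_closed 6 T [col x p, col ?y q, col ?y p]"
        using ne card card_eq x y p q by (intro triple_on_hexagon[OF comm]) (auto simp: col_step(1))
      then have "extends_to_closed 6 S [p, q, p]"
        using p q by (intro extends_to_closed_preimage[OF x]) auto
      with p(3) show False by simp
    qed
    with p show ?thesis by blast
  qed
  obtain p q r where "S = {p, q, r}" using card by (auto simp: card_3_iff)
  then show ?thesis
    by (rule affine_equiv_of_col_constant[OF hom]) (rule col_constant[OF card edge])
qed

text \<open>The span of \<open>S\<close> is cyclic of order \<open>n\<close>, which is
  \<open>3\<close> or \<open>9\<close>. The path \<open>r p r\<close> must lie on a hexagon since
  all paths in \<open>T\<close> do, so \<open>n\<close> divides one of \<open>6\<close>,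
  \<open>3\<close>, \<open>- 7\<close>, \<open>- 8\<close>. This leaves \<open>n = 3\<close>, where
  \<open>q = r\<close>.\<close>

lemma no_skew_cubes:
  assumes fin: "finite (carrier G)" and card: "card S = 3" and comm: "commuting_set G S" "commuting_set G T"
    and skew: "has_skew S" and cubes: "has_cubes T"
  shows False
proof -
  have cT: "card T = 3" using card card_eq by simp
  obtain p q r where pqr: "S = {p, q, r}" "skew_rel p q r" and d: "p \<noteq> q" "p \<noteq> r" "q \<noteq> r"
    using has_skewE[OF skew card] by metis
  obtain p' q' r' where pqr': "T = {p', q', r'}" "cube_rel p' q'" "cube_rel p' r'"
    and d': "p' \<noteq> q'" "p' \<noteq> r'" "q' \<noteq> r'"
    using has_cubesE[OF cubes cT] by metis
  interpret A: commuting_triple G p q r using comm pqr(1) by (simp add: commuting_set_def)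
  interpret A': commuting_triple G r p q by (rule A.commuting_triple_subset) auto
  interpret B: commuting_triple G p' q' r' using comm pqr'(1) by (simp add: commuting_set_def)
  let ?n = "ord (inv p \<otimes> q)"
  have "card (diff_span {p, q, r}) = ?n"
    using A.card_diff_span_cyclic[OF fin] pqr(2) by (simp add: skew_rel_def)
  then have "?n = card (diff_span T)" using card_diff_span[OF fin] pqr(1) by simp
  then have n: "?n = 3 \<or> ?n = 9"
    using B.cube_card(1)[OF fin d' pqr'(2,3)] pqr'(1) by (metis (full_types))
  let ?y = "inv p \<otimes> (r \<otimes> \<one>)"
  have S': "p \<in> S" "r \<in> S" using pqr(1) by auto
  have y: "same_side ?y" by (rule same_side_step[OF same_side_one S'(2,1)])
  have "extends_to_closed 6 T [col \<one> r, col ?y p, col ?y r]"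
  proof (rule cubes_on_hexagons[OF comm(2) cT cubes])
    show "col \<one> r \<noteq> col ?y p" using col_adj[OF same_side_one S'(2,1)] d(2) by blast
    show "col ?y p \<noteq> col ?y r" using col_inj[OF y S'] d(2) by blast
  qed (use S' y in \<open>auto intro: col_step(1)\<close>)
  then have "extends_to_closed 6 T (image_word \<one> [r, p, r])" by (simp only: image_word.simps)
  then have "extends_to_closed 6 S [r, p, r]"
    using pqr(1) by (intro extends_to_closed_preimage[of \<one>]) auto
  moreover have "S = {r, p, q}" using pqr(1) by auto
  ultimately have *: "square_rel r q \<or> skew_rel p r q \<or> cube_rel r p \<or> skew_rel r p q \<or> skew_rel r q p"
    using A'.path_on_hexagon by simp
  have iff: "A.cf i j = \<one> \<longleftrightarrow> int ?n dvd i - 2 * j" for i j by (rule A.skew_cf[OF pqr(2)])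
  have 1: "square_rel r q \<longleftrightarrow> int ?n dvd 6" "skew_rel p r q \<longleftrightarrow> int ?n dvd 3" "cube_rel r p \<longleftrightarrow> int ?n dvd 6"
    "skew_rel r p q \<longleftrightarrow> int ?n dvd - 7" "skew_rel r q p \<longleftrightarrow> int ?n dvd - 8"
    unfolding square_rel_def skew_rel_def cube_rel_def A.difference_cf A.cf_pow A.cf_eq_iff
    by (simp_all add: iff A.difference_cf(1) A.cf_eq_iff[of 0 1] A.cf_eq_iff[of 1 0] A.cf_eq_iff[of 1 "- 1"] A.cf_eq_iff[of 0 "- 1"])
  have "?n = 3" using * 1 n by auto
  then have "A.cf (- 1) 1 = \<one>" by (simp add: iff)
  then show False using A.cf_neq_one d by simp
qed

lemma no_square_cubes:
  assumes fin: "finite (carrier G)" and card: "card S = 3" and comm: "commuting_set G S" "commuting_set G T"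
    and square: "has_square S" and cubes: "has_cubes T"
  shows False
proof -
  have cT: "card T = 3" using card card_eq by simp
  obtain p q r where pqr: "S = {p, q, r}" "square_rel p q" and d: "p \<noteq> q"
    using has_squareE[OF square card] by metis
  obtain p' q' r' where pqr': "T = {p', q', r'}" "cube_rel p' q'" "cube_rel p' r'"
    and d': "p' \<noteq> q'" "p' \<noteq> r'" "q' \<noteq> r'"
    using has_cubesE[OF cubes cT] by metis
  interpret B: commuting_triple G p' q' r' using comm pqr'(1) by (simp add: commuting_set_def)
  have "even (card (diff_span S))" by (rule even_card_diff_span_square[OF S pqr(2) d]) (use pqr(1) in auto)
  moreover have "card (diff_span T) \<in> {3, 9}"
    using B.cube_card(1)[OF fin d' pqr'(2,3)] pqr'(1) by (metis (full_types) insertCI)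
  ultimately show False using card_diff_span[OF fin] by auto
qed

text \<open>In the cyclic span of \<open>T\<close>, the image of a \<open>4\<close>-cycle makes the
  order divide one of \<plusminus>1, \<plusminus>2, \<plusminus>4, \<plusminus>5, \<plusminus>6. The
  order is even because \<open>S\<close> has an involution, and \<open>2\<close>, \<open>4\<close>,
  \<open>6\<close> are the doubled differences of the three letters.\<close>

lemma square_skew:
  assumes fin: "finite (carrier G)" and card: "card S = 3" and comm: "commuting_set G S" "commuting_set G T"
    and square: "has_square S" and skew: "has_skew T"
  shows "has_square T"
proof -
  have cT: "card T = 3" using card card_eq by simp
  obtain p q r where pqr: "S = {p, q, r}" "square_rel p q" and d: "p \<noteq> q" "p \<noteq> r" "q \<noteq> r"
    using has_squareE[OF square card] by metis
  obtain p' q' r' where pqr': "T = {p', q', r'}" "skew_rel p' q' r'"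
    using has_skewE[OF skew cT] by metis
  interpret A: commuting_triple G p q r using comm pqr(1) by (simp add: commuting_set_def)
  interpret B: commuting_triple G p' q' r' using comm pqr'(1) by (simp add: commuting_set_def)
  let ?n = "ord (inv p' \<otimes> q')"
  have "card (diff_span {p', q', r'}) = ?n"
    using B.card_diff_span_cyclic[OF fin] pqr'(2) by (simp add: skew_rel_def)
  then have ev: "even ?n"
    using even_card_diff_span_square[OF S pqr(2) d(1)] card_diff_span[OF fin] pqr pqr' by simp
  have "extends_to_closed 4 S [p]" unfolding pqr(1) by (rule A.square_on_4_cycle[OF d pqr(2)])
  then have "extends_to_closed 4 T (image_word \<one> [p])" by (rule extends_to_closed_image[OF same_side_one])
  then have "extends_to_closed 4 {p', q', r'} [col \<one> p]" by (simp add: pqr')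
  moreover have "col \<one> p \<in> {p', q', r'}" using col_step(1)[of \<one> p] pqr pqr' by simp
  ultimately have "\<exists>(i, j)\<in>{(-2, 0), (-2, 1), (-2, 2), (-1, -1), (-1, 2), (0, -2), (0, 2),
      (1, -2), (1, 1), (2, -2), (2, -1), (2, 0)}. B.cf i j = \<one>"
    by (rule B.closed_4_word_cf)
  then obtain ij where ij0: "ij \<in> {(-2, 0), (-2, 1), (-2, 2), (-1, -1), (-1, 2), (0, -2), (0, 2),
      (1, -2), (1, 1), (2, -2), (2, -1), (2, 0)}" "case ij of (i, j) \<Rightarrow> B.cf i j = \<one>"
    by (elim bexE)
  obtain i j where e: "ij = (i, j)" by (cases ij)
  note ij = ij0(1)[unfolded e] ij0(2)[unfolded e case_prod_conv]
  have iff: "B.cf i j = \<one> \<longleftrightarrow> int ?n dvd i - 2 * j" for i j by (rule B.skew_cf[OF pqr'(2)])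
  have odd: "\<not> int ?n dvd k" if "odd k" for k using that ev by (metis dvd_trans even_of_nat)
  have rel: "square_rel p' q' \<longleftrightarrow> int ?n dvd 2" "square_rel p' r' \<longleftrightarrow> int ?n dvd 4" "square_rel q' r' \<longleftrightarrow> int ?n dvd 6"
    by (simp_all add: B.rel_cf iff)
  have "int ?n dvd i - 2 * j" using ij iff by simp
  then have "int ?n dvd 2 \<or> int ?n dvd 4 \<or> int ?n dvd 6"
    using ij(1) odd[of 1] odd[of 5] odd[of "- 1"] odd[of "- 5"] by auto
  then have "square_rel p' q' \<or> square_rel p' r' \<or> square_rel q' r'" using rel by simp
  moreover have "T = {p', r', q'}" "T = {q', r', p'}" using pqr' by auto
  ultimately show ?thesis using pqr'(1) unfolding has_square_def by metis
qed

end

theorem (in bicayley_iso) affine_equiv_commuting_sets: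
  assumes fin: "finite (carrier G)" and hom: "homogeneous G" and inv: "no_4_or_unique_involution G"
    and card: "card S = 3" and comm: "commuting_set G S" "commuting_set G T"
  shows "affine_equiv S T"
proof -
  interpret inverse: bicayley_iso G T S f_inv by (rule bicayley_iso_inverse)
  have card': "card T = 3" using card card_eq by simp
  have card_span: "card (diff_span S) = card (diff_span T)" by (rule card_diff_span[OF fin])
  have sq: "affine_equiv S T" if h: "has_square S" "has_square T"
  proof -
    obtain p q r where pqr: "S = {p, q, r}" "p \<noteq> q" "square_rel p q"
      using has_squareE[OF h(1) card] by metis
    obtain p' q' r' where pqr': "T = {p', q', r'}" "p' \<noteq> q'" "square_rel p' q'"
      using has_squareE[OF h(2) card'] by metis
    have "commuting_triple G p q r" "commuting_triple G p' q' r'"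
      using comm pqr(1) pqr'(1) by (simp_all add: commuting_set_def)
    then show ?thesis
      using card_span pqr(2,3) pqr'(2,3) unfolding pqr(1) pqr'(1) by (intro affine_equiv_square[OF fin hom inv])
  qed
  have sk: "affine_equiv S T" if h: "has_skew S" "has_skew T"
  proof -
    obtain p q r where pqr: "S = {p, q, r}" "skew_rel p q r"
      using has_skewE[OF h(1) card] by metis
    obtain p' q' r' where pqr': "T = {p', q', r'}" "skew_rel p' q' r'"
      using has_skewE[OF h(2) card'] by metis
    interpret A: commuting_triple G p q r using comm pqr(1) by (simp add: commuting_set_def)
    interpret B: commuting_triple G p' q' r' using comm pqr'(1) by (simp add: commuting_set_def)
    have "ord (inv p \<otimes> q) = ord (inv p' \<otimes> q')"
      using A.card_diff_span_cyclic[OF fin] B.card_diff_span_cyclic[OF fin] pqr pqr' card_span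
      by (simp add: skew_rel_def)
    then show ?thesis
      using pqr(2) pqr'(2) unfolding pqr(1) pqr'(1) skew_rel_def
      by (intro affine_equiv_cyclic[OF hom A.commuting_triple_axioms B.commuting_triple_axioms])
  qed
  have cu: "affine_equiv S T" if h: "has_cubes S" "has_cubes T"
  proof -
    obtain p q r where pqr: "S = {p, q, r}" "p \<noteq> q" "p \<noteq> r" "q \<noteq> r" "cube_rel p q" "cube_rel p r"
      using has_cubesE[OF h(1) card] by metis
    obtain p' q' r' where pqr': "T = {p', q', r'}" "p' \<noteq> q'" "p' \<noteq> r'" "q' \<noteq> r'" "cube_rel p' q'" "cube_rel p' r'"
      using has_cubesE[OF h(2) card'] by metis
    have "commuting_triple G p q r" "commuting_triple G p' q' r'"
      using comm pqr(1) pqr'(1) by (simp_all add: commuting_set_def)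
    then show ?thesis
      using card_span pqr(2-) pqr'(2-) unfolding pqr(1) pqr'(1) by (intro affine_equiv_cubes[OF fin hom])
  qed
  show ?thesis
  proof (cases "\<forall>q\<in>S. \<exists>p\<in>S - {q}. \<not> extends_to_closed 6 S [p, q, p]")
    case True
    then show ?thesis using rigid_commuting[OF hom card comm(2)] by blast
  next
    case nonrigid: False
    show ?thesis
    proof (cases "\<forall>q\<in>T. \<exists>p\<in>T - {q}. \<not> extends_to_closed 6 T [p, q, p]")
      case True
      then have "affine_equiv T S" using inverse.rigid_commuting[OF hom card' comm(1)] by blast
      then show ?thesis using affine_equiv_sym T by blast
    next
      case False
      \<comment> \<open>With both sets exceptional, equal types are settled by the order of the
        span, a square passes to a skew set, and cubes go with neither of the other types.\<close>
      then have "has_square T \<or> has_skew T \<or> has_cubes T" using nonrigid_cases[OF comm(2) card'] by blast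
      moreover have "has_square S \<or> has_skew S \<or> has_cubes S"
        using nonrigid nonrigid_cases[OF comm(1) card] by blast
      ultimately show ?thesis
        using sq sk cu square_skew[OF fin card comm] no_square_cubes[OF fin card comm] no_skew_cubes[OF fin card comm]
          inverse.square_skew[OF fin card' comm(2,1)] inverse.no_square_cubes[OF fin card' comm(2,1)]
          inverse.no_skew_cubes[OF fin card' comm(2,1)]
        by blast
    qed
  qed
qed

section \<open>Extensions of the quaternion group\<close>

definition Q8_neg :: "int \<times> int \<times> int \<times> int" where
  "Q8_neg = (- 1, 0, 0, 0)"

lemma Q8_mult: "x \<otimes>\<^bsub>Q8\<^esub> y = quat_mult x y" and Q8_one: "\<one>\<^bsub>Q8\<^esub> = (1, 0, 0, 0)"
  by (simp_all add: Q8_def)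

lemma Q8_cases:
  assumes "x \<in> carrier Q8"
  shows "x \<in> {(1, 0, 0, 0), (- 1, 0, 0, 0), (0, 1, 0, 0), (0, - 1, 0, 0),
    (0, 0, 1, 0), (0, 0, - 1, 0), (0, 0, 0, 1), (0, 0, 0, - 1)}"
  using assms by (simp add: Q8_def)

lemma Q8_neg_closed: "Q8_neg \<in> carrier Q8"
  by (simp add: Q8_neg_def Q8_def)

lemma Q8_neg_square: "Q8_neg \<otimes>\<^bsub>Q8\<^esub> Q8_neg = \<one>\<^bsub>Q8\<^esub>"
  by (simp add: Q8_neg_def Q8_def)

lemma Q8_neg_central: "x \<in> carrier Q8 \<Longrightarrow> Q8_neg \<otimes>\<^bsub>Q8\<^esub> x = x \<otimes>\<^bsub>Q8\<^esub> Q8_neg"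
  unfolding Q8_mult Q8_neg_def by (drule Q8_cases, elim insertE emptyE) simp_all

lemma Q8_involution: "x \<in> carrier Q8 \<Longrightarrow> x \<otimes>\<^bsub>Q8\<^esub> x = \<one>\<^bsub>Q8\<^esub> \<Longrightarrow> x = \<one>\<^bsub>Q8\<^esub> \<or> x = Q8_neg"
  unfolding Q8_mult Q8_one Q8_neg_def by (drule Q8_cases, elim insertE emptyE) simp_all

lemma Q8_pow_4: "x \<in> carrier Q8 \<Longrightarrow> x \<otimes>\<^bsub>Q8\<^esub> x \<otimes>\<^bsub>Q8\<^esub> (x \<otimes>\<^bsub>Q8\<^esub> x) = \<one>\<^bsub>Q8\<^esub>"
  unfolding Q8_mult Q8_one by (drule Q8_cases, elim insertE emptyE) simp_all

lemma Q8_noncommuting: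
  assumes "x \<in> carrier Q8" "y \<in> carrier Q8" "x \<otimes>\<^bsub>Q8\<^esub> y \<noteq> y \<otimes>\<^bsub>Q8\<^esub> x"
  shows "x \<otimes>\<^bsub>Q8\<^esub> x = Q8_neg" "y \<otimes>\<^bsub>Q8\<^esub> y = Q8_neg"
    "y \<otimes>\<^bsub>Q8\<^esub> x = Q8_neg \<otimes>\<^bsub>Q8\<^esub> (x \<otimes>\<^bsub>Q8\<^esub> y)"
    "distinct [\<one>\<^bsub>Q8\<^esub>, Q8_neg, x, y, x \<otimes>\<^bsub>Q8\<^esub> y]"
proof -
  have "x \<otimes>\<^bsub>Q8\<^esub> x = Q8_neg \<and> y \<otimes>\<^bsub>Q8\<^esub> y = Q8_neg \<and> y \<otimes>\<^bsub>Q8\<^esub> x = Q8_neg \<otimes>\<^bsub>Q8\<^esub> (x \<otimes>\<^bsub>Q8\<^esub> y)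
    \<and> distinct [\<one>\<^bsub>Q8\<^esub>, Q8_neg, x, y, x \<otimes>\<^bsub>Q8\<^esub> y]"
    using assms(3) Q8_cases[OF assms(1)] Q8_cases[OF assms(2)] unfolding Q8_mult Q8_one Q8_neg_def
    by (elim insertE emptyE) simp_all
  then show "x \<otimes>\<^bsub>Q8\<^esub> x = Q8_neg" "y \<otimes>\<^bsub>Q8\<^esub> y = Q8_neg"
    "y \<otimes>\<^bsub>Q8\<^esub> x = Q8_neg \<otimes>\<^bsub>Q8\<^esub> (x \<otimes>\<^bsub>Q8\<^esub> y)"
    "distinct [\<one>\<^bsub>Q8\<^esub>, Q8_neg, x, y, x \<otimes>\<^bsub>Q8\<^esub> y]" by (iprover elim: conjE)+
qed

text \<open>A noncommuting pair produces five distinct elements, and \<open>8\<close> is the only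
  divisor of \<open>8\<close> that is at least \<open>5\<close>.\<close>

lemma Q8_subgroup_eq:
  assumes H: "subgroup H Q8" and xy: "x \<in> H" "y \<in> H" "x \<otimes>\<^bsub>Q8\<^esub> y \<noteq> y \<otimes>\<^bsub>Q8\<^esub> x"
  shows "H = carrier Q8"
proof -
  have HG: "H \<subseteq> carrier Q8" using H by (rule subgroup.subset)
  have fin: "finite (carrier Q8)" by (simp add: Q8_def)
  note n = Q8_noncommuting[OF subsetD[OF HG xy(1)] subsetD[OF HG xy(2)] xy(3)]
  have "Q8_neg \<in> H" using subgroup.m_closed[OF H xy(1,1)] n(1) by simp
  then have sub5: "set [\<one>\<^bsub>Q8\<^esub>, Q8_neg, x, y, x \<otimes>\<^bsub>Q8\<^esub> y] \<subseteq> H"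
    using xy subgroup.one_closed[OF H] subgroup.m_closed[OF H] by simp
  have finH: "finite H" using HG fin by (rule finite_subset)
  have "length [\<one>\<^bsub>Q8\<^esub>, Q8_neg, x, y, x \<otimes>\<^bsub>Q8\<^esub> y] \<le> card H"
    using card_mono[OF finH sub5] unfolding distinct_card[OF n(4)] .
  then have d: "5 \<le> card H" by simp
  have d': "card H dvd 8" using group.lagrange[OF group_Q8 H] order_Q8 by (metis dvd_triv_right)
  then have "card H \<le> 8" by (auto dest: dvd_imp_le)
  with d have "card H \<in> {5, 6, 7, 8}" by auto
  with d' have "card H = order Q8" by (auto simp: order_Q8)
  then show ?thesis using HG fin by (simp add: order_def card_subset_eq)
qed

lemma Q8_ex_noncommuting_with:
  assumes "x \<in> carrier Q8" "x \<noteq> \<one>\<^bsub>Q8\<^esub>" "x \<noteq> Q8_neg"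
  shows "\<exists>y\<in>carrier Q8. x \<otimes>\<^bsub>Q8\<^esub> y \<noteq> y \<otimes>\<^bsub>Q8\<^esub> x"
proof -
  have "(0, 1, 0, 0) \<in> carrier Q8" "(0, 0, 1, 0) \<in> carrier Q8" by (simp_all add: Q8_def)
  moreover have "x \<otimes>\<^bsub>Q8\<^esub> (0, 1, 0, 0) \<noteq> (0, 1, 0, 0) \<otimes>\<^bsub>Q8\<^esub> x \<or> x \<otimes>\<^bsub>Q8\<^esub> (0, 0, 1, 0) \<noteq> (0, 0, 1, 0) \<otimes>\<^bsub>Q8\<^esub> x"
    using assms(2,3) Q8_cases[OF assms(1)] unfolding Q8_mult Q8_one Q8_neg_def by (elim insertE emptyE) simp_all
  ultimately show ?thesis by metis
qed

lemma Q8_commuting_with: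
  assumes "x \<in> carrier Q8" "x \<noteq> \<one>\<^bsub>Q8\<^esub>" "x \<noteq> Q8_neg" "y \<in> carrier Q8" "x \<otimes>\<^bsub>Q8\<^esub> y = y \<otimes>\<^bsub>Q8\<^esub> x"
  shows "y \<in> {\<one>\<^bsub>Q8\<^esub>, x, x \<otimes>\<^bsub>Q8\<^esub> x, x \<otimes>\<^bsub>Q8\<^esub> x \<otimes>\<^bsub>Q8\<^esub> x}"
  using assms(2,3,5) Q8_cases[OF assms(1)] Q8_cases[OF assms(4)] unfolding Q8_mult Q8_one Q8_neg_def
  by (elim insertE emptyE) simp_all

lemma ex_Q8_noncommuting:
  "\<exists>x\<in>carrier Q8. \<exists>y\<in>carrier Q8. x \<otimes>\<^bsub>Q8\<^esub> y \<noteq> y \<otimes>\<^bsub>Q8\<^esub> x"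
  by (rule bexI[of _ "(0, 1, 0, 0)"], rule bexI[of _ "(0, 0, 1, 0)"]) (simp_all add: Q8_def)

text \<open>The relations of any noncommuting pair \<open>x\<close>, \<open>y\<close> in
  \<open>Q8\<close>, from \<open>x\<^sup>2 = y\<^sup>2 = - 1\<close>; they do not depend on the
  pair.\<close>

definition Q8_exponents :: "int \<Rightarrow> int \<Rightarrow> int \<Rightarrow> bool" where
  "Q8_exponents i j e \<longleftrightarrow> even i \<and> even j \<and> even (i div 2 + j div 2 + e)"

lemma commutator_pair_Q8:
  assumes "x \<in> carrier Q8" "y \<in> carrier Q8" "x \<otimes>\<^bsub>Q8\<^esub> y \<noteq> y \<otimes>\<^bsub>Q8\<^esub> x"
  shows "commutator_pair Q8 x y Q8_neg"
  by (intro commutator_pair.intro commutator_pair_axioms.intro group_Q8)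
    (fact assms Q8_neg_closed Q8_neg_square Q8_neg_central[OF assms(1)] Q8_neg_central[OF assms(2)]
      Q8_noncommuting(3)[OF assms])+

lemma Q8_nf_eq_one_iff:
  assumes x: "x \<in> carrier Q8" "y \<in> carrier Q8" "x \<otimes>\<^bsub>Q8\<^esub> y \<noteq> y \<otimes>\<^bsub>Q8\<^esub> x"
  shows "commutator_pair.nf Q8 x y Q8_neg i j e = \<one>\<^bsub>Q8\<^esub> \<longleftrightarrow> Q8_exponents i j e"
proof -
  interpret commutator_pair Q8 x y Q8_neg by (rule commutator_pair_Q8[OF x])
  have sq: "nf 2 0 0 = nf 0 0 1" "nf 0 2 0 = nf 0 0 1"
    using Q8_noncommuting[OF x] nf_mult[of 1 0 0 1 0 0] nf_mult[of 0 1 0 0 1 0] by (simp_all add: nf_a nf_b nf_z)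
  have "nf (2 * k) 0 0 = nf 0 0 k" "nf 0 (2 * k) 0 = nf 0 0 k" for k
    using int_pow_pow[of x 2 k] int_pow_pow[of y 2 k] sq by (simp_all add: nf_def)
  then have "nf (i + 2 * k) j e = nf i j (e + k)" "nf i (j + 2 * l) e = nf i j (e + l)" for i j e k l
    using nf_mult[of "2 * k" 0 0 i j e] nf_mult[of 0 0 k i j e] nf_mult[of i j e 0 "2 * l" 0] nf_mult[of i j e 0 0 l]
    by (simp_all add: add.commute)
  then have "nf (i + 2 * k) (j + 2 * l) e = nf i j (e + k + l)" for i j e k l by (simp add: ac_simps)
  from this[of "i mod 2" "i div 2" "j mod 2" "j div 2" e]
  have "nf i j e = nf (i mod 2) (j mod 2) (e + i div 2 + j div 2)" by simp
  also have "\<dots> = nf (i mod 2) (j mod 2) ((e + i div 2 + j div 2) mod 2)"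
    by (rule nf_parity) presburger
  finally have red: "nf i j e = nf (i mod 2) (j mod 2) ((e + i div 2 + j div 2) mod 2)" .
  \<comment> \<open>These are the eight normal forms with exponents in \<open>{0, 1}\<close>, to
    which \<open>red\<close> reduces all others.\<close>
  have "distinct [\<one>\<^bsub>Q8\<^esub>, Q8_neg, x, y, x \<otimes>\<^bsub>Q8\<^esub> Q8_neg, y \<otimes>\<^bsub>Q8\<^esub> Q8_neg, x \<otimes>\<^bsub>Q8\<^esub> y, x \<otimes>\<^bsub>Q8\<^esub> (y \<otimes>\<^bsub>Q8\<^esub> Q8_neg)]"
    using x(3) Q8_cases[OF x(1)] Q8_cases[OF x(2)] unfolding Q8_mult Q8_one Q8_neg_def
    by (elim insertE emptyE) simp_all
  then have ne: "Q8_neg \<noteq> \<one>\<^bsub>Q8\<^esub>" "x \<noteq> \<one>\<^bsub>Q8\<^esub>" "y \<noteq> \<one>\<^bsub>Q8\<^esub>" "x \<otimes>\<^bsub>Q8\<^esub> Q8_neg \<noteq> \<one>\<^bsub>Q8\<^esub>" "y \<otimes>\<^bsub>Q8\<^esub> Q8_neg \<noteq> \<one>\<^bsub>Q8\<^esub>"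
    "x \<otimes>\<^bsub>Q8\<^esub> y \<noteq> \<one>\<^bsub>Q8\<^esub>" "x \<otimes>\<^bsub>Q8\<^esub> (y \<otimes>\<^bsub>Q8\<^esub> Q8_neg) \<noteq> \<one>\<^bsub>Q8\<^esub>"
    by auto
  have "i mod 2 = 0 \<or> i mod 2 = 1" "j mod 2 = 0 \<or> j mod 2 = 1"
    "(e + i div 2 + j div 2) mod 2 = 0 \<or> (e + i div 2 + j div 2) mod 2 = 1" by presburger+
  then have "nf i j e = \<one>\<^bsub>Q8\<^esub> \<longleftrightarrow> i mod 2 = 0 \<and> j mod 2 = 0 \<and> (e + i div 2 + j div 2) mod 2 = 0"
    unfolding red using ne x Q8_neg_closed by (auto simp: nf_def)
  then show ?thesis unfolding Q8_exponents_def by presburger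
qed

lemma (in group) odd_order_pow_eq_one:
  assumes odd: "odd (order G)" and x: "x \<in> carrier G" and "x [^] (k::int) = \<one>" and k: "k \<in> {2, 4, - 2, - 4}"
  shows "x = \<one>"
proof -
  have "odd (ord x)" using ord_dvd_group_order[OF x] odd by (metis dvd_trans)
  then have "coprime (int (ord x)) 4"
    using coprime_power_right_iff[of "int (ord x)" 2 2] by simp
  moreover have "int (ord x) dvd 4" using assms int_pow_eq_id[OF x, of k]
    by (auto intro: dvd_trans[of _ 2])
  ultimately have "int (ord x) dvd 1" by (metis coprime_def dvd_refl)
  then show ?thesis using ord_eq_1[OF x] by simp
qed

text \<open>A group \<open>G \<cong> U \<times> Q\<^sub>8\<close> with \<open>U\<close> abelian of odd order, given by its two projections.\<close>

locale q8_product = group G for G (structure) +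
  fixes U :: "('u, 'v) monoid_scheme" and \<pi> :: "'a \<Rightarrow> 'u" and \<rho> :: "'a \<Rightarrow> int \<times> int \<times> int \<times> int"
  assumes U: "comm_group U" and odd_U: "odd (order U)"
    and \<pi>: "\<pi> \<in> hom G U" and \<rho>: "\<rho> \<in> hom G Q8"
    and inj: "\<And>x y. x \<in> carrier G \<Longrightarrow> y \<in> carrier G \<Longrightarrow> \<pi> x = \<pi> y \<Longrightarrow> \<rho> x = \<rho> y \<Longrightarrow> x = y"
    and surj: "\<And>u s. u \<in> carrier U \<Longrightarrow> s \<in> carrier Q8 \<Longrightarrow> \<exists>x\<in>carrier G. \<pi> x = u \<and> \<rho> x = s"
begin

sublocale U: comm_group U by (rule U)
sublocale \<pi>: group_hom G U \<pi> using \<pi> by unfold_locales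
sublocale \<rho>: group_hom G Q8 \<rho> using \<rho> group_Q8 by (simp add: group_hom_def group_hom_axioms_def is_group)

definition central_involution :: 'a where
  "central_involution = (SOME z. z \<in> carrier G \<and> \<pi> z = \<one>\<^bsub>U\<^esub> \<and> \<rho> z = Q8_neg)"

lemma central_involution: "central_involution \<in> carrier G" "\<pi> central_involution = \<one>\<^bsub>U\<^esub>" "\<rho> central_involution = Q8_neg"
proof -
  have "\<exists>z. z \<in> carrier G \<and> \<pi> z = \<one>\<^bsub>U\<^esub> \<and> \<rho> z = Q8_neg"
    using surj[OF U.one_closed Q8_neg_closed] by blast
  then have "central_involution \<in> carrier G \<and> \<pi> central_involution = \<one>\<^bsub>U\<^esub> \<and> \<rho> central_involution = Q8_neg" unfolding central_involution_def by (rule someI_ex)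
  then show "central_involution \<in> carrier G" "\<pi> central_involution = \<one>\<^bsub>U\<^esub>" "\<rho> central_involution = Q8_neg" by auto
qed

lemma \<rho>_noncommuting:
  assumes "a \<in> carrier G" "b \<in> carrier G" "a \<otimes> b \<noteq> b \<otimes> a"
  shows "\<rho> a \<otimes>\<^bsub>Q8\<^esub> \<rho> b \<noteq> \<rho> b \<otimes>\<^bsub>Q8\<^esub> \<rho> a"
  using assms inj[of "a \<otimes> b" "b \<otimes> a"] by (auto simp: U.m_comm)

lemma commutator_pair_noncommuting:
  assumes "a \<in> carrier G" "b \<in> carrier G" "a \<otimes> b \<noteq> b \<otimes> a"
  shows "commutator_pair G a b central_involution"
proof -
  note n = Q8_noncommuting[OF \<rho>.hom_closed[OF assms(1)] \<rho>.hom_closed[OF assms(2)] \<rho>_noncommuting[OF assms]]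
  show ?thesis
  proof unfold_locales
    show "b \<otimes> a = central_involution \<otimes> (a \<otimes> b)"
      by (rule inj) (use assms central_involution n in \<open>auto simp: U.m_comm\<close>)
    show "central_involution \<otimes> a = a \<otimes> central_involution" "central_involution \<otimes> b = b \<otimes> central_involution"
      by (rule inj; use assms central_involution Q8_neg_central in simp)+
    show "central_involution \<otimes> central_involution = \<one>"
      by (rule inj) (use central_involution Q8_neg_square in auto)
  qed (use assms central_involution in auto)
qed

text \<open>All dependence on the pair sits in the \<open>U\<close>-components; the
  \<open>Q8\<close>-part contributes the same condition for every noncommuting pair.\<close>

lemma nf_eq_one_iff:
  assumes ab: "a \<in> carrier G" "b \<in> carrier G" "a \<otimes> b \<noteq> b \<otimes> a"
  shows "commutator_pair.nf G a b central_involution i j e = \<one> \<longleftrightarrow>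
    \<pi> a [^]\<^bsub>U\<^esub> i \<otimes>\<^bsub>U\<^esub> \<pi> b [^]\<^bsub>U\<^esub> j = \<one>\<^bsub>U\<^esub> \<and> Q8_exponents i j e"
proof -
  interpret commutator_pair G a b central_involution by (rule commutator_pair_noncommuting[OF ab])
  note r = \<rho>.hom_closed[OF ab(1)] \<rho>.hom_closed[OF ab(2)] \<rho>_noncommuting[OF ab]
  interpret Q: commutator_pair Q8 "\<rho> a" "\<rho> b" Q8_neg by (rule commutator_pair_Q8[OF r])
  have 1: "\<pi> (nf i j e) = \<pi> a [^]\<^bsub>U\<^esub> i \<otimes>\<^bsub>U\<^esub> \<pi> b [^]\<^bsub>U\<^esub> j"
    using ab central_involution by (simp add: nf_def \<pi>.hom_int_pow)
  have 2: "\<rho> (nf i j e) = Q.nf i j e"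
    using ab central_involution by (simp add: nf_def Q.nf_def \<rho>.hom_int_pow)
  have "nf i j e = \<one> \<longleftrightarrow> \<pi> (nf i j e) = \<one>\<^bsub>U\<^esub> \<and> \<rho> (nf i j e) = \<one>\<^bsub>Q8\<^esub>"
    using inj[of "nf i j e" \<one>] by auto
  then show ?thesis by (simp only: 1 2 Q8_nf_eq_one_iff[OF r])
qed

lemma odd_power_eq_one:
  "u \<in> carrier U \<Longrightarrow> u [^]\<^bsub>U\<^esub> (k::int) = \<one>\<^bsub>U\<^esub> \<Longrightarrow> k \<in> {2, 4, - 2, - 4} \<Longrightarrow> u = \<one>\<^bsub>U\<^esub>"
  by (rule U.odd_order_pow_eq_one[OF odd_U])

end

section \<open>Closed words over noncommuting connection sets\<close>

locale noncommuting_triple = q8_product G U \<pi> \<rho> for G (structure) and U \<pi> \<rho> +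
  fixes p q r
  assumes p_closed: "p \<in> carrier G" and q_closed: "q \<in> carrier G" and r_closed: "r \<in> carrier G"
    and noncommute: "(inv p \<otimes> q) \<otimes> (inv p \<otimes> r) \<noteq> (inv p \<otimes> r) \<otimes> (inv p \<otimes> q)"

sublocale noncommuting_triple \<subseteq> connection_triple G "inv p \<otimes> q" "inv p \<otimes> r" central_involution p q r
proof -
  interpret commutator_pair G "inv p \<otimes> q" "inv p \<otimes> r" central_involution
    using p_closed q_closed r_closed noncommute by (intro commutator_pair_noncommuting) auto
  show "connection_triple G (inv p \<otimes> q) (inv p \<otimes> r) central_involution p q r"
    by unfold_locales (use p_closed q_closed r_closed in auto)
qed

context noncommuting_triple
begin

lemma distinct_letters: "p \<noteq> q" "p \<noteq> r" "q \<noteq> r"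
  using noncommute by auto

lemma nf_one: "nf i j e = \<one> \<longleftrightarrow>
    \<pi> (inv p \<otimes> q) [^]\<^bsub>U\<^esub> i \<otimes>\<^bsub>U\<^esub> \<pi> (inv p \<otimes> r) [^]\<^bsub>U\<^esub> j = \<one>\<^bsub>U\<^esub> \<and> Q8_exponents i j e"
  using nf_eq_one_iff[OF a b noncommute] .

text \<open>If the \<open>U\<close>-component of \<open>inv p \<otimes> q\<close> is trivial, its
  square is the central involution, which compensates the odd exponent collected by the word
  \<open>p q r q p r\<close>.\<close>

lemma hexagon_word:
  assumes "\<pi> p = \<pi> q"
  shows "extends_to_closed 6 {p, q, r} []"
proof -
  have "\<pi> (inv p \<otimes> q) = \<one>\<^bsub>U\<^esub>" using assms by simp
  then have "nf (- 2) 0 (- 3) = \<one>" by (simp add: nf_one Q8_exponents_def)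
  then have "extends_to_closed 6 {p, q, r} (map letter [])"
    by (intro extends_to_closed_lettersI[where v = "[0, 1, 2, 1, 0, 2]"])
      (use distinct_letters in \<open>simp_all add: letter_mult_def letter_div_def\<close>)
  then show ?thesis by simp
qed

text \<open>Among the end points allowed by \<open>Q8\<close>, only \<plusminus>2 times a single
  difference occurs. Squaring is injective in a group of odd order, so this difference has trivial
  \<open>U\<close>-component.\<close>

lemma closed_6_word:
  assumes "extends_to_closed 6 {p, q, r} [s]" "s \<in> {p, q, r}"
  shows "\<pi> p = \<pi> q \<or> \<pi> p = \<pi> r \<or> \<pi> q = \<pi> r"
proof -
  have "\<exists>c\<in>{0, 1, 2}. s = letter c" using assms(2) by (auto simp: letter_def)
  then obtain c where c: "c \<in> {0, 1, 2}" "s = letter c" by blast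
  then have "extends_to_closed 6 {p, q, r} (map letter [c])" using assms(1) by simp
  then obtain v where v: "v \<in> set (next_letters 5 c)" "last ([c] @ v) \<noteq> c"
    "nf3 (word_nf (0, 0, 0) ([c] @ v)) = \<one>"
    by (rule extends_to_closed_lettersD) simp_all
  have K: "\<forall>c\<in>set [0, 1, 2]. \<forall>v\<in>set (next_letters 5 c). last ([c] @ v) = c \<or>
      (case word_nf (0, 0, 0) ([c] @ v) of (i, j, e) \<Rightarrow> Q8_exponents i j e \<longrightarrow>
        (i, j) \<in> {(-2, 0), (-2, 2), (0, -2), (0, 2), (2, -2), (2, 0)})"
    unfolding Q8_exponents_def by code_simp
  have cs: "c \<in> set [0, 1, 2]" using c(1) by simp
  have 1: "last ([c] @ v) = c \<or>
      (case word_nf (0, 0, 0) ([c] @ v) of (i, j, e) \<Rightarrow> Q8_exponents i j e \<longrightarrow>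
        (i, j) \<in> {(-2, 0), (-2, 2), (0, -2), (0, 2), (2, -2), (2, 0)})"
    by (rule bspec[OF bspec[OF K cs] v(1)])
  obtain i j e where e: "word_nf (0, 0, 0) ([c] @ v) = (i, j, e)" by (metis surj_pair)
  have nf1: "nf i j e = \<one>" using v(3) unfolding e by simp
  then have ij: "(i, j) \<in> {(-2, 0), (-2, 2), (0, -2), (0, 2), (2, -2), (2, 0)}"
    using 1 v(2) unfolding e by (auto simp: nf_one)
  define u w where "u = \<pi> (inv p \<otimes> q)" and "w = \<pi> (inv p \<otimes> r)"
  have [simp]: "u \<in> carrier U" "w \<in> carrier U" by (simp_all add: u_def w_def)
  have rel: "u [^]\<^bsub>U\<^esub> i \<otimes>\<^bsub>U\<^esub> w [^]\<^bsub>U\<^esub> j = \<one>\<^bsub>U\<^esub>" using nf1 by (simp add: nf_one u_def w_def)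
  have quot: "inv\<^bsub>U\<^esub> u \<otimes>\<^bsub>U\<^esub> w = \<one>\<^bsub>U\<^esub>" if "j = - i" "i \<in> {2, -2}"
  proof (rule odd_power_eq_one)
    show "(inv\<^bsub>U\<^esub> u \<otimes>\<^bsub>U\<^esub> w) [^]\<^bsub>U\<^esub> j = \<one>\<^bsub>U\<^esub>"
    proof -
      have "(inv\<^bsub>U\<^esub> u \<otimes>\<^bsub>U\<^esub> w) [^]\<^bsub>U\<^esub> j = u [^]\<^bsub>U\<^esub> (- j) \<otimes>\<^bsub>U\<^esub> w [^]\<^bsub>U\<^esub> j"
        by (simp add: U.int_pow_distrib U.int_pow_inv U.int_pow_neg)
      with rel that(1) show ?thesis by simp
    qed
  qed (use that in auto)
  have "u = \<one>\<^bsub>U\<^esub> \<or> w = \<one>\<^bsub>U\<^esub> \<or> inv\<^bsub>U\<^esub> u \<otimes>\<^bsub>U\<^esub> w = \<one>\<^bsub>U\<^esub>"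
    using ij rel odd_power_eq_one[of u i] odd_power_eq_one[of w j] quot by auto
  moreover have "inv\<^bsub>U\<^esub> u \<otimes>\<^bsub>U\<^esub> w = inv\<^bsub>U\<^esub> \<pi> q \<otimes>\<^bsub>U\<^esub> \<pi> r"
    by (simp add: u_def w_def U.inv_mult_group U.m_assoc)
  ultimately show ?thesis using U.difference_eq_one_iff by (auto simp: u_def w_def)
qed

text \<open>Every completion allowed by \<open>Q8\<close> ends at exponent \<open>- 2\<close> or
  \<open>- 4\<close> of \<open>inv p \<otimes> q\<close>, which forces the
  \<open>U\<close>-component of this difference to be trivial. These words cannot lie on closed
  walks of length ten when the \<open>U\<close>-components are distinct.\<close>

lemma closed_10_word:
  assumes "extends_to_closed 10 {p, q, r} [p, q, p, q, p] \<or> extends_to_closed 10 {p, q, r} [p, q, r, q, p]"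
  shows "\<pi> p = \<pi> q"
proof -
  have "map letter [0, 1, 0, 1, 0] = [p, q, p, q, p]" "map letter [0, 1, 2, 1, 0] = [p, q, r, q, p]"
    by (simp_all add: letter_def)
  with assms obtain c where c: "c \<in> {0, 2}" "extends_to_closed 10 {p, q, r} (map letter [0, 1, c, 1, 0])"
    by (metis insertI1 insertI2)
  then obtain v where v: "v \<in> set (next_letters 5 0)" "last ([0, 1, c, 1, 0] @ v) \<noteq> 0"
    "nf3 (word_nf (0, 0, 0) ([0, 1, c, 1, 0] @ v)) = \<one>"
    by (elim extends_to_closed_lettersD[of 10 "[0, 1, c, 1, 0]"]) simp_all
  have K: "\<forall>c\<in>set [0, 2]. \<forall>v\<in>set (next_letters 5 0). last ([0, 1, c, 1, 0] @ v) = 0 \<or>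
      (case word_nf (0, 0, 0) ([0, 1, c, 1, 0] @ v) of (i, j, e) \<Rightarrow> Q8_exponents i j e \<longrightarrow>
        (i, j) \<in> {(-2, 0), (-4, 0)})"
    unfolding Q8_exponents_def by code_simp
  have cs: "c \<in> set [0, 2]" using c(1) by simp
  have 1: "last ([0, 1, c, 1, 0] @ v) = 0 \<or>
      (case word_nf (0, 0, 0) ([0, 1, c, 1, 0] @ v) of (i, j, e) \<Rightarrow> Q8_exponents i j e \<longrightarrow>
        (i, j) \<in> {(-2, 0), (-4, 0)})"
    by (rule bspec[OF bspec[OF K cs] v(1)])
  obtain i j e where e: "word_nf (0, 0, 0) ([0, 1, c, 1, 0] @ v) = (i, j, e)" by (metis surj_pair)
  have nf1: "nf i j e = \<one>" using v(3) unfolding e by simp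
  then have ij: "(i, j) \<in> {(-2, 0), (-4, 0)}"
    using 1 v(2) unfolding e by (auto simp: nf_one)
  then have "\<pi> (inv p \<otimes> q) [^]\<^bsub>U\<^esub> i = \<one>\<^bsub>U\<^esub>" using nf1 by (auto simp: nf_one)
  then have "\<pi> (inv p \<otimes> q) = \<one>\<^bsub>U\<^esub>" using odd_power_eq_one[of "\<pi> (inv p \<otimes> q)" i] ij by auto
  then show ?thesis using U.difference_eq_one_iff by simp
qed

text \<open>Each word is the first half of a word \<open>w w\<close> that runs around two adjacent
  hexagons. A single hexagon contributes the central involution, and two contributions
  cancel.\<close>

lemma two_hexagons:
  "extends_to_closed 10 {p, q, r} [p, q, r, p, q]" "extends_to_closed 10 {p, q, r} [p, q, r, p, r]"
  "extends_to_closed 10 {p, q, r} [r, q, r, p, q]"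
proof -
  have "extends_to_closed 10 {p, q, r} (map letter [0, 1, 2, 0, 1])"
    by (rule extends_to_closed_lettersI[where v = "[0, 1, 2, 0, 1]"])
      (use distinct_letters in \<open>simp_all add: letter_mult_def letter_div_def\<close>)
  then show "extends_to_closed 10 {p, q, r} [p, q, r, p, q]" by (simp add: letter_def)
  have "nf 0 0 (- 2) = \<one>" by (simp add: nf_one Q8_exponents_def)
  then have "extends_to_closed 10 {p, q, r} (map letter [0, 1, 2, 0, 2])"
    by (intro extends_to_closed_lettersI[where v = "[0, 1, 2, 0, 2]"])
      (use distinct_letters in \<open>simp_all add: letter_mult_def letter_div_def\<close>)
  then show "extends_to_closed 10 {p, q, r} [p, q, r, p, r]" by (simp add: letter_def)
  have "extends_to_closed 10 {p, q, r} (map letter [2, 1, 2, 0, 1])"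
    by (rule extends_to_closed_lettersI[where v = "[2, 1, 2, 0, 1]"])
      (use distinct_letters in \<open>simp_all add: letter_mult_def letter_div_def\<close>)
  then show "extends_to_closed 10 {p, q, r} [r, q, r, p, q]" by (simp add: letter_def)
qed

end

lemma odd_times_divisor_of_8_cancel:
  fixes m n k l :: nat
  assumes "m * k = n * l" "odd m" "odd n" "k dvd 8" "l dvd 8"
  shows "m = n \<and> k = l"
proof -
  have cop: "coprime a d" if "odd a" "d dvd 8" for a d :: nat
  proof -
    have "coprime a (2 ^ 3)" 
      using that(1) by (simp only: coprime_power_right_iff coprime_right_2_iff_odd simp_thms)
    then show ?thesis using that(2) coprime_divisors[of a a d "2 ^ 3"] by simp
  qed
  have "m dvd n" using assms(1) cop[OF assms(2,5)] by (metis coprime_dvd_mult_left_iff dvd_triv_left)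
  moreover have "n dvd m" using assms(1) cop[OF assms(3,4)] by (metis coprime_dvd_mult_left_iff dvd_triv_left)
  ultimately have "m = n" by (rule dvd_antisym)
  with assms show ?thesis by (auto simp: odd_pos)
qed

section \<open>Subgroups of a product of \<open>U\<close> and \<open>Q8\<close>, and their
  orders\<close>

context q8_product
begin

lemma subgroup_split:
  assumes H: "subgroup H G" and x: "x \<in> H"
  obtains y z where "y \<in> H" "\<pi> y = \<pi> x" "\<rho> y = \<one>\<^bsub>Q8\<^esub>" "z \<in> H" "\<pi> z = \<one>\<^bsub>U\<^esub>" "\<rho> z = \<rho> x"
proof -
  have xG: "x \<in> carrier G" using H x by (rule subgroup.mem_carrier)
  obtain m where m: "order U = 2 * m + 1" using odd_U by (elim oddE)
  \<comment> \<open>An odd square: as a multiple of \<open>order U\<close> it kills the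
    \<open>U\<close>-component, and being congruent to \<open>1\<close> modulo \<open>4\<close> it
    fixes the \<open>Q8\<close>-component.\<close>
  define n where "n = int (order U * order U)"
  define z where "z = x [^] n"
  have z: "z \<in> H" unfolding z_def by (rule subgroup_int_pow_closed[OF H x])
  have zG: "z \<in> carrier G" using xG by (simp add: z_def)
  have "\<pi> z = (\<pi> x [^]\<^bsub>U\<^esub> int (order U)) [^]\<^bsub>U\<^esub> int (order U)"
    using xG by (simp add: z_def n_def \<pi>.hom_int_pow U.int_pow_pow)
  then have 1: "\<pi> z = \<one>\<^bsub>U\<^esub>" using xG by (simp add: int_pow_int U.pow_order_eq_1)
  have "n = 4 * int (m * m + m) + 1" by (simp add: n_def m algebra_simps)
  moreover have "\<rho> x [^]\<^bsub>Q8\<^esub> (4::int) = \<one>\<^bsub>Q8\<^esub>"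
    using \<rho>.H.int_pow_mult[of "\<rho> x" 2 2] \<rho>.H.int_pow_mult[of "\<rho> x" 1 1] xG Q8_pow_4[of "\<rho> x"] by simp
  ultimately have 2: "\<rho> z = \<rho> x"
    using xG by (simp add: z_def \<rho>.hom_int_pow \<rho>.H.int_pow_mult flip: \<rho>.H.int_pow_pow)
  show ?thesis
  proof (rule that[of "x \<otimes> inv z" z])
    show "x \<otimes> inv z \<in> H" using H x z by (simp add: subgroup.m_closed subgroup.m_inv_closed)
  qed (use z 1 2 xG zG in auto)
qed

text \<open>By \<open>subgroup_split\<close>, a subgroup is the full product of its two
  projections.\<close>

lemma card_subgroup_parts:
  assumes H: "subgroup H G" and fin: "finite (carrier G)"
  shows "card H = card (\<pi> ` H) * card (\<rho> ` H)" "odd (card (\<pi> ` H))" "card (\<rho> ` H) dvd 8"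
proof -
  have HG: "H \<subseteq> carrier G" using H by (rule subgroup.subset)
  have "inj_on (\<lambda>x. (\<pi> x, \<rho> x)) H" using inj HG by (auto simp: inj_on_def)
  moreover have "(\<lambda>x. (\<pi> x, \<rho> x)) ` H = \<pi> ` H \<times> \<rho> ` H"
  proof (intro equalityI subsetI, goal_cases)
    case (2 w)
    then obtain x x' where w: "x \<in> H" "x' \<in> H" "w = (\<pi> x, \<rho> x')" by auto
    obtain y where y: "y \<in> H" "\<pi> y = \<pi> x" "\<rho> y = \<one>\<^bsub>Q8\<^esub>" using subgroup_split[OF H w(1)] by metis
    obtain z where z: "z \<in> H" "\<pi> z = \<one>\<^bsub>U\<^esub>" "\<rho> z = \<rho> x'" using subgroup_split[OF H w(2)] by metis
    have "y \<otimes> z \<in> H" using H y z by (simp add: subgroup.m_closed)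
    moreover have "w = (\<pi> (y \<otimes> z), \<rho> (y \<otimes> z))" using w y z HG by (auto simp: subset_iff)
    ultimately show ?case by blast
  qed auto
  ultimately have "card H = card (\<pi> ` H \<times> \<rho> ` H)" using card_image by fastforce
  then show "card H = card (\<pi> ` H) * card (\<rho> ` H)" by (simp add: card_cartesian_product)
  have "subgroup (\<pi> ` H) U" by (rule \<pi>.subgroup_img_is_subgroup[OF H])
  then show "odd (card (\<pi> ` H))" using U.lagrange odd_U by (metis dvd_triv_right dvd_trans)
  have "subgroup (\<rho> ` H) Q8" by (rule \<rho>.subgroup_img_is_subgroup[OF H])
  then show "card (\<rho> ` H) dvd 8" using \<rho>.H.lagrange order_Q8 by (metis dvd_triv_right)
qed

lemma card_subgroup_parts_eq:
  assumes "subgroup H G" "subgroup K G" "finite (carrier G)" "card H = card K"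
  shows "card (\<pi> ` H) = card (\<pi> ` K)" "card (\<rho> ` H) = card (\<rho> ` K)"
  using card_subgroup_parts[OF assms(1,3)] card_subgroup_parts[OF assms(2,3)] assms(4)
    odd_times_divisor_of_8_cancel by metis+

lemma no_4_or_unique_involution: "no_4_or_unique_involution G"
proof -
  have "x = central_involution" if x: "x \<in> carrier G" "x [^] (2::int) = \<one>" "x \<noteq> \<one>" for x
  proof (rule inj)
    have "\<pi> x [^]\<^bsub>U\<^esub> (2::int) = \<one>\<^bsub>U\<^esub>" using x by (simp flip: \<pi>.hom_int_pow)
    then have px: "\<pi> x = \<one>\<^bsub>U\<^esub>" using odd_power_eq_one[of "\<pi> x" 2] x by simp
    then show "\<pi> x = \<pi> central_involution" by (simp add: central_involution)
    have "x \<otimes> x = \<one>" using x(1,2) int_pow_mult[OF x(1), of 1 1] by simp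
    then have "\<rho> x \<otimes>\<^bsub>Q8\<^esub> \<rho> x = \<one>\<^bsub>Q8\<^esub>" using x(1) by (simp flip: \<rho>.hom_mult)
    then have "\<rho> x = \<one>\<^bsub>Q8\<^esub> \<or> \<rho> x = Q8_neg" using x(1) by (intro Q8_involution) auto
    moreover have "\<rho> x \<noteq> \<one>\<^bsub>Q8\<^esub>" using x(1,3) px inj[of x \<one>] by auto
    ultimately show "\<rho> x = \<rho> central_involution" by (simp add: central_involution)
  qed (use x central_involution in auto)
  then show ?thesis unfolding no_4_or_unique_involution_def by metis
qed

lemma noncommuting_tripleI:
  "p \<in> carrier G \<Longrightarrow> q \<in> carrier G \<Longrightarrow> r \<in> carrier G \<Longrightarrow> \<not> commuting_triple G p q r \<Longrightarrow>
    noncommuting_triple G U \<pi> \<rho> p q r"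
  by unfold_locales (auto simp: commuting_triple_def commuting_triple_axioms_def is_group)

end

context noncommuting_triple
begin

lemma noncommuting_subset:
  assumes "{x, y, w} = {p, q, r}"
  shows "noncommuting_triple G U \<pi> \<rho> x y w"
proof (rule noncommuting_tripleI)
  have "{x, y, w} \<subseteq> carrier G" unfolding assms by simp
  then show "x \<in> carrier G" "y \<in> carrier G" "w \<in> carrier G" by simp_all
  show "\<not> commuting_triple G x y w"
  proof
    assume "commuting_triple G x y w"
    then have "commuting_triple G p q r"
      by (rule commuting_triple.commuting_triple_subset) (use assms in auto)
    then show False using noncommute by (simp add: commuting_triple_def commuting_triple_axioms_def)
  qed
qed

lemma difference_in_span: "inv p \<otimes> q \<in> diff_span {p, q, r}" "inv p \<otimes> r \<in> diff_span {p, q, r}"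
  by (auto intro!: generate.incl simp: differences_def image_iff)

lemma subgroup_span: "subgroup (diff_span {p, q, r}) G"
  by (rule subgroup_diff_span) simp

lemma \<rho>_span: "\<rho> ` diff_span {p, q, r} = carrier Q8"
proof (rule Q8_subgroup_eq)
  show "subgroup (\<rho> ` diff_span {p, q, r}) Q8" by (rule \<rho>.subgroup_img_is_subgroup[OF subgroup_span])
  show "\<rho> (inv p \<otimes> q) \<in> \<rho> ` diff_span {p, q, r}" "\<rho> (inv p \<otimes> r) \<in> \<rho> ` diff_span {p, q, r}"
    using difference_in_span by blast+
qed (rule \<rho>_noncommuting[OF a b noncommute])

lemma card_\<pi>_span:
  assumes eq: "\<pi> p = \<pi> q" and fin: "finite (carrier G)"
  shows "card (\<pi> ` diff_span {p, q, r}) = U.ord (\<pi> (inv p \<otimes> r))"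
proof -
  let ?w = "\<pi> (inv p \<otimes> r)"
  have w: "?w \<in> carrier U" by simp
  have key: "\<pi> (inv x \<otimes> y) \<in> generate U {?w}" if xy: "x \<in> {p, q, r}" "y \<in> {p, q, r}" for x y
  proof -
    have "\<pi> x \<in> {\<pi> p, \<pi> r}" "\<pi> y \<in> {\<pi> p, \<pi> r}" "x \<in> carrier G" "y \<in> carrier G" using xy eq by auto
    then have "\<pi> (inv x \<otimes> y) \<in> {\<one>\<^bsub>U\<^esub>, ?w, inv\<^bsub>U\<^esub> ?w}"
      by (auto simp: U.inv_mult_group)
    then show ?thesis using generate.one generate.incl[of ?w "{?w}" U] generate.inv[of ?w "{?w}" U] by auto
  qed
  have "\<pi> ` differences {p, q, r} \<subseteq> generate U {?w}"
  proof (rule image_subsetI)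
    fix d assume "d \<in> differences {p, q, r}"
    then obtain x y where "x \<in> {p, q, r}" "y \<in> {p, q, r}" "d = inv x \<otimes> y"
      unfolding differences_def by (elim imageE SigmaE) (simp only: case_prod_conv)
    then show "\<pi> d \<in> generate U {?w}" using key by (simp only:)
  qed
  then have "generate U (\<pi> ` differences {p, q, r}) \<subseteq> generate U {?w}"
    by (rule U.generate_subgroup_incl) (use w in \<open>simp add: U.generate_is_subgroup del: \<pi>.hom_mult\<close>)
  then have "\<pi> ` diff_span {p, q, r} \<subseteq> generate U {?w}"
    using \<pi>.generate_img[of "differences {p, q, r}"] differences_carrier[of "{p, q, r}"] by simp
  moreover have "generate U {?w} \<subseteq> \<pi> ` diff_span {p, q, r}"
    using difference_in_span(2)
    by (intro U.generate_subgroup_incl[OF _ \<pi>.subgroup_img_is_subgroup[OF subgroup_span]]) blast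
  ultimately show ?thesis using U.generate_pow_card[OF w] by (metis subset_antisym)
qed

end

context q8_product
begin

text \<open>With \<open>inv p \<otimes> q\<close> trivial in \<open>U\<close>, the relations have a
  single parameter, the order of the \<open>U\<close>-component of \<open>inv p \<otimes> r\<close>,
  and this is the odd part of the order of the span.\<close>

lemma affine_equiv_hexagon:
  assumes fin: "finite (carrier G)" and hom: "homogeneous G"
    and tr: "noncommuting_triple G U \<pi> \<rho> p q r" "noncommuting_triple G U \<pi> \<rho> p' q' r'"
    and eq: "\<pi> p = \<pi> q" "\<pi> p' = \<pi> q'"
    and card: "card (diff_span {p, q, r}) = card (diff_span {p', q', r'})"
  shows "affine_equiv {p, q, r} {p', q', r'}"
proof -
  interpret A: noncommuting_triple G U \<pi> \<rho> p q r by fact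
  interpret B: noncommuting_triple G U \<pi> \<rho> p' q' r' by fact
  have "U.ord (\<pi> (inv p \<otimes> r)) = U.ord (\<pi> (inv p' \<otimes> r'))"
    using card_subgroup_parts_eq(1)[OF A.subgroup_span B.subgroup_span fin card]
    by (simp only: A.card_\<pi>_span[OF eq(1) fin] B.card_\<pi>_span[OF eq(2) fin])
  moreover have "\<pi> (inv p \<otimes> q) = \<one>\<^bsub>U\<^esub>" "\<pi> (inv p' \<otimes> q') = \<one>\<^bsub>U\<^esub>" using eq A.q B.q by simp_all
  ultimately show ?thesis
    by (intro affine_equiv_commutator_pairs[OF hom A.p A.q A.r B.p B.q B.r A.commutator_pair_axioms
        B.commutator_pair_axioms])
      (simp only: A.nf_one B.nf_one, simp add: U.int_pow_eq_id)
qed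

text \<open>In the noncommuting case, inverting both differences inverts the relation value in
  \<open>U\<close> and leaves \<open>Q8_exponents\<close> unchanged.\<close>

lemma affine_equiv_inverse:
  assumes hom: "homogeneous G" and pqr: "p \<in> carrier G" "q \<in> carrier G" "r \<in> carrier G"
  shows "affine_equiv {p, q, r} {\<one>, inv q \<otimes> p, inv r \<otimes> p}"
proof (cases "commuting_triple G p q r")
  case True
  then show ?thesis by (rule affine_equiv_inverse_commuting[OF hom])
next
  case False
  let ?a = "inv p \<otimes> q" and ?b = "inv p \<otimes> r"
  have nc: "?a \<otimes> ?b \<noteq> ?b \<otimes> ?a"
    using False pqr by (auto simp: commuting_triple_def commuting_triple_axioms_def is_group)
  have ab: "?a \<in> carrier G" "?b \<in> carrier G" "inv ?a \<in> carrier G" "inv ?b \<in> carrier G" using pqr by simp_all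
  have nc': "inv ?a \<otimes> inv ?b \<noteq> inv ?b \<otimes> inv ?a"
    using nc ab(1,2) inv_mult_group[OF ab(1,2)] inv_mult_group[OF ab(2,1)] by (metis inv_inv m_closed)
  have d: "inv \<one> \<otimes> (inv q \<otimes> p) = inv ?a" "inv \<one> \<otimes> (inv r \<otimes> p) = inv ?b"
    using pqr by (simp_all add: inv_mult_group)
  have uw: "\<pi> ?a \<in> carrier U" "\<pi> ?b \<in> carrier U" using ab by (auto simp del: \<pi>.hom_mult)
  have eq: "\<pi> (inv ?a) [^]\<^bsub>U\<^esub> i \<otimes>\<^bsub>U\<^esub> \<pi> (inv ?b) [^]\<^bsub>U\<^esub> j = inv\<^bsub>U\<^esub> (\<pi> ?a [^]\<^bsub>U\<^esub> i \<otimes>\<^bsub>U\<^esub> \<pi> ?b [^]\<^bsub>U\<^esub> j)"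
    for i j :: int
    unfolding \<pi>.hom_inv[OF ab(1)] \<pi>.hom_inv[OF ab(2)] using uw
    by (simp add: U.int_pow_inv U.inv_mult del: \<pi>.hom_mult)
  show ?thesis
  proof (rule affine_equiv_commutator_pairs[OF hom pqr, where z = central_involution])
    show "commutator_pair G ?a ?b central_involution" by (rule commutator_pair_noncommuting[OF ab(1,2) nc])
    show "commutator_pair G (inv \<one> \<otimes> (inv q \<otimes> p)) (inv \<one> \<otimes> (inv r \<otimes> p)) central_involution"
      unfolding d by (rule commutator_pair_noncommuting[OF ab(3,4) nc'])
    show "commutator_pair.nf G ?a ?b central_involution i j e = \<one> \<longleftrightarrow>
        commutator_pair.nf G (inv \<one> \<otimes> (inv q \<otimes> p)) (inv \<one> \<otimes> (inv r \<otimes> p)) central_involution i j e = \<one>" for i j e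
      unfolding d nf_eq_one_iff[OF ab(1,2) nc] nf_eq_one_iff[OF ab(3,4) nc'] eq using uw
      by (simp del: \<pi>.hom_mult)
  qed (use pqr in auto)
qed

lemma affine_equiv_3:
  assumes bi: "bicayley_iso G S T f" and fin: "finite (carrier G)" and hom: "homogeneous G" and card: "card S = 3"
  shows "affine_equiv S T"
proof -
  interpret bicayley_iso G S T f by fact
  have cT: "card T = 3" using card card_eq by simp
  obtain p q r where pqr: "S = {p, q, r}" "p \<noteq> q" "p \<noteq> r" "q \<noteq> r" using card by (auto simp: card_3_iff)
  obtain p' q' r' where pqr': "T = {p', q', r'}" "p' \<noteq> q'" "p' \<noteq> r'" "q' \<noteq> r'" using cT by (auto simp: card_3_iff)
  have c: "p \<in> carrier G" "q \<in> carrier G" "r \<in> carrier G" "p' \<in> carrier G" "q' \<in> carrier G" "r' \<in> carrier G"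
    using S T pqr pqr' by auto
  have cs: "card (diff_span {p, q, r}) = card (diff_span {p', q', r'})"
    using card_diff_span[OF fin] pqr pqr' by simp
  \<comment> \<open>A noncommuting span projects onto \<open>Q8\<close>. By equality of orders a
    commuting one would as well, although it is abelian.\<close>
  have no_mix: False
    if 1: "commuting_triple G s t u" and 2: "noncommuting_triple G U \<pi> \<rho> s' t' u'"
      and eq: "card (diff_span {s, t, u}) = card (diff_span {s', t', u'})" for s t u s' t' u'
  proof -
    interpret A: commuting_triple G s t u by fact
    interpret B: noncommuting_triple G U \<pi> \<rho> s' t' u' by fact
    have sub: "subgroup (diff_span {s, t, u}) G" by (rule subgroup_diff_span) simp
    have "card (\<rho> ` diff_span {s, t, u}) = card (carrier Q8)"
      using card_subgroup_parts_eq(2)[OF sub B.subgroup_span fin eq] B.\<rho>_span by simp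
    moreover have "\<rho> ` diff_span {s, t, u} \<subseteq> carrier Q8" "finite (carrier Q8)"
      using subgroup.subset[OF \<rho>.subgroup_img_is_subgroup[OF sub]] by (blast, simp add: Q8_def)
    ultimately have full: "\<rho> ` diff_span {s, t, u} = carrier Q8" by (simp add: card_subset_eq)
    have "x \<otimes>\<^bsub>Q8\<^esub> y = y \<otimes>\<^bsub>Q8\<^esub> x" if xy: "x \<in> carrier Q8" "y \<in> carrier Q8" for x y
    proof -
      obtain i j k l where "x = \<rho> (A.cf i j)" "y = \<rho> (A.cf k l)"
        using xy unfolding full[symmetric] A.diff_span_eq by blast
      then have "x \<otimes>\<^bsub>Q8\<^esub> y = \<rho> (A.cf i j \<otimes> A.cf k l)" "y \<otimes>\<^bsub>Q8\<^esub> x = \<rho> (A.cf k l \<otimes> A.cf i j)" by simp_all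
      then show ?thesis by (simp add: A.cf_mult add.commute del: \<rho>.hom_mult)
    qed
    then show False using ex_Q8_noncommuting by blast
  qed
  consider "commuting_triple G p q r" "commuting_triple G p' q' r'"
    | "noncommuting_triple G U \<pi> \<rho> p q r" "noncommuting_triple G U \<pi> \<rho> p' q' r'"
    using no_mix[of p q r p' q' r'] no_mix[of p' q' r' p q r] noncommuting_tripleI c cs by metis
  then show ?thesis
  proof cases
    case 1
    then show ?thesis
      using affine_equiv_commuting_sets[OF fin hom no_4_or_unique_involution card] commuting_setI pqr pqr' by simp
  next
    case 2
    interpret A: noncommuting_triple G U \<pi> \<rho> p q r by fact
    interpret B: noncommuting_triple G U \<pi> \<rho> p' q' r' by fact
    show ?thesis
    \<comment> \<open>The empty prefix asks whether there is any closed word of length six.\<close>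
    proof (cases "extends_to_closed 6 S []")
      case True
      have hex: "\<exists>s t u. {p, q, r} = {s, t, u} \<and> \<pi> s = \<pi> t"
        if tr: "noncommuting_triple G U \<pi> \<rho> p q r" and ext: "extends_to_closed 6 {p, q, r} []" for p q r
      proof -
        interpret noncommuting_triple G U \<pi> \<rho> p q r by (rule tr)
        obtain v where v: "length v = 6" "closed_word {p, q, r} v" using ext by (auto simp: extends_to_closed_def)
        then obtain s w where w: "v = [s] @ w" by (cases v) auto
        have "s \<in> {p, q, r}" using v(2) w by (simp add: closed_word_def)
        moreover have "extends_to_closed 6 {p, q, r} [s]"
          unfolding extends_to_closed_def by (rule exI[of _ w]) (use v w in \<open>simp only: simp_thms\<close>)
        ultimately have "\<pi> p = \<pi> q \<or> \<pi> p = \<pi> r \<or> \<pi> q = \<pi> r" by (intro closed_6_word)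
        then show ?thesis by (metis insert_commute)
      qed
      have "extends_to_closed 6 T (image_word \<one> [])" by (rule extends_to_closed_image[OF same_side_one True])
      then have "extends_to_closed 6 T []" by simp
      then obtain s' t' u' where 2: "T = {s', t', u'}" "\<pi> s' = \<pi> t'"
        using hex[OF B.noncommuting_triple_axioms] pqr'(1) by metis
      obtain s t u where 1: "S = {s, t, u}" "\<pi> s = \<pi> t"
        using hex[OF A.noncommuting_triple_axioms] True pqr(1) by metis
      have "noncommuting_triple G U \<pi> \<rho> s t u" "noncommuting_triple G U \<pi> \<rho> s' t' u'"
        using 1(1) 2(1) pqr(1) pqr'(1) A.noncommuting_subset[of s t u] B.noncommuting_subset[of s' t' u'] by simp_all
      then show ?thesis
        unfolding 1(1) 2(1) using 1 2 card_diff_span[OF fin] by (intro affine_equiv_hexagon[OF fin hom]) auto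
    next
      case False
      have trS: "noncommuting_triple G U \<pi> \<rho> x y w" if "S = {x, y, w}" for x y w
        using that pqr(1) A.noncommuting_subset[of x y w] by simp
      have trT: "noncommuting_triple G U \<pi> \<rho> x y w" if "T = {x, y, w}" for x y w
        using that pqr'(1) B.noncommuting_subset[of x y w] by simp
      have ne: "\<pi> x \<noteq> \<pi> y" if "S = {x, y, w}" for x y w
        using noncommuting_triple.hexagon_word[OF trS[OF that]] False that by auto
      have edge: "\<forall>x. same_side x \<longrightarrow> col (inv c \<otimes> (b \<otimes> x)) b = col x b" if bc: "b \<in> S" "c \<in> S" "b \<noteq> c" for b c
      proof (intro allI impI, rule ccontr)
        fix x assume x: "same_side x" and neq: "col (inv c \<otimes> (b \<otimes> x)) b \<noteq> col x b"
        define w where "w = inv c \<otimes> (b \<otimes> x)"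
        have w: "same_side w" unfolding w_def by (rule same_side_step[OF x bc(1,2)])
        have "card (S - {b, c}) = 1" using card bc by (simp add: card_Diff_subset)
        then obtain r where "S - {b, c} = {r}" by (auto simp: card_1_singleton_iff)
        then have r: "S = {b, c, r}" "r \<in> S" "r \<noteq> b" "r \<noteq> c" using bc by auto
        have cG: "b \<in> carrier G" "c \<in> carrier G" "r \<in> carrier G" "x \<in> carrier G" "w \<in> carrier G"
          using bc r(2) S x w same_side_carrier by auto
        have xw: "inv b \<otimes> (c \<otimes> w) = x" using cG by (simp add: w_def)
        \<comment> \<open>The far end of the edge \<open>a\<close> at \<open>b \<otimes> w\<close>.
          The word \<open>a b c b e\<close> runs from \<open>y a\<close> through
          \<open>b \<otimes> w\<close>, \<open>w\<close>,
          \<open>c \<otimes> w = b \<otimes> x\<close> and \<open>x\<close>; only its two outer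
          letters vary.\<close>
        define y where "y a = inv a \<otimes> (b \<otimes> w)" for a
        have y: "same_side (y a)" if "a \<in> S" for a
          unfolding y_def by (rule same_side_step[OF w bc(1) that])
        have yw: "a \<otimes> y a = b \<otimes> w" if "a \<in> S" for a
          using that S cG unfolding y_def by auto
        have im: "image_word (y a) [a, b, c, b, e] = [col (y a) a, col w b, col w c, col x b, col x e]"
          if "a \<in> S" for a e
          using yw[OF that] xw cG by simp
        \<comment> \<open>With equal outer letters, \<open>closed_10_word\<close> excludes a closed
          walk of length ten, as the \<open>U\<close>-components are distinct.\<close>
        have no: "\<not> extends_to_closed 10 T [col (y a) a, col w b, col w c, col x b, col x a]"
          if a: "a = c \<or> a = r" for a
        proof
          assume "extends_to_closed 10 T [col (y a) a, col w b, col w c, col x b, col x a]"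
          then have "extends_to_closed 10 T (image_word (y a) [a, b, c, b, a])" using a im bc r(2) by auto
          then have ext: "extends_to_closed 10 S [a, b, c, b, a]"
            using a bc r(2) y by (intro extends_to_closed_preimage[of "y a"]) auto
          show False
          proof (cases "a = c")
            case True
            have "S = {c, b, r}" using r by auto
            then show False
              using noncommuting_triple.closed_10_word[OF trS[of c b r]] ne[of c b r] ext True by simp
          next
            case False
            have "S = {r, b, c}" using r by auto
            then show False
              using noncommuting_triple.closed_10_word[OF trS[of r b c]] ne[of r b c] ext False a by simp
          qed
        qed
        let ?b = "col w b" and ?c = "col w c" and ?d = "col x b"
        have mem: "?b \<in> T" "?c \<in> T" "?d \<in> T" using w x bc by (simp_all add: col_step(1))
        have bc': "?b \<noteq> ?c" using col_inj[OF w bc(1,2)] bc(3) by blast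
        have cd': "?c \<noteq> ?d" using col_adj[OF w bc(2,1)] bc(3) xw by auto
        have bd': "?b \<noteq> ?d" using neq by (simp add: w_def)
        have T3: "T = {?d, ?b, ?c}"
        proof -
          have "finite T" using cT by (metis card.infinite zero_neq_numeral)
          then show ?thesis using cT mem bc' cd' bd' by (intro card_seteq[symmetric]) auto
        qed
        have yc: "col (y a) a \<in> {?c, ?d}" if "a \<in> S" "a \<noteq> b" for a
        proof -
          have "col (y a) a \<in> T" using that y by (simp add: col_step(1))
          moreover have "col (y a) a \<noteq> ?b"
            using col_adj[OF y[OF that(1)] that(1) bc(1) that(2)] yw[OF that(1)] cG by simp
          ultimately show ?thesis using T3 by auto
        qed
        have xe: "col x e \<in> {?b, ?c}" if "e \<in> S" "e \<noteq> b" for e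
          using T3 col_step(1)[OF x that(1)] col_inj[OF x that(1) bc(1)] that(2) by auto
        have y_ne: "col (y c) c \<noteq> col (y r) r"
          using col_inj_side1[OF y[OF bc(2)] y[OF r(2)] bc(2) r(2)] yw[OF bc(2)] yw[OF r(2)] r(4) by auto
        have x_ne: "col x c \<noteq> col x r" using col_inj[OF x bc(2) r(2)] r(4) by auto
        \<comment> \<open>For \<open>a = c\<close> and \<open>a = r\<close>, the first image colours
          are \<open>?c\<close> and \<open>?d\<close> in some order, the last ones \<open>?b\<close>
          and \<open>?c\<close>. Of the four combinations only \<open>?c\<close> with
          \<open>?c\<close> is absent from \<open>two_hexagons\<close>, so either way of pairing
          contradicts \<open>no\<close>.\<close>
        note hex = noncommuting_triple.two_hexagons[OF trT[OF T3], folded T3]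
        show False
          using yc[of c] yc[of r] xe[of c] xe[of r] y_ne x_ne no[of c] no[of r] hex bc r by auto
      qed
      show ?thesis
      proof (rule affine_equiv_of_col_constant[OF hom pqr(1)])
        fix x s t u assume "same_side x" "s \<in> S" "t \<in> S" "u \<in> S"
        then show "col (inv t \<otimes> (s \<otimes> x)) u = col x u"
        proof (rule col_constant[OF card, rotated])
          fix c assume "c \<in> S"
          moreover have "\<exists>b\<in>S. b \<noteq> c" using pqr by auto
          ultimately show "\<exists>b\<in>S - {c}. \<forall>x. same_side x \<longrightarrow> col (inv c \<otimes> (b \<otimes> x)) b = col x b"
            using edge by blast
        qed
      qed
    qed
  qed
qed

end

section \<open>Homogeneity of abelian groups\<close>

lemma (in group) restrict_in_auto:
  assumes fin: "finite (carrier G)" and inj: "inj_on \<phi> (carrier G)"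
    and closed: "\<And>x. x \<in> carrier G \<Longrightarrow> \<phi> x \<in> carrier G"
    and mult: "\<And>x y. x \<in> carrier G \<Longrightarrow> y \<in> carrier G \<Longrightarrow> \<phi> (x \<otimes> y) = \<phi> x \<otimes> \<phi> y"
  shows "restrict \<phi> (carrier G) \<in> auto G"
proof -
  have "\<phi> ` carrier G = carrier G" using closed by (intro endo_inj_surj[OF fin _ inj]) auto
  then have "bij_betw (restrict \<phi> (carrier G)) (carrier G) (carrier G)"
    using inj by (simp add: bij_betw_def)
  then show ?thesis using closed mult by (auto simp: auto_def hom_def Bij_def)
qed

lemma (in group) prime_pow_mem_subgroup:
  assumes H: "subgroup H G" and x: "x \<in> carrier G" "x \<notin> H" and p: "Factorial_Ring.prime p" "x [^] int p \<in> H"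
  shows "x [^] (i::int) \<in> H \<longleftrightarrow> int p dvd i"
proof
  assume i: "x [^] i \<in> H"
  show "int p dvd i"
  proof (rule ccontr)
    assume "\<not> int p dvd i"
    then have "coprime (int p) i" using p(1) by (simp add: prime_imp_coprime)
    then obtain u v where uv: "u * int p + v * i = 1" using bezout_int[of "int p" i] by (auto simp: coprime_iff_gcd_eq_1)
    have "x [^] (u * int p + v * i) = (x [^] int p) [^] u \<otimes> (x [^] i) [^] v"
      using x(1) by (simp add: int_pow_mult int_pow_pow mult.commute)
    moreover have "(x [^] int p) [^] u \<otimes> (x [^] i) [^] v \<in> H"
      by (intro subgroup.m_closed[OF H] subgroup_int_pow_closed[OF H] p(2) i)
    ultimately show False using uv x by simp
  qed
next
  assume "int p dvd i"
  then obtain k where "i = int p * k" by (elim dvdE)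
  then show "x [^] i \<in> H" using x(1) subgroup_int_pow_closed[OF H p(2), of k] by (simp add: int_pow_pow)
qed

text \<open>
  For every prime divisor \<open>p\<close> of the exponent \<open>n\<close>, the \<open>p\<close>-th powers are recognised by their order.
  This is what makes isomorphisms between subgroups extend one prime step at a time.
\<close>

definition root_closed :: "nat \<Rightarrow> ('a, 'b) monoid_scheme \<Rightarrow> bool" where
  "root_closed n G \<longleftrightarrow> (\<forall>x\<in>carrier G. x [^]\<^bsub>G\<^esub> n = \<one>\<^bsub>G\<^esub>) \<and>
     (\<forall>p h. Factorial_Ring.prime p \<longrightarrow> p dvd n \<longrightarrow> h \<in> carrier G \<longrightarrow> h [^]\<^bsub>G\<^esub> (n div p) = \<one>\<^bsub>G\<^esub> \<longrightarrow>
        (\<exists>y\<in>carrier G. y [^]\<^bsub>G\<^esub> p = h))"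

locale partial_embedding = comm_group G for G (structure) +
  fixes H \<phi>
  assumes H: "subgroup H G" and inj: "inj_on \<phi> H"
    and mult: "\<And>x y. x \<in> H \<Longrightarrow> y \<in> H \<Longrightarrow> \<phi> (x \<otimes> y) = \<phi> x \<otimes> \<phi> y"
    and closed: "\<And>x. x \<in> H \<Longrightarrow> \<phi> x \<in> carrier G"
begin

lemma mem_carrier: "x \<in> H \<Longrightarrow> x \<in> carrier G"
  using subgroup.mem_carrier[OF H] .

lemma group_hom: "group_hom (G\<lparr>carrier := H\<rparr>) G \<phi>"
  using subgroup_imp_group[OF H] mult closed
  by (auto simp: group_hom_def group_hom_axioms_def hom_def is_group)

lemma one: "\<phi> \<one> = \<one>"
  using group_hom.hom_one[OF group_hom] by simp

lemma inv: "x \<in> H \<Longrightarrow> \<phi> (inv x) = inv (\<phi> x)"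
  using group_hom.hom_inv[OF group_hom, of x] m_inv_consistent[OF H] by simp

lemma int_pow: "x \<in> H \<Longrightarrow> \<phi> (x [^] (i::int)) = \<phi> x [^] i"
  using group_hom.hom_int_pow[OF group_hom, of x i] int_pow_consistent[OF H, of x i] by simp

lemma eq_one_iff: "x \<in> H \<Longrightarrow> \<phi> x = \<one> \<longleftrightarrow> x = \<one>"
  using inj_onD[OF inj, of x \<one>] one subgroup.one_closed[OF H] by auto

lemma subgroup_image: "subgroup (\<phi> ` H) G"
  using group_hom.img_is_subgroup[OF group_hom] by simp

text \<open>The extension sends \<open>x [^] i \<otimes> h\<close> to
  \<open>y [^] i \<otimes> \<phi> h\<close>. It is well defined and injective: since
  \<open>x\<close> and \<open>y\<close> lie outside the subgroups, a relation on either side forces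
  \<open>p\<close> to divide \<open>i\<close>, and then it is a relation inside
  \<open>H\<close>.\<close>

lemma extend_by_root:
  assumes x: "x \<in> carrier G" "x \<notin> H" and p: "Factorial_Ring.prime p" "x [^] int p \<in> H"
    and y: "y \<in> carrier G" "y \<notin> \<phi> ` H" "y [^] int p = \<phi> (x [^] int p)"
  shows "\<exists>K \<psi>. partial_embedding G K \<psi> \<and> H \<subset> K \<and> (\<forall>h\<in>H. \<psi> h = \<phi> h)"
proof -
  have key: "x [^] i \<otimes> h = \<one> \<longleftrightarrow> y [^] i \<otimes> \<phi> h = \<one>" if h: "h \<in> H" for i :: int and h
  proof -
    have hc: "h \<in> carrier G" "\<phi> h \<in> carrier G" "inv h \<in> H" "inv (\<phi> h) \<in> \<phi> ` H"
      using h mem_carrier closed subgroup.m_inv_closed[OF H h]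
        subgroup.m_inv_closed[OF subgroup_image, of "\<phi> h"] by auto
    have 1: "int p dvd i" if "x [^] i \<otimes> h = \<one>"
    proof -
      have "x [^] i = inv h" using that x(1) hc by (simp add: inv_equality)
      then have "x [^] i \<in> H" using hc by simp
      then show ?thesis using prime_pow_mem_subgroup[OF H x p] by blast
    qed
    have 2: "int p dvd i" if "y [^] i \<otimes> \<phi> h = \<one>"
    proof -
      have "y [^] i = inv (\<phi> h)" using that y(1) hc by (simp add: inv_equality)
      then have "y [^] i \<in> \<phi> ` H" using hc by simp
      moreover have "y [^] int p \<in> \<phi> ` H" using p(2) y(3) by simp
      ultimately show ?thesis using prime_pow_mem_subgroup[OF subgroup_image y(1,2) p(1)] by blast
    qed
    have 3: "x [^] i \<otimes> h = \<one> \<longleftrightarrow> y [^] i \<otimes> \<phi> h = \<one>" if dvd: "int p dvd i"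
    proof -
      from dvd obtain m where m: "i = int p * m" by (elim dvdE)
      have xi: "x [^] i = (x [^] int p) [^] m" "(x [^] int p) [^] m \<in> H"
        using m x(1) subgroup_int_pow_closed[OF H p(2)] by (simp_all add: int_pow_pow)
      have "y [^] i = \<phi> (x [^] i)" using m y(1,3) xi p(2) by (simp add: int_pow flip: int_pow_pow)
      then have "y [^] i \<otimes> \<phi> h = \<phi> (x [^] i \<otimes> h)" using xi h by (simp add: mult)
      then show ?thesis using eq_one_iff xi h subgroup.m_closed[OF H] by simp
    qed
    show ?thesis using 1 2 3 by blast
  qed
  have eq: "x [^] i \<otimes> h = x [^] j \<otimes> k \<longleftrightarrow> y [^] i \<otimes> \<phi> h = y [^] j \<otimes> \<phi> k"
    if h: "h \<in> H" "k \<in> H" for i j :: int and h k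
  proof -
    have hc: "h \<in> carrier G" "k \<in> carrier G" "\<phi> h \<in> carrier G" "\<phi> k \<in> carrier G" "inv k \<in> H" "h \<otimes> inv k \<in> H"
      using h mem_carrier closed subgroup.m_inv_closed[OF H] subgroup.m_closed[OF H] by auto
    have quot: "u = v \<longleftrightarrow> u \<otimes> inv v = \<one>" if "u \<in> carrier G" "v \<in> carrier G" for u v
      using that by (metis inv_closed inv_equality inv_inv r_inv)
    have "x [^] i \<otimes> h = x [^] j \<otimes> k \<longleftrightarrow> x [^] (i - j) \<otimes> (h \<otimes> inv k) = \<one>"
      using x(1) hc by (subst quot) (auto simp: inv_mult int_pow_diff m_ac)
    moreover have "y [^] i \<otimes> \<phi> h = y [^] j \<otimes> \<phi> k \<longleftrightarrow> y [^] (i - j) \<otimes> \<phi> (h \<otimes> inv k) = \<one>"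
      using y(1) hc h by (subst quot) (auto simp: inv_mult int_pow_diff m_ac mult inv)
    ultimately show ?thesis using key[OF hc(6), of "i - j"] by simp
  qed
  let ?K = "{x [^] i \<otimes> h | (i::int) h. h \<in> H}"
  define \<psi> where "\<psi> w = (SOME v. \<exists>(i::int) h. h \<in> H \<and> w = x [^] i \<otimes> h \<and> v = y [^] i \<otimes> \<phi> h)" for w
  have \<psi>: "\<psi> (x [^] i \<otimes> h) = y [^] i \<otimes> \<phi> h" if h: "h \<in> H" for i :: int and h
  proof -
    have "\<exists>(j::int) k. k \<in> H \<and> x [^] i \<otimes> h = x [^] j \<otimes> k \<and> \<psi> (x [^] i \<otimes> h) = y [^] j \<otimes> \<phi> k"
      unfolding \<psi>_def by (rule someI_ex) (use h in blast)
    then show ?thesis using eq h by metis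
  qed
  have prod: "(x [^] i \<otimes> h) \<otimes> (x [^] j \<otimes> k) = x [^] (i + j) \<otimes> (h \<otimes> k)" if "h \<in> H" "k \<in> H" for i j :: int and h k
    using that x(1) mem_carrier by (simp add: int_pow_mult m_ac)
  have prod': "(y [^] i \<otimes> \<phi> h) \<otimes> (y [^] j \<otimes> \<phi> k) = y [^] (i + j) \<otimes> \<phi> (h \<otimes> k)" if "h \<in> H" "k \<in> H" for i j :: int and h k
    using that y(1) closed by (simp add: int_pow_mult m_ac mult)
  have pe: "partial_embedding G ?K \<psi>"
  proof (intro partial_embedding.intro partial_embedding_axioms.intro comm_group_axioms)
    show "subgroup ?K G"
    proof (rule subgroupI)
      show "?K \<subseteq> carrier G" using x(1) mem_carrier by auto
      show "?K \<noteq> {}" using subgroup.one_closed[OF H] by blast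
      fix w assume "w \<in> ?K"
      then obtain i :: int and h where w: "w = x [^] i \<otimes> h" "h \<in> H" by blast
      then have "inv w = x [^] (- i) \<otimes> inv h" using x(1) mem_carrier by (simp add: inv_mult int_pow_neg)
      then show "inv w \<in> ?K" using w(2) subgroup.m_inv_closed[OF H] by blast
      fix v assume "v \<in> ?K"
      then obtain j :: int and k where "v = x [^] j \<otimes> k" "k \<in> H" by blast
      then show "w \<otimes> v \<in> ?K" using w prod subgroup.m_closed[OF H] by blast
    qed
    show "inj_on \<psi> ?K" using \<psi> eq by (auto simp: inj_on_def)
    show "\<psi> (w \<otimes> v) = \<psi> w \<otimes> \<psi> v" if "w \<in> ?K" "v \<in> ?K" for w v
      using that \<psi> prod prod' subgroup.m_closed[OF H] by auto
    show "\<psi> w \<in> carrier G" if "w \<in> ?K" for w using that \<psi> y(1) closed by auto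
  qed
  have sub: "h \<in> ?K \<and> \<psi> h = \<phi> h" if "h \<in> H" for h
  proof -
    have "x [^] (0::int) \<otimes> h = h" "y [^] (0::int) \<otimes> \<phi> h = \<phi> h" using that mem_carrier closed by simp_all
    then show ?thesis using \<psi>[OF that, of 0] that by (metis (mono_tags, lifting) mem_Collect_eq)
  qed
  have "x [^] (1::int) \<otimes> \<one> = x" using x(1) by simp
  then have "x \<in> ?K" using subgroup.one_closed[OF H] by (metis (mono_tags, lifting) mem_Collect_eq)
  then have "H \<subset> ?K" using sub x(2) by blast
  then show ?thesis using pe sub by blast
qed

text \<open>Take the least positive \<open>j\<close> with \<open>w [^] j\<close> in \<open>H\<close>
  and a prime \<open>p\<close> dividing it; then \<open>x = w [^] (j div p)\<close> works.\<close>

lemma ex_prime_step: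
  assumes n: "\<And>x. x \<in> carrier G \<Longrightarrow> x [^] n = \<one>" "n > 0" and proper: "H \<noteq> carrier G"
  obtains x p where "x \<in> carrier G" "x \<notin> H" "Factorial_Ring.prime p" "p dvd n" "x [^] int p \<in> H"
proof -
  obtain w where w: "w \<in> carrier G" "w \<notin> H" using proper subgroup.subset[OF H] by blast
  define j where "j = (LEAST j. j > 0 \<and> w [^] int j \<in> H)"
  have ex: "n > 0 \<and> w [^] int n \<in> H"
    using n w subgroup.one_closed[OF H] by (simp add: int_pow_int)
  have j: "j > 0" "w [^] int j \<in> H" unfolding j_def using LeastI[where P = "\<lambda>j. j > 0 \<and> w [^] int j \<in> H", OF ex] by auto
  have least: "w [^] int k \<notin> H" if "k > 0" "k < j" for k
    using that not_less_Least[of k "\<lambda>j. j > 0 \<and> w [^] int j \<in> H"] unfolding j_def by blast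
  have "j \<noteq> 1" using j w by auto
  then obtain p where p: "Factorial_Ring.prime p" "p dvd j" using prime_factor_nat by blast
  define x where "x = w [^] int (j div p)"
  have "p > 1" using p(1) by (rule prime_gt_1_nat)
  then have "j div p > 0" "j div p < j" using p j by (auto simp: div_greater_zero_iff dvd_imp_le)
  then have x: "x \<in> carrier G" "x \<notin> H" using least w by (simp_all add: x_def)
  have "x [^] int p = w [^] int j"
    using w p(2) by (simp add: x_def int_pow_pow flip: of_nat_mult)
  then have xp: "x [^] int p \<in> H" using j by simp
  have "x [^] int n \<in> H" using n x subgroup.one_closed[OF H] by (simp add: int_pow_int)
  then have "p dvd n" using prime_pow_mem_subgroup[OF H x p(1) xp] by simp
  then show ?thesis using that x p(1) xp by blast
qed

lemma ex_extension:
  assumes fin: "finite (carrier G)" and n: "root_closed n G" "n > 0" and proper: "H \<noteq> carrier G"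
  shows "\<exists>K \<psi>. partial_embedding G K \<psi> \<and> H \<subset> K \<and> (\<forall>h\<in>H. \<psi> h = \<phi> h)"
proof -
  have exp: "x [^] n = \<one>" if "x \<in> carrier G" for x using n that by (simp add: root_closed_def)
  obtain x p where x: "x \<in> carrier G" "x \<notin> H" and p: "Factorial_Ring.prime p" "p dvd n" and xp: "x [^] int p \<in> H"
    using ex_prime_step[OF exp n(2) proper] by metis
  let ?g = "\<phi> (x [^] int p)"
  have g: "?g \<in> carrier G" using xp closed by simp
  have np: "int p * int (n div p) = int n" using p(2) by (simp flip: of_nat_mult)
  have "?g [^] int (n div p) = \<phi> ((x [^] int p) [^] int (n div p))" using xp by (simp add: int_pow)
  also have "(x [^] int p) [^] int (n div p) = \<one>" 
    by (simp only: int_pow_pow[OF x(1)] np) (simp only: int_pow_int exp[OF x(1)])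
  finally have "?g [^] (n div p) = \<one>" by (simp add: one int_pow_int)
  then obtain y0 where y0: "y0 \<in> carrier G" "y0 [^] int p = ?g"
    using n(1) p g unfolding root_closed_def by (metis int_pow_int)
  have "\<exists>y\<in>carrier G. y \<notin> \<phi> ` H \<and> y [^] int p = ?g"
  \<comment> \<open>A root inside the image is moved out by multiplying with some \<open>s\<close>
    outside the image whose \<open>p\<close>-th power is trivial.\<close>
  proof (cases "y0 \<in> \<phi> ` H")
    case True
    then obtain x' where x': "x' \<in> H" "y0 = \<phi> x'" by blast
    let ?M = "{g \<in> carrier G. g [^] int p = \<one>}"
    have x'c: "x' \<in> carrier G" "x' [^] int p \<in> H"
      using x' mem_carrier subgroup_int_pow_closed[OF H] by auto
    have "\<phi> (x' [^] int p) = \<phi> (x [^] int p)" using x' y0 by (simp add: int_pow)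
    then have "x' [^] int p = x [^] int p" using inj x'c xp by (auto dest: inj_onD)
    then have "(x \<otimes> inv x') [^] int p = \<one>" using x x'c by (simp add: int_pow_distrib int_pow_inv)
    moreover have "x \<otimes> inv x' \<notin> H"
    proof
      assume "x \<otimes> inv x' \<in> H"
      then have "x \<otimes> inv x' \<otimes> x' \<in> H" using x' subgroup.m_closed[OF H] by blast
      then show False using x x'c by (simp add: m_assoc)
    qed
    ultimately have "H \<inter> ?M \<subset> ?M" using x x'c by blast
    \<comment> \<open>\<open>H\<close> misses some solution of \<open>g [^] p = \<one>\<close>. The
      injective \<phi> creates no new ones in its image, so the image misses a solution as
      well.\<close>
    then have lt: "card (H \<inter> ?M) < card ?M" using fin by (intro psubset_card_mono) auto
    have "\<phi> ` H \<inter> ?M \<subseteq> \<phi> ` (H \<inter> ?M)"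
    proof
      fix k assume k: "k \<in> \<phi> ` H \<inter> ?M"
      then obtain h where h: "h \<in> H" "k = \<phi> h" by blast
      then have "\<phi> (h [^] int p) = \<one>" using k by (simp add: int_pow)
      then have "h [^] int p = \<one>" using eq_one_iff subgroup_int_pow_closed[OF H h(1)] by simp
      then show "k \<in> \<phi> ` (H \<inter> ?M)" using h mem_carrier by blast
    qed
    moreover have "finite (H \<inter> ?M)" using fin by simp
    ultimately have "card (\<phi> ` H \<inter> ?M) < card ?M"
      using lt card_image_le[of "H \<inter> ?M" \<phi>] card_mono[of "\<phi> ` (H \<inter> ?M)" "\<phi> ` H \<inter> ?M"] by simp
    then have "\<phi> ` H \<inter> ?M \<noteq> ?M" by auto
    then obtain s where s: "s \<in> carrier G" "s [^] int p = \<one>" "s \<notin> \<phi> ` H" by blast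
    have "y0 \<otimes> s \<notin> \<phi> ` H"
    proof
      assume "y0 \<otimes> s \<in> \<phi> ` H"
      then have "inv y0 \<otimes> (y0 \<otimes> s) \<in> \<phi> ` H"
        using True subgroup.m_closed[OF subgroup_image] subgroup.m_inv_closed[OF subgroup_image] by blast
      then show False using s y0 by simp
    qed
    moreover have "(y0 \<otimes> s) [^] int p = ?g" using s y0 g by (simp add: int_pow_distrib)
    ultimately show ?thesis using s y0 by blast
  qed (use y0 in blast)
  then show ?thesis using extend_by_root[OF x p(1) xp] by blast
qed

end

lemma (in comm_group) homogeneous_of_root_closed:
  assumes fin: "finite (carrier G)" and n: "root_closed n G" "n > 0"
  shows "homogeneous G"
proof -
  have *: "\<exists>\<alpha>\<in>auto G. \<forall>x\<in>H. \<alpha> x = \<phi> x" if "partial_embedding G H \<phi>" for H \<phi>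
    using that
  proof (induction "card (carrier G) - card H" arbitrary: H \<phi> rule: less_induct)
    case less
    interpret partial_embedding G H \<phi> by fact
    show ?case
    proof (cases "H = carrier G")
      case True
      then have "restrict \<phi> (carrier G) \<in> auto G" using inj closed mult by (intro restrict_in_auto[OF fin]) auto
      then show ?thesis using True by (intro bexI) auto
    next
      case False
      obtain K \<psi> where K: "partial_embedding G K \<psi>" "H \<subset> K" "\<forall>h\<in>H. \<psi> h = \<phi> h"
        using ex_extension[OF fin n False] by blast
      have "K \<subseteq> carrier G" using K(1) by (simp add: partial_embedding_def partial_embedding_axioms_def subgroup.subset)
      then have "card H < card K" "card K \<le> card (carrier G)"
        using K(2) fin by (auto intro: psubset_card_mono card_mono finite_subset)
      then have "\<exists>\<alpha>\<in>auto G. \<forall>x\<in>K. \<alpha> x = \<psi> x" by (intro less.hyps[OF _ K(1)]) simp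
      then obtain \<alpha> where "\<alpha> \<in> auto G" "\<forall>x\<in>K. \<alpha> x = \<psi> x" by blast
      then show ?thesis using K by (intro bexI[of _ \<alpha>]) auto
    qed
  qed
  show ?thesis
    unfolding homogeneous_def
  proof (intro allI impI)
    fix H \<phi> assume "subgroup H G" "\<phi> \<in> hom (G\<lparr>carrier := H\<rparr>) G" "inj_on \<phi> H"
    then have "partial_embedding G H \<phi>" 
      by (intro partial_embedding.intro partial_embedding_axioms.intro comm_group_axioms) (auto simp: hom_def)
    then show "\<exists>\<alpha>\<in>auto G. \<forall>x\<in>H. \<alpha> x = \<phi> x" by (rule *)
  qed
qed

section \<open>Homogeneity of quaternion extensions\<close>

text \<open>A subgroup is central, or all of \<open>Q8\<close>, or it consists of powers of an
  element \<open>x\<close> of order four. In the last case \<open>x\<close> and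
  \<open>\<phi> x\<close> are completed to noncommuting pairs, which satisfy the same
  relations.\<close>

lemma homogeneous_Q8: "homogeneous Q8"
proof -
  interpret group Q8 by (rule group_Q8)
  have fin: "finite (carrier Q8)" by (simp add: Q8_def)
  show ?thesis
    unfolding homogeneous_def
  proof (intro allI impI)
    fix H \<phi> assume H: "subgroup H Q8" and \<phi>: "\<phi> \<in> hom (Q8\<lparr>carrier := H\<rparr>) Q8" "inj_on \<phi> H"
    have HG: "x \<in> carrier Q8" if "x \<in> H" for x using H that by (rule subgroup.mem_carrier)
    have \<phi>c: "\<phi> x \<in> carrier Q8" if "x \<in> H" for x using \<phi>(1) that by (auto simp: hom_def)
    have \<phi>m: "\<phi> (x \<otimes>\<^bsub>Q8\<^esub> y) = \<phi> x \<otimes>\<^bsub>Q8\<^esub> \<phi> y" if "x \<in> H" "y \<in> H" for x y using \<phi>(1) that by (auto simp: hom_def)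
    have oneH: "\<one>\<^bsub>Q8\<^esub> \<in> H" using H by (rule subgroup.one_closed)
    have \<phi>1: "\<phi> \<one>\<^bsub>Q8\<^esub> = \<one>\<^bsub>Q8\<^esub>" using \<phi>m[OF oneH oneH] \<phi>c[OF oneH] by (simp add: l_cancel_one')
    have \<phi>_inj: "\<phi> x = \<one>\<^bsub>Q8\<^esub> \<Longrightarrow> x = \<one>\<^bsub>Q8\<^esub>" if "x \<in> H" for x
      using inj_onD[OF \<phi>(2), of x "\<one>\<^bsub>Q8\<^esub>"] \<phi>1 that oneH by simp
    have \<phi>neg: "\<phi> Q8_neg = Q8_neg" if "Q8_neg \<in> H"
    proof -
      have "\<phi> Q8_neg \<otimes>\<^bsub>Q8\<^esub> \<phi> Q8_neg = \<one>\<^bsub>Q8\<^esub>" using \<phi>m[OF that that] \<phi>1 by (simp add: Q8_neg_square)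
      moreover have "\<phi> Q8_neg \<noteq> \<one>\<^bsub>Q8\<^esub>" using \<phi>_inj[OF that] by (auto simp: Q8_neg_def Q8_one)
      ultimately show ?thesis using Q8_involution[OF \<phi>c[OF that]] by blast
    qed
    show "\<exists>\<alpha>\<in>auto Q8. \<forall>x\<in>H. \<alpha> x = \<phi> x"
    proof (cases "H \<subseteq> {\<one>\<^bsub>Q8\<^esub>, Q8_neg}")
      case True
      then have "\<forall>x\<in>H. (\<lambda>x\<in>carrier Q8. x) x = \<phi> x" using HG \<phi>1 \<phi>neg by auto
      then show ?thesis using id_in_auto by blast
    next
      case False
      then obtain x where x: "x \<in> H" "x \<noteq> \<one>\<^bsub>Q8\<^esub>" "x \<noteq> Q8_neg" by blast
      show ?thesis
      proof (cases "\<exists>y\<in>H. x \<otimes>\<^bsub>Q8\<^esub> y \<noteq> y \<otimes>\<^bsub>Q8\<^esub> x")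
        case True
        then have "H = carrier Q8" using Q8_subgroup_eq[OF H x(1)] by blast
        then have "restrict \<phi> (carrier Q8) \<in> auto Q8" using \<phi>(2) \<phi>c \<phi>m by (intro restrict_in_auto[OF fin]) auto
        then show ?thesis using HG by (intro bexI) auto
      next
        case comm: False
        have \<phi>x: "\<phi> x \<noteq> \<one>\<^bsub>Q8\<^esub>" "\<phi> x \<noteq> Q8_neg"
        proof -
          show "\<phi> x \<noteq> \<one>\<^bsub>Q8\<^esub>" using x \<phi>_inj by blast
          show "\<phi> x \<noteq> Q8_neg"
          proof
            assume "\<phi> x = Q8_neg"
            then have "\<phi> (x \<otimes>\<^bsub>Q8\<^esub> x) = \<one>\<^bsub>Q8\<^esub>" using \<phi>m[OF x(1) x(1)] by (simp add: Q8_neg_square)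
            then have "x \<otimes>\<^bsub>Q8\<^esub> x = \<one>\<^bsub>Q8\<^esub>" using \<phi>_inj subgroup.m_closed[OF H x(1) x(1)] by blast
            then show False using Q8_involution[OF HG[OF x(1)]] x by blast
          qed
        qed
        obtain q where q: "q \<in> carrier Q8" "x \<otimes>\<^bsub>Q8\<^esub> q \<noteq> q \<otimes>\<^bsub>Q8\<^esub> x"
          using Q8_ex_noncommuting_with[OF HG[OF x(1)] x(2,3)] by blast
        obtain q' where q': "q' \<in> carrier Q8" "\<phi> x \<otimes>\<^bsub>Q8\<^esub> q' \<noteq> q' \<otimes>\<^bsub>Q8\<^esub> \<phi> x"
          using Q8_ex_noncommuting_with[OF \<phi>c[OF x(1)] \<phi>x] by blast
        interpret A: commutator_pair Q8 x q Q8_neg by (rule commutator_pair_Q8[OF HG[OF x(1)] q])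
        interpret B: commutator_pair Q8 "\<phi> x" q' Q8_neg by (rule commutator_pair_Q8[OF \<phi>c[OF x(1)] q'])
        let ?R = "{A.nf i j e | i j e. True}"
        have "x \<in> ?R" "q \<in> ?R" using A.nf_a[symmetric] A.nf_b[symmetric] by blast+
        then have R: "?R = carrier Q8" using Q8_subgroup_eq[OF A.subgroup_range_nf] q(2) by blast
        obtain \<psi> where \<psi>: "\<psi> x = \<phi> x" "inj_on \<psi> ?R"
          "\<And>u v. u \<in> ?R \<Longrightarrow> v \<in> ?R \<Longrightarrow> \<psi> (u \<otimes>\<^bsub>Q8\<^esub> v) = \<psi> u \<otimes>\<^bsub>Q8\<^esub> \<psi> v" "\<And>u. u \<in> ?R \<Longrightarrow> \<psi> u \<in> carrier Q8"
          by (rule commutator_pairs_hom[OF A.commutator_pair_axioms B.commutator_pair_axioms])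
            (auto simp: Q8_nf_eq_one_iff[OF HG[OF x(1)] q] Q8_nf_eq_one_iff[OF \<phi>c[OF x(1)] q'])
        note \<psi>' = \<psi>(2-4)[unfolded R]
        have auto: "restrict \<psi> (carrier Q8) \<in> auto Q8" by (rule restrict_in_auto[OF fin \<psi>'(1,3,2)])
        have "\<psi> y = \<phi> y" if y: "y \<in> H" for y
        proof -
          have "y \<in> {\<one>\<^bsub>Q8\<^esub>, x, x \<otimes>\<^bsub>Q8\<^esub> x, x \<otimes>\<^bsub>Q8\<^esub> x \<otimes>\<^bsub>Q8\<^esub> x}"
            using Q8_commuting_with[OF HG[OF x(1)] x(2,3) HG[OF y]] comm y by blast
          moreover have "\<psi> \<one>\<^bsub>Q8\<^esub> = \<one>\<^bsub>Q8\<^esub>"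
            using \<psi>'(2)[OF one_closed one_closed] \<psi>'(3)[OF one_closed] by (simp add: l_cancel_one')
          moreover have xx: "x \<otimes>\<^bsub>Q8\<^esub> x \<in> H" using subgroup.m_closed[OF H x(1) x(1)] .
          moreover have "\<psi> (x \<otimes>\<^bsub>Q8\<^esub> x) = \<phi> (x \<otimes>\<^bsub>Q8\<^esub> x)"
            using \<psi>'(2)[OF HG[OF x(1)] HG[OF x(1)]] \<phi>m[OF x(1) x(1)] \<psi>(1) by simp
          moreover from this have "\<psi> (x \<otimes>\<^bsub>Q8\<^esub> x \<otimes>\<^bsub>Q8\<^esub> x) = \<phi> (x \<otimes>\<^bsub>Q8\<^esub> x \<otimes>\<^bsub>Q8\<^esub> x)"
            using \<psi>'(2)[OF HG[OF xx] HG[OF x(1)]] \<phi>m[OF xx x(1)] \<psi>(1) by simp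
          ultimately show ?thesis using \<psi>(1) \<phi>1 by (elim insertE emptyE) simp_all
        qed
        then show ?thesis using auto HG by (intro bexI) auto
      qed
    qed
  qed
qed

text \<open>The orders of the two factors are coprime, so \<phi> respects the two parts of
  \<open>H\<close>. Each part is extended inside its own factor, and the extensions are
  combined.\<close>

lemma (in q8_product) homogeneous_q8_product:
  assumes fin: "finite (carrier G)" and hom: "homogeneous U"
  shows "homogeneous G"
  unfolding homogeneous_def
proof (intro allI impI)
  fix H \<phi> assume H: "subgroup H G" and \<phi>: "\<phi> \<in> hom (G\<lparr>carrier := H\<rparr>) G" "inj_on \<phi> H"
  have HG: "x \<in> carrier G" if "x \<in> H" for x using H that by (rule subgroup.mem_carrier)
  interpret \<phi>: group_hom "G\<lparr>carrier := H\<rparr>" G \<phi>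
    using subgroup_imp_group[OF H] \<phi>(1) by (simp add: group_hom_def group_hom_axioms_def is_group)
  have \<phi>c: "\<phi> x \<in> carrier G" if "x \<in> H" for x using \<phi>.hom_closed that by simp
  have \<phi>m: "\<phi> (x \<otimes> y) = \<phi> x \<otimes> \<phi> y" if "x \<in> H" "y \<in> H" for x y using \<phi>.hom_mult that by simp
  have \<phi>1: "\<phi> \<one> = \<one>" using \<phi>.hom_one by simp
  have \<phi>p: "\<phi> (x [^] (i::int)) = \<phi> x [^] i" if "x \<in> H" for x i
    using \<phi>.hom_int_pow[of x i] int_pow_consistent[OF H that] that by simp
  have \<rho>\<phi>: "\<rho> (\<phi> y) = \<one>\<^bsub>Q8\<^esub>" if y: "y \<in> H" "\<rho> y = \<one>\<^bsub>Q8\<^esub>" for y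
  proof -
    let ?n = "int (order U)"
    have "y [^] ?n = \<one>"
      by (rule inj) (use y HG in \<open>auto simp: \<pi>.hom_nat_pow \<rho>.hom_nat_pow int_pow_int U.pow_order_eq_1\<close>)
    then have "\<phi> y [^] ?n = \<one>" using \<phi>p[OF y(1), of ?n] \<phi>1 by simp
    then have "\<rho> (\<phi> y) [^]\<^bsub>Q8\<^esub> ?n = \<one>\<^bsub>Q8\<^esub>" using \<phi>c[OF y(1)] by (metis \<rho>.hom_int_pow \<rho>.hom_one)
    then have "int (\<rho>.H.ord (\<rho> (\<phi> y))) dvd ?n" using \<phi>c[OF y(1)] by (simp add: \<rho>.H.int_pow_eq_id)
    then have "odd (\<rho>.H.ord (\<rho> (\<phi> y)))" using odd_U by (metis dvd_trans even_of_nat of_nat_dvd_iff)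
    moreover have "\<rho>.H.ord (\<rho> (\<phi> y)) dvd 8" 
      using \<rho>.H.ord_dvd_group_order[OF \<rho>.hom_closed[OF \<phi>c[OF y(1)]]] by (simp only: order_Q8)
    ultimately have "\<rho>.H.ord (\<rho> (\<phi> y)) = 1 \<and> 1 = \<rho>.H.ord (\<rho> (\<phi> y))"
      by (intro odd_times_divisor_of_8_cancel) simp_all
    then have "\<rho>.H.ord (\<rho> (\<phi> y)) = 1" by (rule conjunct1)
    then show ?thesis using \<rho>.H.ord_eq_1[OF \<rho>.hom_closed[OF \<phi>c[OF y(1)]]] by blast
  qed
  have \<pi>\<phi>: "\<pi> (\<phi> z) = \<one>\<^bsub>U\<^esub>" if z: "z \<in> H" "\<pi> z = \<one>\<^bsub>U\<^esub>" for z
  proof -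
    have "\<rho> z [^]\<^bsub>Q8\<^esub> (4::int) = \<one>\<^bsub>Q8\<^esub>"
      using \<rho>.H.int_pow_mult[of "\<rho> z" 2 2] \<rho>.H.int_pow_mult[of "\<rho> z" 1 1] HG[OF z(1)] Q8_pow_4[of "\<rho> z"] by simp
    then have "z [^] (4::int) = \<one>"
      by (intro inj) (use z HG in \<open>auto simp: \<pi>.hom_int_pow \<rho>.hom_int_pow\<close>)
    then have "\<phi> z [^] (4::int) = \<one>" using \<phi>p[OF z(1), of 4] \<phi>1 by simp
    then have "\<pi> (\<phi> z) [^]\<^bsub>U\<^esub> (4::int) = \<one>\<^bsub>U\<^esub>" using \<phi>c[OF z(1)] by (metis \<pi>.hom_int_pow \<pi>.hom_one)
    then show ?thesis using odd_power_eq_one[of "\<pi> (\<phi> z)" 4] \<phi>c[OF z(1)] by simp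
  qed
  define lift\<pi> where "lift\<pi> u = (SOME y. y \<in> H \<and> \<pi> y = u \<and> \<rho> y = \<one>\<^bsub>Q8\<^esub>)" for u
  define lift\<rho> where "lift\<rho> s = (SOME z. z \<in> H \<and> \<pi> z = \<one>\<^bsub>U\<^esub> \<and> \<rho> z = s)" for s
  have lp: "lift\<pi> u \<in> H" "\<pi> (lift\<pi> u) = u" "\<rho> (lift\<pi> u) = \<one>\<^bsub>Q8\<^esub>" if "u \<in> \<pi> ` H" for u
  proof -
    have "\<exists>y. y \<in> H \<and> \<pi> y = u \<and> \<rho> y = \<one>\<^bsub>Q8\<^esub>" using that subgroup_split[OF H] by (metis imageE)
    then have "lift\<pi> u \<in> H \<and> \<pi> (lift\<pi> u) = u \<and> \<rho> (lift\<pi> u) = \<one>\<^bsub>Q8\<^esub>" unfolding lift\<pi>_def by (rule someI_ex)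
    then show "lift\<pi> u \<in> H" "\<pi> (lift\<pi> u) = u" "\<rho> (lift\<pi> u) = \<one>\<^bsub>Q8\<^esub>" by auto
  qed
  have lr: "lift\<rho> s \<in> H" "\<pi> (lift\<rho> s) = \<one>\<^bsub>U\<^esub>" "\<rho> (lift\<rho> s) = s" if "s \<in> \<rho> ` H" for s
  proof -
    have "\<exists>z. z \<in> H \<and> \<pi> z = \<one>\<^bsub>U\<^esub> \<and> \<rho> z = s" using that subgroup_split[OF H] by (metis imageE)
    then have "lift\<rho> s \<in> H \<and> \<pi> (lift\<rho> s) = \<one>\<^bsub>U\<^esub> \<and> \<rho> (lift\<rho> s) = s" unfolding lift\<rho>_def by (rule someI_ex)
    then show "lift\<rho> s \<in> H" "\<pi> (lift\<rho> s) = \<one>\<^bsub>U\<^esub>" "\<rho> (lift\<rho> s) = s" by auto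
  qed
  have sub\<pi>: "subgroup (\<pi> ` H) U" by (rule \<pi>.subgroup_img_is_subgroup[OF H])
  have sub\<rho>: "subgroup (\<rho> ` H) Q8" by (rule \<rho>.subgroup_img_is_subgroup[OF H])
  obtain \<alpha> where \<alpha>: "\<alpha> \<in> auto U" "\<And>u. u \<in> \<pi> ` H \<Longrightarrow> \<alpha> u = \<pi> (\<phi> (lift\<pi> u))"
  proof (rule homogeneousD[OF hom sub\<pi>, of "\<lambda>u. \<pi> (\<phi> (lift\<pi> u))"])
    show "inj_on (\<lambda>u. \<pi> (\<phi> (lift\<pi> u))) (\<pi> ` H)"
    proof (rule inj_onI)
      fix u v assume uv: "u \<in> \<pi> ` H" "v \<in> \<pi> ` H" "\<pi> (\<phi> (lift\<pi> u)) = \<pi> (\<phi> (lift\<pi> v))"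
      then have "\<phi> (lift\<pi> u) = \<phi> (lift\<pi> v)"
        using lp \<rho>\<phi> \<phi>c by (intro inj) simp_all
      then have "lift\<pi> u = lift\<pi> v" using inj_onD[OF \<phi>(2)] lp uv by blast
      then show "u = v" using lp(2) uv by metis
    qed
    fix u v assume uv: "u \<in> \<pi> ` H" "v \<in> \<pi> ` H"
    then have w: "u \<otimes>\<^bsub>U\<^esub> v \<in> \<pi> ` H" using subgroup.m_closed[OF sub\<pi>] by blast
    have "lift\<pi> (u \<otimes>\<^bsub>U\<^esub> v) = lift\<pi> u \<otimes> lift\<pi> v"
      by (rule inj) (use lp[OF w] lp[OF uv(1)] lp[OF uv(2)] HG in auto)
    then show "\<pi> (\<phi> (lift\<pi> (u \<otimes>\<^bsub>U\<^esub> v))) = \<pi> (\<phi> (lift\<pi> u)) \<otimes>\<^bsub>U\<^esub> \<pi> (\<phi> (lift\<pi> v))"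
      using lp uv \<phi>m \<phi>c by simp
  qed (use lp \<phi>c in auto)
  obtain \<beta> where \<beta>: "\<beta> \<in> auto Q8" "\<And>s. s \<in> \<rho> ` H \<Longrightarrow> \<beta> s = \<rho> (\<phi> (lift\<rho> s))"
  proof (rule homogeneousD[OF homogeneous_Q8 sub\<rho>, of "\<lambda>s. \<rho> (\<phi> (lift\<rho> s))"])
    show "inj_on (\<lambda>s. \<rho> (\<phi> (lift\<rho> s))) (\<rho> ` H)"
    proof (rule inj_onI)
      fix u v assume uv: "u \<in> \<rho> ` H" "v \<in> \<rho> ` H" "\<rho> (\<phi> (lift\<rho> u)) = \<rho> (\<phi> (lift\<rho> v))"
      then have "\<phi> (lift\<rho> u) = \<phi> (lift\<rho> v)"
        using lr \<pi>\<phi> \<phi>c by (intro inj) simp_all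
      then have "lift\<rho> u = lift\<rho> v" using inj_onD[OF \<phi>(2)] lr uv by blast
      then show "u = v" using lr(3) uv by metis
    qed
    fix u v assume uv: "u \<in> \<rho> ` H" "v \<in> \<rho> ` H"
    then have w: "u \<otimes>\<^bsub>Q8\<^esub> v \<in> \<rho> ` H" using subgroup.m_closed[OF sub\<rho>] by blast
    have "lift\<rho> (u \<otimes>\<^bsub>Q8\<^esub> v) = lift\<rho> u \<otimes> lift\<rho> v"
      by (rule inj) (use lr[OF w] lr[OF uv(1)] lr[OF uv(2)] HG in auto)
    then show "\<rho> (\<phi> (lift\<rho> (u \<otimes>\<^bsub>Q8\<^esub> v))) = \<rho> (\<phi> (lift\<rho> u)) \<otimes>\<^bsub>Q8\<^esub> \<rho> (\<phi> (lift\<rho> v))"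
      using lr uv \<phi>m \<phi>c by simp
  qed (use lr \<phi>c in auto)
  define \<gamma> where "\<gamma> x = (SOME y. y \<in> carrier G \<and> \<pi> y = \<alpha> (\<pi> x) \<and> \<rho> y = \<beta> (\<rho> x))" for x
  have \<gamma>: "\<gamma> x \<in> carrier G" "\<pi> (\<gamma> x) = \<alpha> (\<pi> x)" "\<rho> (\<gamma> x) = \<beta> (\<rho> x)" if x: "x \<in> carrier G" for x
  proof -
    have "\<exists>y. y \<in> carrier G \<and> \<pi> y = \<alpha> (\<pi> x) \<and> \<rho> y = \<beta> (\<rho> x)"
      using surj[of "\<alpha> (\<pi> x)" "\<beta> (\<rho> x)"] U.auto_mult(2)[OF \<alpha>(1)] \<rho>.H.auto_mult(2)[OF \<beta>(1)] x by auto
    then have "\<gamma> x \<in> carrier G \<and> \<pi> (\<gamma> x) = \<alpha> (\<pi> x) \<and> \<rho> (\<gamma> x) = \<beta> (\<rho> x)" unfolding \<gamma>_def by (rule someI_ex)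
    then show "\<gamma> x \<in> carrier G" "\<pi> (\<gamma> x) = \<alpha> (\<pi> x)" "\<rho> (\<gamma> x) = \<beta> (\<rho> x)" by auto
  qed
  have inj\<alpha>: "inj_on \<alpha> (carrier U)" and inj\<beta>: "inj_on \<beta> (carrier Q8)"
    using \<alpha>(1) \<beta>(1) by (auto simp: auto_def Bij_def bij_betw_def)
  have auto: "restrict \<gamma> (carrier G) \<in> auto G"
  proof (rule restrict_in_auto[OF fin])
    show "inj_on \<gamma> (carrier G)"
    proof (rule inj_onI)
      fix x y assume xy: "x \<in> carrier G" "y \<in> carrier G" "\<gamma> x = \<gamma> y"
      then have "\<alpha> (\<pi> x) = \<alpha> (\<pi> y)" "\<beta> (\<rho> x) = \<beta> (\<rho> y)" using \<gamma> by metis+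
      then show "x = y" using inj_onD[OF inj\<alpha>] inj_onD[OF inj\<beta>] xy by (intro inj) auto
    qed
    show "\<gamma> (x \<otimes> y) = \<gamma> x \<otimes> \<gamma> y" if "x \<in> carrier G" "y \<in> carrier G" for x y
      using that \<gamma> U.auto_mult(1)[OF \<alpha>(1)] \<rho>.H.auto_mult(1)[OF \<beta>(1)] by (intro inj) auto
  qed (rule \<gamma>)
  have "\<gamma> x = \<phi> x" if x: "x \<in> H" for x
  proof -
    have im: "\<pi> x \<in> \<pi> ` H" "\<rho> x \<in> \<rho> ` H" using x by auto
    let ?y = "lift\<pi> (\<pi> x)" and ?z = "lift\<rho> (\<rho> x)"
    note y = lp[OF im(1)] and z = lr[OF im(2)]
    have "x = ?y \<otimes> ?z" by (rule inj) (use y z x HG in auto)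
    then have "\<phi> x = \<phi> ?y \<otimes> \<phi> ?z" using \<phi>m y(1) z(1) by metis
    then have "\<pi> (\<phi> x) = \<pi> (\<phi> ?y)" "\<rho> (\<phi> x) = \<rho> (\<phi> ?z)"
      using \<phi>c[OF y(1)] \<phi>c[OF z(1)] \<rho>\<phi>[OF y(1,3)] \<pi>\<phi>[OF z(1,2)] by simp_all
    then show ?thesis
      using \<gamma> \<alpha>(2)[OF im(1)] \<beta>(2)[OF im(2)] HG[OF x] \<phi>c[OF x] by (intro inj) simp_all
  qed
  then show "\<exists>\<alpha>\<in>auto G. \<forall>x\<in>H. \<alpha> x = \<phi> x" using auto HG by (intro bexI) auto
qed

section \<open>Normalising graph isomorphisms\<close>

lemma graph_isomorphism_trans:
  assumes f: "graph_isomorphism \<Gamma> \<Delta> f" and g: "graph_isomorphism \<Delta> \<Lambda> g"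
  shows "graph_isomorphism \<Gamma> \<Lambda> (g \<circ> f)"
proof -
  have "f u \<in> vertices \<Delta>" if "u \<in> vertices \<Gamma>" for u
    using f that bij_betwE unfolding graph_isomorphism_def by blast
  then show ?thesis
    using f g unfolding graph_isomorphism_def by (auto intro: bij_betw_trans)
qed

context group
begin

lemma edge_iff_quotient:
  assumes "S \<subseteq> carrier G" "x \<in> carrier G" "y \<in> carrier G"
  shows "{(x, i), (y, j)} \<in> edges (BCay G S) \<longleftrightarrow>
    i = 0 \<and> j = 1 \<and> y \<otimes> inv x \<in> S \<or> i = 1 \<and> j = 0 \<and> x \<otimes> inv y \<in> S"
proof -
  have "(\<exists>s\<in>S. y = s \<otimes> x) \<longleftrightarrow> y \<otimes> inv x \<in> S" if "x \<in> carrier G" "y \<in> carrier G" for x y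
  proof
    assume "\<exists>s\<in>S. y = s \<otimes> x"
    then show "y \<otimes> inv x \<in> S" using assms(1) that by (auto simp: m_assoc subset_iff)
  next
    assume "y \<otimes> inv x \<in> S"
    moreover have "y = (y \<otimes> inv x) \<otimes> x" using that by (simp add: m_assoc)
    ultimately show "\<exists>s\<in>S. y = s \<otimes> x" by blast
  qed
  from this[OF assms(2,3)] this[OF assms(3,2)] show ?thesis
    using assms by (auto simp: mem_edges_BCay)
qed

lemma right_translation_iso:
  assumes T: "T \<subseteq> carrier G" and w: "w \<in> carrier G"
  shows "graph_isomorphism (BCay G T) (BCay G T) (\<lambda>(x, j). (x \<otimes> w, j))"
  unfolding graph_isomorphism_def vertices_BCay
proof (intro conjI ballI)
  show "bij_betw (\<lambda>(x, j). (x \<otimes> w, j)) (carrier G \<times> {0, 1::nat}) (carrier G \<times> {0, 1})"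
    by (rule bij_betw_byWitness[where f' = "\<lambda>(x, j). (x \<otimes> inv w, j)"]) (use w in \<open>auto simp: m_assoc\<close>)
next
  fix u v assume "u \<in> carrier G \<times> {0, 1::nat}" "v \<in> carrier G \<times> {0, 1::nat}"
  then obtain x i y j where uv: "u = (x, i)" "v = (y, j)" "x \<in> carrier G" "y \<in> carrier G" by auto
  have c: "(b \<otimes> w) \<otimes> inv (a \<otimes> w) = b \<otimes> inv a" if "a \<in> carrier G" "b \<in> carrier G" for a b
    using that w by (simp add: inv_mult_group m_assoc)
  show "{u, v} \<in> edges (BCay G T) \<longleftrightarrow>
      {case u of (x, j) \<Rightarrow> (x \<otimes> w, j), case v of (x, j) \<Rightarrow> (x \<otimes> w, j)} \<in> edges (BCay G T)"
    using uv w by (simp add: edge_iff_quotient[OF T] c)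
qed

text \<open>The edge from \<open>(x, 0)\<close> to \<open>(t \<otimes> x, 1)\<close> becomes the one
  from \<open>(inv p \<otimes> (t \<otimes> x), 0)\<close> to \<open>(x, 1)\<close>, whose colour is
  \<open>inv t \<otimes> p\<close>. For \<open>p\<close> in \<open>T\<close> the new connection set
  contains \<open>\<one>\<close>.\<close>

lemma side_swap_iso:
  assumes T: "T \<subseteq> carrier G" and p: "p \<in> carrier G"
  shows "graph_isomorphism (BCay G T) (BCay G ((\<lambda>t. inv t \<otimes> p) ` T))
    (\<lambda>(x, j). if j = 0 then (x, 1) else (inv p \<otimes> x, 0))"
  unfolding graph_isomorphism_def vertices_BCay
proof (intro conjI ballI)
  let ?f = "\<lambda>(x, j::nat). if j = 0 then (x, 1::nat) else (inv p \<otimes> x, 0)"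
  let ?R = "(\<lambda>t. inv t \<otimes> p) ` T"
  show "bij_betw ?f (carrier G \<times> {0, 1}) (carrier G \<times> {0, 1})"
    by (rule bij_betw_byWitness[where f' = "\<lambda>(x, j). if j = 0 then (p \<otimes> x, 1) else (x, 0)"]) (use p in auto)
  fix u v assume "u \<in> carrier G \<times> {0, 1::nat}" "v \<in> carrier G \<times> {0, 1::nat}"
  then obtain x i y j where uv: "u = (x, i)" "v = (y, j)" "x \<in> carrier G" "y \<in> carrier G" "i \<in> {0, 1}" "j \<in> {0, 1}"
    by auto
  have R: "?R \<subseteq> carrier G" using T p by auto
  have c: "a \<otimes> inv (inv p \<otimes> b) \<in> ?R \<longleftrightarrow> b \<otimes> inv a \<in> T" if ab: "a \<in> carrier G" "b \<in> carrier G" for a b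
  proof -
    have "inv t \<otimes> p = a \<otimes> inv (inv p \<otimes> b) \<longleftrightarrow> t = b \<otimes> inv a" if t: "t \<in> T" for t
    proof -
      have tc: "t \<in> carrier G" using t T by auto
      have "a \<otimes> inv (inv p \<otimes> b) = inv (b \<otimes> inv a) \<otimes> p" using ab p by (simp add: inv_mult_group m_assoc)
      then have "inv t \<otimes> p = a \<otimes> inv (inv p \<otimes> b) \<longleftrightarrow> inv t = inv (b \<otimes> inv a)" using ab p tc by simp
      also have "\<dots> \<longleftrightarrow> t = b \<otimes> inv a" using ab tc by (metis inv_closed inv_inv m_closed)
      finally show ?thesis .
    qed
    then show ?thesis by (metis (no_types, lifting) image_iff)
  qed
  show "{u, v} \<in> edges (BCay G T) \<longleftrightarrow> {?f u, ?f v} \<in> edges (BCay G ?R)"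
    using uv p c by (auto simp: edge_iff_quotient[OF T] edge_iff_quotient[OF R])
qed

lemma ex_bicayley_iso:
  assumes "S \<subseteq> carrier G" "T \<subseteq> carrier G"
    and f: "graph_isomorphism (BCay G S) (BCay G T) f" "snd (f (\<one>, 0)) = 0"
  shows "\<exists>g. bicayley_iso G S T g"
proof -
  obtain y where y: "f (\<one>, 0) = (y, 0)" using f(2) by (metis prod.collapse)
  have "f (\<one>, 0) \<in> carrier G \<times> {0, 1}"
    using f(1) bij_betwE unfolding graph_isomorphism_def vertices_BCay by blast
  then have yG: "y \<in> carrier G" using y by simp
  have "graph_isomorphism (BCay G S) (BCay G T) ((\<lambda>(x, j). (x \<otimes> inv y, j)) \<circ> f)"
    using yG by (intro graph_isomorphism_trans[OF f(1)] right_translation_iso assms(2)) simp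
  then have "bicayley_iso G S T ((\<lambda>(x, j). (x \<otimes> inv y, j)) \<circ> f)"
    by (intro bicayley_iso.intro bicayley_iso_axioms.intro is_group assms(1,2)) (simp_all add: y yG)
  then show ?thesis by blast
qed

lemma affine_equiv_trans:
  assumes S: "S \<subseteq> carrier G" and 1: "affine_equiv S T" and 2: "affine_equiv T R"
  shows "affine_equiv S R"
proof -
  obtain g \<alpha> where g: "g \<in> carrier G" "\<alpha> \<in> auto G" "T = g <# (\<alpha> ` S)" using 1 by (auto simp: affine_equiv_def)
  obtain h \<beta> where h: "h \<in> carrier G" "\<beta> \<in> auto G" "R = h <# (\<beta> ` T)" using 2 by (auto simp: affine_equiv_def)
  have "compose (carrier G) \<beta> \<alpha> \<in> auto G"
    using g(2) h(2) by (auto simp: auto_def compose_Bij intro: hom_compose)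
  moreover have "R = (h \<otimes> \<beta> g) <# (compose (carrier G) \<beta> \<alpha> ` S)"
  proof -
    have "h \<otimes> \<beta> (g \<otimes> \<alpha> s) = h \<otimes> \<beta> g \<otimes> compose (carrier G) \<beta> \<alpha> s" if "s \<in> S" for s
      using that S g(1) h(1) auto_mult[OF g(2)] auto_mult[OF h(2)] by (auto simp: compose_def m_assoc subset_iff)
    then show ?thesis unfolding h(3) g(3) l_coset_def by auto
  qed
  moreover have "h \<otimes> \<beta> g \<in> carrier G" using g h auto_mult(2) by simp
  ultimately show ?thesis unfolding affine_equiv_def by blast
qed

lemma affine_equiv_empty: "affine_equiv {} {}"
  unfolding affine_equiv_def using id_in_auto by (auto simp: l_coset_def)

text \<open>Sets with at most two elements are degenerate triples \<open>p, q, q\<close>, whose only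
  parameter is the order of the span.\<close>

lemma affine_equiv_2:
  assumes bi: "bicayley_iso G {p, q} {p', q'} f" and fin: "finite (carrier G)" and hom: "homogeneous G"
  shows "affine_equiv {p, q} {p', q'}"
proof -
  interpret bicayley_iso G "{p, q}" "{p', q'}" f by fact
  have A: "commuting_triple G p q q" and B: "commuting_triple G p' q' q'"
    using S T by (unfold_locales; simp)+
  interpret A: commuting_triple G p q q by (rule A)
  interpret B: commuting_triple G p' q' q' by (rule B)
  have "ord (inv p \<otimes> q) = ord (inv p' \<otimes> q')"
    using A.card_diff_span_cyclic[OF fin, of 1] B.card_diff_span_cyclic[OF fin, of 1] card_diff_span[OF fin] by simp
  then have "affine_equiv {p, q, q} {p', q', q'}" by (intro affine_equiv_cyclic[OF hom A B, of 1]) simp_all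
  then show ?thesis by simp
qed

lemma card_le_3_cases:
  assumes "finite A" "card A \<le> 3" "p \<in> A"
  obtains q r where "A = {p, q, r}"
proof -
  have "card (A - {p}) \<le> 2" using assms by simp
  then consider "card (A - {p}) = 0" | "card (A - {p}) = 1" | "card (A - {p}) = 2" by linarith
  then show ?thesis
  proof cases
    case 1
    then have "A - {p} = {}" using assms(1) by (metis card_0_eq finite_Diff)
    then have "A = {p, p, p}" using assms(3) by auto
    then show ?thesis by (rule that)
  next
    case 2
    then obtain q where "A - {p} = {q}" by (auto simp: card_1_singleton_iff)
    then have "A = {p, q, q}" using assms(3) by auto
    then show ?thesis by (rule that)
  next
    case 3
    then obtain q r where "A - {p} = {q, r}" by (auto simp: card_2_iff)
    then have "A = {p, q, r}" using assms(3) by auto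
    then show ?thesis by (rule that)
  qed
qed

lemma BCI_group_3I:
  assumes fin: "finite (carrier G)" and hom: "homogeneous G"
    and inverse: "\<And>p q r. p \<in> carrier G \<Longrightarrow> q \<in> carrier G \<Longrightarrow> r \<in> carrier G \<Longrightarrow>
      affine_equiv {p, q, r} {\<one>, inv q \<otimes> p, inv r \<otimes> p}"
    and three: "\<And>S T f. bicayley_iso G S T f \<Longrightarrow> card S = 3 \<Longrightarrow> affine_equiv S T"
  shows "BCI_group 3 G"
  unfolding BCI_group_def
proof (intro allI impI)
  fix S assume S: "S \<subseteq> carrier G" and "\<exists>d\<le>3. has_valency (BCay G S) d"
  then obtain d where d: "d \<le> 3" "has_valency (BCay G S) d" by blast
  \<comment> \<open>One vertex is enough to read \<open>card S\<close> off the valency.\<close>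
  have "(\<one>, 0) \<in> vertices (BCay G S)" by simp
  then have "card S = d" using has_valency_BCay[OF S] d(2) unfolding has_valency_def by metis
  then have S3: "card S \<le> 3" using d by simp
  have finS: "finite S" using S fin by (rule finite_subset)
  have core: "affine_equiv S R" if bi: "bicayley_iso G S R g" for R g
  proof -
    interpret bicayley_iso G S R g by fact
    have finR: "finite R" using T fin by (rule finite_subset)
    consider "card S = 0" | "card S = 1" | "card S = 2" | "card S = 3" using S3 by linarith
    then show ?thesis
    proof cases
      case 1
      then have "S = {}" "R = {}" using card_eq finS finR by auto
      then show ?thesis using affine_equiv_empty by simp
    next
      case 2
      then obtain p p' where "S = {p, p}" "R = {p', p'}" using card_eq by (auto simp: card_1_singleton_iff)
      then show ?thesis using affine_equiv_2[of p p p' p' g] bi fin hom by simp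
    next
      case 3
      then obtain p q p' q' where "S = {p, q}" "R = {p', q'}" using card_eq by (metis card_2_iff)
      then show ?thesis using affine_equiv_2[of p q p' q' g] bi fin hom by simp
    next
      case 4
      then show ?thesis using three bi by blast
    qed
  qed
  show "BCI_graph G S"
    unfolding BCI_graph_def affine_equiv_def[symmetric] graph_isomorphic_def
  proof (intro allI impI, elim exE)
    fix T f assume T: "T \<subseteq> carrier G" and f: "graph_isomorphism (BCay G S) (BCay G T) f"
    have fv: "f v \<in> carrier G \<times> {0, 1}" if "v \<in> carrier G \<times> {0, 1}" for v
      using f that bij_betwE unfolding graph_isomorphism_def vertices_BCay by blast
    show "affine_equiv S T"
    proof (cases "snd (f (\<one>, 0)) = 0")
      case True
      then show ?thesis using ex_bicayley_iso[OF S T f] core by blast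
    next
      case False
      then have snd1: "snd (f (\<one>, 0)) = 1" using fv[of "(\<one>, 0)"] by auto
      show ?thesis
      \<comment> \<open>The exchange of sides is normalised by an element of \<open>T\<close>; if
        there is none, both graphs are without edges.\<close>
      proof (cases "T = {}")
        case True
        have "S = {}"
        proof (rule ccontr)
          assume "S \<noteq> {}"
          then obtain s where s: "s \<in> S" by blast
          then have "{(\<one>, 0), (s \<otimes> \<one>, 1)} \<in> edges (BCay G S)" by (intro edge_BCay) auto
          moreover have "(\<one>, 0) \<in> vertices (BCay G S)" "(s \<otimes> \<one>, 1) \<in> vertices (BCay G S)" using s S by auto
          ultimately have "{f (\<one>, 0), f (s \<otimes> \<one>, 1)} \<in> edges (BCay G T)"
            using f unfolding graph_isomorphism_def by blast
          then show False using True by (simp add: mem_edges_BCay)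
        qed
        then show ?thesis using True affine_equiv_empty by simp
      next
        case nonempty: False
        then obtain p where p: "p \<in> T" by blast
        then have pG: "p \<in> carrier G" using T by auto
        let ?R = "(\<lambda>t. inv t \<otimes> p) ` T" and ?s = "\<lambda>(x, j). if j = 0 then (x, 1) else (inv p \<otimes> x, 0)"
        have R: "?R \<subseteq> carrier G" using T pG by auto
        have "graph_isomorphism (BCay G S) (BCay G ?R) (?s \<circ> f)"
          by (rule graph_isomorphism_trans[OF f side_swap_iso[OF T pG]])
        moreover have "snd ((?s \<circ> f) (\<one>, 0)) = 0" using snd1 by (simp add: case_prod_beta)
        ultimately obtain g where g: "bicayley_iso G S ?R g" using ex_bicayley_iso[OF S R] by blast
        then have SR: "affine_equiv S ?R" by (rule core)
        have "inj_on (\<lambda>t. inv t \<otimes> p) T"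
        proof (rule inj_onI)
          fix t u assume "t \<in> T" "u \<in> T" "inv t \<otimes> p = inv u \<otimes> p"
          then show "t = u" using T pG by (metis inv_closed inv_inv r_cancel subsetD)
        qed
        then have "card T = card ?R" by (simp add: card_image)
        then have "card T \<le> 3" using bicayley_iso.card_eq[OF g] S3 by simp
        moreover have "finite T" using T fin by (rule finite_subset)
        ultimately obtain q r where qr: "T = {p, q, r}" using card_le_3_cases p by metis
        then have "?R = {\<one>, inv q \<otimes> p, inv r \<otimes> p}" using pG by simp
        then have "affine_equiv T ?R" using inverse[of p q r] qr T by simp
        then have "affine_equiv ?R T" by (rule affine_equiv_sym[OF T])
        with SR show ?thesis by (rule affine_equiv_trans[OF S])
      qed
    qed
  qed
qed

end

lemma (in comm_group) BCI_group_3_abelian: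
  assumes fin: "finite (carrier G)" and hom: "homogeneous G" and inv: "no_4_or_unique_involution G"
  shows "BCI_group 3 G"
proof (rule BCI_group_3I[OF fin hom])
  have comm: "commuting_triple G p q r" if "p \<in> carrier G" "q \<in> carrier G" "r \<in> carrier G" for p q r
    using that by unfold_locales (auto simp: m_comm)
  show "affine_equiv {p, q, r} {\<one>, inv q \<otimes> p, inv r \<otimes> p}"
    if "p \<in> carrier G" "q \<in> carrier G" "r \<in> carrier G" for p q r
    by (rule affine_equiv_inverse_commuting[OF hom comm[OF that]])
  show "affine_equiv S T" if bi: "bicayley_iso G S T f" and card: "card S = 3" for S T f
  proof -
    interpret bicayley_iso G S T f by fact
    have "commuting_set G S" "commuting_set G T"
      unfolding commuting_set_def using S T comm by blast+
    then show ?thesis by (rule affine_equiv_commuting_sets[OF fin hom inv card])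
  qed
qed

lemma (in q8_product) BCI_group_3_q8:
  assumes fin: "finite (carrier G)" and hom: "homogeneous U"
  shows "BCI_group 3 G"
  using homogeneous_q8_product[OF fin hom] affine_equiv_inverse affine_equiv_3[OF _ fin]
  by (intro BCI_group_3I[OF fin]) auto

section \<open>The groups of the theorem\<close>

lemma root_closed_iso:
  assumes G: "group G" "group G'" and h: "h \<in> iso G G'" and n: "root_closed n G'"
  shows "root_closed n G"
proof -
  interpret G: group G by (rule G(1))
  interpret h: group_hom G G' h
    using G h by (simp add: group_hom_def group_hom_axioms_def iso_def)
  have inj: "inj_on h (carrier G)" and surj: "h ` carrier G = carrier G'"
    using h by (auto simp: iso_def bij_betw_def)
  have pow: "x [^]\<^bsub>G\<^esub> m = y \<longleftrightarrow> h x [^]\<^bsub>G'\<^esub> m = h y" if "x \<in> carrier G" "y \<in> carrier G" for x y and m :: nat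
    using inj_onD[OF inj, of "x [^]\<^bsub>G\<^esub> m" y] that h.hom_nat_pow[of x m] by auto
  show ?thesis
    unfolding root_closed_def
  proof (intro conjI ballI allI impI)
    fix x assume x: "x \<in> carrier G"
    then show "x [^]\<^bsub>G\<^esub> n = \<one>\<^bsub>G\<^esub>" using n pow[OF x G.one_closed] by (simp add: root_closed_def)
  next
    fix p g assume p: "Factorial_Ring.prime p" "p dvd n" and g: "g \<in> carrier G" "g [^]\<^bsub>G\<^esub> (n div p) = \<one>\<^bsub>G\<^esub>"
    then have "h g [^]\<^bsub>G'\<^esub> (n div p) = \<one>\<^bsub>G'\<^esub>" using pow[OF g(1) G.one_closed] by simp
    then obtain y where "y \<in> carrier G'" "y [^]\<^bsub>G'\<^esub> p = h g"
      using n p g(1) unfolding root_closed_def by (meson h.hom_closed)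
    moreover from this obtain x where "x \<in> carrier G" "y = h x" using surj by blast
    ultimately show "\<exists>y\<in>carrier G. y [^]\<^bsub>G\<^esub> p = g" using pow g(1) by auto
  qed
qed

lemma root_closed_integer_mod_group:
  assumes n: "n > 0"
  shows "root_closed n (integer_mod_group n)"
  unfolding root_closed_def
proof (intro conjI ballI allI impI)
  fix p h assume p: "Factorial_Ring.prime p" "p dvd n" and h: "h \<in> carrier (integer_mod_group n)"
    and e: "h [^]\<^bsub>integer_mod_group n\<^esub> (n div p) = \<one>\<^bsub>integer_mod_group n\<^esub>"
  have pos: "p > 0" using p(1) prime_gt_0_nat by blast
  obtain m where m: "n = p * m" using p(2) by (elim dvdE)
  have hb: "0 \<le> h" "h < int n" using h n by (simp_all add: carrier_integer_mod_group)
  have "int m * h mod int n = 0" using e m pos by simp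
  then have "int m * int p dvd int m * h" using m by (simp add: mult.commute mod_0_imp_dvd)
  then have "int p dvd h" using n m by simp
  then obtain y where y: "h = int p * y" by (elim dvdE)
  have "0 \<le> y" using hb(1) y pos by (simp add: zero_le_mult_iff)
  moreover have "y \<le> h" using y pos \<open>0 \<le> y\<close> by (simp add: mult_le_cancel_right1)
  ultimately have "y \<in> carrier (integer_mod_group n)" using hb n by (simp add: carrier_integer_mod_group)
  moreover have "y [^]\<^bsub>integer_mod_group n\<^esub> p = h" using y hb by simp
  ultimately show "\<exists>y\<in>carrier (integer_mod_group n). y [^]\<^bsub>integer_mod_group n\<^esub> p = h" by blast
qed simp

lemma nat_pow_product_group:
  "x \<in> carrier (product_group I Gs) \<Longrightarrow>
    x [^]\<^bsub>product_group I Gs\<^esub> (m::nat) = (\<lambda>i\<in>I. x i [^]\<^bsub>Gs i\<^esub> m)"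
  by (induction m) (auto simp: restrict_def)

lemma root_closed_product_group:
  assumes n: "\<And>i. i \<in> I \<Longrightarrow> root_closed n (Gs i)"
  shows "root_closed n (product_group I Gs)"
  unfolding root_closed_def
proof (intro conjI ballI allI impI)
  fix x assume x: "x \<in> carrier (product_group I Gs)"
  then have "(\<lambda>i\<in>I. x i [^]\<^bsub>Gs i\<^esub> n) = (\<lambda>i\<in>I. \<one>\<^bsub>Gs i\<^esub>)"
    using n by (intro restrict_ext) (auto simp: root_closed_def PiE_mem)
  then show "x [^]\<^bsub>product_group I Gs\<^esub> n = \<one>\<^bsub>product_group I Gs\<^esub>"
    by (simp add: nat_pow_product_group[OF x])
next
  fix p h assume p: "Factorial_Ring.prime p" "p dvd n" and h: "h \<in> carrier (product_group I Gs)"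
    and e: "h [^]\<^bsub>product_group I Gs\<^esub> (n div p) = \<one>\<^bsub>product_group I Gs\<^esub>"
  have "\<exists>y. y \<in> carrier (Gs i) \<and> y [^]\<^bsub>Gs i\<^esub> p = h i" if i: "i \<in> I" for i
  proof -
    have "h i \<in> carrier (Gs i)" using h i by auto
    moreover have "h i [^]\<^bsub>Gs i\<^esub> (n div p) = \<one>\<^bsub>Gs i\<^esub>"
      using fun_cong[OF e, of i] h i by (simp add: nat_pow_product_group)
    ultimately show ?thesis using n[OF i] p unfolding root_closed_def by blast
  qed
  then obtain y where y: "\<And>i. i \<in> I \<Longrightarrow> y i \<in> carrier (Gs i) \<and> y i [^]\<^bsub>Gs i\<^esub> p = h i" by metis
  have yc: "restrict y I \<in> carrier (product_group I Gs)" using y by auto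
  have "h \<in> extensional I" using h by (simp add: PiE_def)
  then have "restrict y I [^]\<^bsub>product_group I Gs\<^esub> p = h"
    using y by (subst nat_pow_product_group[OF yc]) (auto simp: extensional_def restrict_def)
  with yc show "\<exists>y\<in>carrier (product_group I Gs). y [^]\<^bsub>product_group I Gs\<^esub> p = h" by blast
qed

lemma nat_pow_DirProd: "(x, y) [^]\<^bsub>G \<times>\<times> H\<^esub> (m::nat) = (x [^]\<^bsub>G\<^esub> m, y [^]\<^bsub>H\<^esub> m)"
  by (induction m) auto

lemma (in group) coprime_root:
  assumes x: "x \<in> carrier G" "x [^] (m::nat) = \<one>" and cop: "coprime m p"
  shows "\<exists>y\<in>carrier G. y [^] (p::nat) = x"
proof -
  obtain u v where uv: "u * int m + v * int p = 1"
    using bezout_int[of "int m" "int p"] cop by auto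
  have "1 - u * int m = v * int p" using uv by simp
  then have "(x [^] v) [^] p = x [^] (1 - u * int m)" using x(1) by (simp add: int_pow_pow flip: int_pow_int)
  also have "\<dots> = x \<otimes> inv ((x [^] int m) [^] u)"
    using x(1) by (simp add: int_pow_diff int_pow_pow mult.commute)
  also have "\<dots> = x" using x by (simp add: int_pow_int)
  finally show ?thesis using x(1) by blast
qed

text \<open>A prime divisor of \<open>n * m\<close> divides exactly one of the coprime exponents.
  The root comes from \<open>root_closed\<close> in that factor and from Bezout coefficients in the
  other.\<close>

lemma root_closed_DirProd:
  assumes G: "group G" "group H" and n: "root_closed n G" "root_closed m H" and cop: "coprime n m"
  shows "root_closed (n * m) (G \<times>\<times> H)"
proof -
  interpret G: group G by fact
  interpret H: group H by fact
  have eG: "x [^]\<^bsub>G\<^esub> n = \<one>\<^bsub>G\<^esub>" if "x \<in> carrier G" for x using n(1) that by (simp add: root_closed_def)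
  have eH: "x [^]\<^bsub>H\<^esub> m = \<one>\<^bsub>H\<^esub>" if "x \<in> carrier H" for x using n(2) that by (simp add: root_closed_def)
  have cancel: "k dvd l" if "(k::nat) dvd l * j" "coprime k j" for k l j :: nat
    using that coprime_dvd_mult_left_iff by blast
  show ?thesis
    unfolding root_closed_def
  proof (intro conjI ballI allI impI)
    fix x assume "x \<in> carrier (G \<times>\<times> H)"
    then show "x [^]\<^bsub>G \<times>\<times> H\<^esub> (n * m) = \<one>\<^bsub>G \<times>\<times> H\<^esub>"
      using eG eH by (auto simp: nat_pow_DirProd mult.commute[of n m] simp flip: H.nat_pow_pow G.nat_pow_pow)
  next
    fix p h assume p: "Factorial_Ring.prime p" "p dvd n * m" and "h \<in> carrier (G \<times>\<times> H)"
      and e: "h [^]\<^bsub>G \<times>\<times> H\<^esub> (n * m div p) = \<one>\<^bsub>G \<times>\<times> H\<^esub>"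
    then obtain u v where h: "h = (u, v)" "u \<in> carrier G" "v \<in> carrier H" by auto
    have uv: "G.ord u dvd n * m div p" "H.ord v dvd n * m div p"
      using e h by (simp_all add: nat_pow_DirProd G.pow_eq_id H.pow_eq_id)
    have ord: "G.ord u dvd n" "H.ord v dvd m" using eG[OF h(2)] eH[OF h(3)] h by (simp_all add: G.pow_eq_id H.pow_eq_id)
    consider "p dvd n" "\<not> p dvd m" | "p dvd m" "\<not> p dvd n"
      using p cop by (metis coprime_common_divisor_nat not_prime_1 prime_dvd_mult_iff)
    then have "(\<exists>y\<in>carrier G. y [^]\<^bsub>G\<^esub> p = u) \<and> (\<exists>y\<in>carrier H. y [^]\<^bsub>H\<^esub> p = v)"
    proof cases
      case 1
      have "n * m div p = (n div p) * m" using 1 by (simp add: dvd_div_mult)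
      moreover have "coprime (G.ord u) m" using ord(1) cop by (metis coprime_divisors dvd_refl)
      ultimately have "G.ord u dvd n div p" using uv(1) cancel by metis
      then have "u [^]\<^bsub>G\<^esub> (n div p) = \<one>\<^bsub>G\<^esub>" using h by (simp add: G.pow_eq_id)
      then have "\<exists>y\<in>carrier G. y [^]\<^bsub>G\<^esub> p = u" using n(1) p(1) 1 h unfolding root_closed_def by blast
      moreover have "coprime m p" using 1 p(1) prime_imp_coprime coprime_commute by blast
      ultimately show ?thesis using H.coprime_root[OF h(3) eH[OF h(3)]] by blast
    next
      case 2
      have "n * m div p = (m div p) * n" using dvd_div_mult[OF 2(1), of n] by (simp only: mult.commute[of n m])
      moreover have "coprime (H.ord v) n" using ord(2) cop by (metis coprime_commute coprime_divisors dvd_refl)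
      ultimately have "H.ord v dvd m div p" using uv(2) cancel by metis
      then have "v [^]\<^bsub>H\<^esub> (m div p) = \<one>\<^bsub>H\<^esub>" using h by (simp add: H.pow_eq_id)
      then have "\<exists>y\<in>carrier H. y [^]\<^bsub>H\<^esub> p = v" using n(2) p(1) 2 h unfolding root_closed_def by blast
      moreover have "coprime n p" using 2 p(1) prime_imp_coprime coprime_commute by blast
      ultimately show ?thesis using G.coprime_root[OF h(2) eG[OF h(2)]] by blast
    qed
    then obtain x y where "x \<in> carrier G" "y \<in> carrier H" "(x, y) [^]\<^bsub>G \<times>\<times> H\<^esub> p = h"
      using h(1) by (auto simp: nat_pow_DirProd)
    then show "\<exists>y\<in>carrier (G \<times>\<times> H). y [^]\<^bsub>G \<times>\<times> H\<^esub> p = h" by (intro bexI[of _ "(x, y)"]) auto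
  qed
qed

section \<open>The condition on elements of order two and four in the groups of the theorem\<close>

lemma no_4_or_unique_involution_iso:
  assumes G: "group G" "group G'" and h: "h \<in> iso G G'" and n: "no_4_or_unique_involution G'"
  shows "no_4_or_unique_involution G"
proof -
  interpret G: group G by (rule G(1))
  interpret h: group_hom G G' h
    using G h by (simp add: group_hom_def group_hom_axioms_def iso_def)
  have inj: "h x = h y \<longleftrightarrow> x = y" if "x \<in> carrier G" "y \<in> carrier G" for x y
    using h that by (auto simp: iso_def bij_betw_def dest: inj_onD)
  have pow: "x [^]\<^bsub>G\<^esub> i = \<one>\<^bsub>G\<^esub> \<longleftrightarrow> h x [^]\<^bsub>G'\<^esub> i = \<one>\<^bsub>G'\<^esub>" if "x \<in> carrier G" for x and i :: int
    using inj[of "x [^]\<^bsub>G\<^esub> i" "\<one>\<^bsub>G\<^esub>"] that h.hom_int_pow[of x i] by simp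
  have one: "x = \<one>\<^bsub>G\<^esub> \<longleftrightarrow> h x = \<one>\<^bsub>G'\<^esub>" if "x \<in> carrier G" for x using inj[of x "\<one>\<^bsub>G\<^esub>"] that by simp
  show ?thesis
    using n unfolding no_4_or_unique_involution_def
  proof (elim disjE, goal_cases)
    case 1
    then have "\<forall>x\<in>carrier G. x [^]\<^bsub>G\<^esub> (4::int) = \<one>\<^bsub>G\<^esub> \<longrightarrow> x [^]\<^bsub>G\<^esub> (2::int) = \<one>\<^bsub>G\<^esub>"
      using pow by simp
    then show ?case by (rule disjI1)
  next
    case 2
    show ?case
    proof (intro disjI2 ballI impI)
      fix x y assume xy: "x \<in> carrier G" "y \<in> carrier G" "x [^]\<^bsub>G\<^esub> (2::int) = \<one>\<^bsub>G\<^esub>" "y [^]\<^bsub>G\<^esub> (2::int) = \<one>\<^bsub>G\<^esub>"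
        "x \<noteq> \<one>\<^bsub>G\<^esub>" "y \<noteq> \<one>\<^bsub>G\<^esub>"
      have "h x = h y"
        by (rule 2[rule_format])
          (use xy pow[OF xy(1)] pow[OF xy(2)] one[OF xy(1)] one[OF xy(2)] in \<open>simp_all only: h.hom_closed simp_thms\<close>)
      then show "x = y" using inj[OF xy(1,2)] by blast
    qed
  qed
qed

lemma int_pow_DirProd:
  assumes "group G" "group H" "x \<in> carrier G" "y \<in> carrier H"
  shows "(x, y) [^]\<^bsub>G \<times>\<times> H\<^esub> (i::int) = (x [^]\<^bsub>G\<^esub> i, y [^]\<^bsub>H\<^esub> i)"
  using assms by (simp add: int_pow_def2 nat_pow_DirProd monoid.nat_pow_closed group.is_monoid del: pow_nat)

lemma no_4_or_unique_involution_DirProd: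
  assumes G: "group G" "group H" and odd: "odd (order G)" and n: "no_4_or_unique_involution H"
  shows "no_4_or_unique_involution (G \<times>\<times> H)"
proof -
  note pow = int_pow_DirProd[OF G]
  have one4: "x = \<one>\<^bsub>G\<^esub>" if "x \<in> carrier G" "x [^]\<^bsub>G\<^esub> (4::int) = \<one>\<^bsub>G\<^esub>" for x
    by (rule group.odd_order_pow_eq_one[OF G(1) odd that]) simp
  have one2: "x = \<one>\<^bsub>G\<^esub>" if "x \<in> carrier G" "x [^]\<^bsub>G\<^esub> (2::int) = \<one>\<^bsub>G\<^esub>" for x
    by (rule group.odd_order_pow_eq_one[OF G(1) odd that]) simp
  from n consider
      "\<forall>x\<in>carrier H. x [^]\<^bsub>H\<^esub> (4::int) = \<one>\<^bsub>H\<^esub> \<longrightarrow> x [^]\<^bsub>H\<^esub> (2::int) = \<one>\<^bsub>H\<^esub>"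
    | "\<forall>x\<in>carrier H. \<forall>y\<in>carrier H. x [^]\<^bsub>H\<^esub> (2::int) = \<one>\<^bsub>H\<^esub> \<longrightarrow> y [^]\<^bsub>H\<^esub> (2::int) = \<one>\<^bsub>H\<^esub> \<longrightarrow>
        x \<noteq> \<one>\<^bsub>H\<^esub> \<longrightarrow> y \<noteq> \<one>\<^bsub>H\<^esub> \<longrightarrow> x = y"
    unfolding no_4_or_unique_involution_def by blast
  then show ?thesis
  proof cases
    case 1
    have "w [^]\<^bsub>G \<times>\<times> H\<^esub> (2::int) = \<one>\<^bsub>G \<times>\<times> H\<^esub>"
      if w: "w \<in> carrier (G \<times>\<times> H)" "w [^]\<^bsub>G \<times>\<times> H\<^esub> (4::int) = \<one>\<^bsub>G \<times>\<times> H\<^esub>" for w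
    proof -
      obtain x y where xy: "w = (x, y)" "x \<in> carrier G" "y \<in> carrier H" using w(1) by auto
      then have "x [^]\<^bsub>G\<^esub> (4::int) = \<one>\<^bsub>G\<^esub>" "y [^]\<^bsub>H\<^esub> (4::int) = \<one>\<^bsub>H\<^esub>" using w(2) by (simp_all add: pow)
      then have "x = \<one>\<^bsub>G\<^esub>" "y [^]\<^bsub>H\<^esub> (2::int) = \<one>\<^bsub>H\<^esub>" using one4 1 xy by blast+
      then show ?thesis using xy group.int_pow_one[OF G(1)] by (simp add: pow)
    qed
    then show ?thesis unfolding no_4_or_unique_involution_def by blast
  next
    case 2
    have "w = w'"
      if w: "w \<in> carrier (G \<times>\<times> H)" "w [^]\<^bsub>G \<times>\<times> H\<^esub> (2::int) = \<one>\<^bsub>G \<times>\<times> H\<^esub>" "w \<noteq> \<one>\<^bsub>G \<times>\<times> H\<^esub>"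
        and w': "w' \<in> carrier (G \<times>\<times> H)" "w' [^]\<^bsub>G \<times>\<times> H\<^esub> (2::int) = \<one>\<^bsub>G \<times>\<times> H\<^esub>" "w' \<noteq> \<one>\<^bsub>G \<times>\<times> H\<^esub>" for w w'
    proof -
      have parts: "\<exists>y\<in>carrier H. w = (\<one>\<^bsub>G\<^esub>, y) \<and> y [^]\<^bsub>H\<^esub> (2::int) = \<one>\<^bsub>H\<^esub> \<and> y \<noteq> \<one>\<^bsub>H\<^esub>"
        if w: "w \<in> carrier (G \<times>\<times> H)" "w [^]\<^bsub>G \<times>\<times> H\<^esub> (2::int) = \<one>\<^bsub>G \<times>\<times> H\<^esub>" "w \<noteq> \<one>\<^bsub>G \<times>\<times> H\<^esub>" for w
      proof -
        obtain x y where xy: "w = (x, y)" "x \<in> carrier G" "y \<in> carrier H" using w(1) by auto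
        then have "x [^]\<^bsub>G\<^esub> (2::int) = \<one>\<^bsub>G\<^esub>" "y [^]\<^bsub>H\<^esub> (2::int) = \<one>\<^bsub>H\<^esub>" using w(2) by (simp_all add: pow)
        then show ?thesis using one2[of x] xy w(3) by auto
      qed
      obtain y where y: "y \<in> carrier H" "w = (\<one>\<^bsub>G\<^esub>, y)" "y [^]\<^bsub>H\<^esub> (2::int) = \<one>\<^bsub>H\<^esub>" "y \<noteq> \<one>\<^bsub>H\<^esub>"
        using parts[OF w] by blast
      obtain y' where y': "y' \<in> carrier H" "w' = (\<one>\<^bsub>G\<^esub>, y')" "y' [^]\<^bsub>H\<^esub> (2::int) = \<one>\<^bsub>H\<^esub>" "y' \<noteq> \<one>\<^bsub>H\<^esub>"
        using parts[OF w'] by blast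
      have "y = y'" using 2 y y' by blast
      then show ?thesis using y(2) y'(2) by simp
    qed
    then show ?thesis unfolding no_4_or_unique_involution_def by blast
  qed
qed

text \<open>The only involution is \<open>2 ^ (r - 1)\<close>; for \<open>r = 0\<close> there is
  none.\<close>

lemma no_4_or_unique_involution_cyclic: "no_4_or_unique_involution (integer_mod_group (2 ^ r))"
proof -
  have "x = 2 ^ (r - 1)"
    if x: "x \<in> carrier (integer_mod_group (2 ^ r))" "x [^]\<^bsub>integer_mod_group (2 ^ r)\<^esub> (2::int) = \<one>\<^bsub>integer_mod_group (2 ^ r)\<^esub>"
      and ne: "x \<noteq> \<one>\<^bsub>integer_mod_group (2 ^ r)\<^esub>" for x
  proof -
    have xb: "0 < x" "x < 2 ^ r" using x(1) ne by (simp_all add: carrier_integer_mod_group)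
    then obtain s where s: "r = Suc s" by (cases r) auto
    have "2 ^ r dvd 2 * x" using x(2) by (simp add: int_pow_integer_mod_group mod_0_imp_dvd)
    then obtain k where "2 * x = 2 ^ r * k" by (elim dvdE)
    then have k: "x = 2 ^ s * k" using s by simp
    then have "0 < k" "k < 2" using xb s by (simp_all add: zero_less_mult_iff)
    then have "k = 1" by simp
    then show ?thesis using k s by simp
  qed
  then show ?thesis unfolding no_4_or_unique_involution_def by metis
qed

lemma no_4_or_unique_involution_elementary:
  "no_4_or_unique_involution (product_group I (\<lambda>_. integer_mod_group 2))"
proof -
  let ?P = "product_group I (\<lambda>_. integer_mod_group 2)"
  have "root_closed 2 ?P" by (intro root_closed_product_group root_closed_integer_mod_group) simp
  then have "x [^]\<^bsub>?P\<^esub> (2::int) = \<one>\<^bsub>?P\<^esub>" if "x \<in> carrier ?P" for x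
    using that by (simp add: root_closed_def int_pow_int[of _ _ 2, simplified])
  then show ?thesis unfolding no_4_or_unique_involution_def by blast
qed

lemma comm_group_iso:
  assumes "group G" "comm_group H" "G \<cong> H"
  shows "comm_group G"
  using assms comm_group.iso_imp_comm_group group.iso_sym group.is_monoid by blast

lemma comm_group_product_group: "(\<And>i. i \<in> I \<Longrightarrow> comm_group (Gs i)) \<Longrightarrow> comm_group (product_group I Gs)"
  by (rule group.group_comm_groupI)
    (auto intro!: restrict_ext comm_monoid.m_comm comm_group.axioms(1) simp: PiE_mem comm_group.axioms(2))

lemma comm_group_DirProd: "comm_group G \<Longrightarrow> comm_group H \<Longrightarrow> comm_group (G \<times>\<times> H)"
  by (rule group.group_comm_groupI) (auto intro: DirProd_group comm_group.axioms(2) comm_monoid.m_comm[OF comm_group.axioms(1)])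

lemma homocyclic_root_closed:
  assumes U: "homocyclic U" and odd: "odd (order U)"
  shows "comm_group U \<and> (\<exists>m. odd m \<and> root_closed m U)"
proof -
  obtain n k :: nat where gU: "group U" and n: "n > 0" and iso: "U \<cong> product_group {..<k} (\<lambda>_. integer_mod_group n)"
    using U unfolding homocyclic_def by blast
  let ?P = "product_group {..<k} (\<lambda>_. integer_mod_group n)"
  have gP: "group ?P" by simp
  obtain h where h: "h \<in> iso U ?P" using iso by (auto simp: is_iso_def)
  have comm: "comm_group U"
    by (rule comm_group_iso[OF gU _ iso]) (rule comm_group_product_group, simp)
  have rP: "root_closed n ?P" by (intro root_closed_product_group root_closed_integer_mod_group n)
  have ord: "order U = n ^ k"
  proof -
    have "order U = order ?P" using h by (rule iso_same_order)
    also have "\<dots> = n ^ k" using n by (simp add: order_def card_PiE carrier_integer_mod_group)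
    finally show ?thesis .
  qed
  have "\<exists>m. odd m \<and> root_closed m U"
  \<comment> \<open>The empty product is trivial whatever \<open>n\<close> is, so \<open>n\<close>
    may be even there; the odd exponent is then \<open>1\<close>.\<close>
  proof (cases "k = 0")
    case True
    interpret group U by (rule gU)
    have "order U = 1" using ord True by simp
    then have "carrier U = {\<one>\<^bsub>U\<^esub>}" by (rule iffD1[OF order_one_triv_iff])
    then have "root_closed 1 U" by (auto simp: root_closed_def)
    then show ?thesis by (metis odd_one)
  next
    case False
    then have "odd n" using odd ord by simp
    then show ?thesis using root_closed_iso[OF gU gP h rP] by blast
  qed
  with comm show ?thesis by blast
qed

theorem theorem1p2:
  fixes G :: "('a, 'x) monoid_scheme"
    and U :: "('b, 'y) monoid_scheme"
    and V :: "('c, 'z) monoid_scheme"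
  assumes "group G" and "finite (carrier G)"
    and "group U" and "group V" and "G \<cong> U \<times>\<times> V"
    and "homocyclic U" and "odd (order U)"
    and "trivial_group V
       \<or> (\<exists>r\<ge>1. V \<cong> integer_mod_group (2 ^ r))
       \<or> (\<exists>r\<ge>1. V \<cong> product_group {..<r::nat} (\<lambda>_. integer_mod_group 2))
       \<or> V \<cong> Q8"
  shows "BCI_group 3 G"
proof -
  note G = assms(1) and fin = assms(2) and U = assms(3) and V = assms(4)
  obtain m where m: "odd m" "root_closed m U" and cU: "comm_group U"
    using homocyclic_root_closed[OF assms(6,7)] by blast
  have m0: "m > 0" using m(1) by (rule odd_pos)
  have UV: "group (U \<times>\<times> V)" by (rule DirProd_group[OF U V])
  obtain h where h: "h \<in> iso G (U \<times>\<times> V)" using assms(5) by (auto simp: is_iso_def)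
  \<comment> \<open>The common argument for the abelian choices of \<open>V\<close>, whose exponent
    \<open>n\<close> is coprime to the odd exponent of \<open>U\<close>.\<close>
  have abelian: "BCI_group 3 G"
    if cV: "comm_group V" and rV: "root_closed n V" "coprime m n" "n > 0" and nV: "no_4_or_unique_involution V" for n
  proof -
    interpret G: comm_group G
      by (rule comm_group_iso[OF G _ assms(5)]) (rule comm_group_DirProd[OF cU cV])
    have "root_closed (m * n) G"
      by (rule root_closed_iso[OF G UV h root_closed_DirProd[OF U V m(2) rV(1,2)]])
    then have "homogeneous G" using m0 rV(3) by (intro G.homogeneous_of_root_closed[OF fin, of "m * n"]) simp_all
    moreover have "no_4_or_unique_involution G"
      by (rule no_4_or_unique_involution_iso[OF G UV h no_4_or_unique_involution_DirProd[OF U V assms(7) nV]])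
    ultimately show ?thesis by (rule G.BCI_group_3_abelian[OF fin])
  qed
  from assms(8) consider "trivial_group V" | r where "V \<cong> integer_mod_group (2 ^ r)"
    | r :: nat where "V \<cong> product_group {..<r} (\<lambda>_. integer_mod_group 2)" | "V \<cong> Q8" by blast
  then show ?thesis
  proof cases
    case 1
    then have V1: "carrier V = {\<one>\<^bsub>V\<^esub>}" by (simp add: trivial_group_def)
    interpret V: group V by (rule V)
    have "comm_group V" using V1 by (intro V.group_comm_groupI) auto
    moreover have "root_closed 1 V" "no_4_or_unique_involution V"
      using V1 by (auto simp: root_closed_def no_4_or_unique_involution_def)
    ultimately show ?thesis using abelian[of 1] by simp
  next
    case 2
    obtain k where k: "k \<in> iso V (integer_mod_group (2 ^ r))" using 2 by (auto simp: is_iso_def)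
    show ?thesis
    proof (rule abelian[of "2 ^ r"])
      show "comm_group V" by (rule comm_group_iso[OF V _ 2]) simp
      show "root_closed (2 ^ r) V"
        by (rule root_closed_iso[OF V _ k root_closed_integer_mod_group]) simp_all
      show "no_4_or_unique_involution V"
        by (rule no_4_or_unique_involution_iso[OF V _ k no_4_or_unique_involution_cyclic]) simp
    qed (use m in simp_all)
  next
    case 3
    obtain k where k: "k \<in> iso V (product_group {..<r} (\<lambda>_. integer_mod_group 2))" using 3 by (auto simp: is_iso_def)
    show ?thesis
    proof (rule abelian[of 2])
      show "comm_group V" by (rule comm_group_iso[OF V _ 3]) (rule comm_group_product_group, simp)
      show "root_closed 2 V"
        by (rule root_closed_iso[OF V _ k root_closed_product_group[OF root_closed_integer_mod_group]]) simp_all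
      show "no_4_or_unique_involution V"
        by (rule no_4_or_unique_involution_iso[OF V _ k no_4_or_unique_involution_elementary]) simp
    qed (use m in simp_all)
  next
    case 4
    then obtain k where k: "k \<in> iso V Q8" by (auto simp: is_iso_def)
    have h1: "fst \<circ> h \<in> hom G U" "snd \<circ> h \<in> hom G V" using h hom_pairwise by (auto simp: iso_def)
    have kb: "inj_on k (carrier V)" "k ` carrier V = carrier Q8" "k \<in> hom V Q8" using k by (auto simp: iso_def bij_betw_def)
    have hb: "inj_on h (carrier G)" "h ` carrier G = carrier U \<times> carrier V" using h by (auto simp: iso_def bij_betw_def)
    interpret q8_product G U "fst \<circ> h" "k \<circ> (snd \<circ> h)"
    proof (intro q8_product.intro q8_product_axioms.intro G cU assms(7) h1(1) hom_compose[OF h1(2) kb(3)])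
      fix x y assume xy: "x \<in> carrier G" "y \<in> carrier G" "(fst \<circ> h) x = (fst \<circ> h) y" "(k \<circ> (snd \<circ> h)) x = (k \<circ> (snd \<circ> h)) y"
      have "snd (h x) \<in> carrier V" "snd (h y) \<in> carrier V"
        using hom_in_carrier[OF h1(2) xy(1)] hom_in_carrier[OF h1(2) xy(2)] by simp_all
      then have "snd (h x) = snd (h y)" using inj_onD[OF kb(1)] xy(4) by simp
      then show "x = y" using inj_onD[OF hb(1)] xy by (simp add: prod_eq_iff)
    next
      fix u s assume us: "u \<in> carrier U" "s \<in> carrier Q8"
      then obtain v where v: "v \<in> carrier V" "k v = s" using kb(2) by (metis imageE)
      then have "(u, v) \<in> h ` carrier G" using us hb(2) by simp
      then obtain x where "x \<in> carrier G" "h x = (u, v)" by (metis imageE)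
      then show "\<exists>x\<in>carrier G. (fst \<circ> h) x = u \<and> (k \<circ> (snd \<circ> h)) x = s"
        using v(2) by (intro bexI[of _ x]) simp_all
    qed
    interpret U: comm_group U by (rule cU)
    have "finite (carrier U)" using assms(7) by (metis card.infinite even_zero order_def)
    then have "homogeneous U" using m(2) m0 by (rule U.homogeneous_of_root_closed)
    then show ?thesis by (rule BCI_group_3_q8[OF fin])
  qed
qed

end
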